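(* Let $G=\mathbb{Z}_2$ with $\rho(0)=1,\rho(1)=-1$. Suppose $\beta_0,\kappa_0\ge 0$ satisfy (a1) $e^{-4\beta_0}+4e^{-4\kappa_0}<1$, (a2) $2^{1/3}\cdot 5\, e^{-4\beta_0}e^{-4\kappa_0/6}<1$, and (a3) $18^2 e^{-4\kappa_0}(2+e^{-4\kappa_0})<1$. Then there is a constant $C=C(\beta_0,\kappa_0)<\infty$ such that for all $\beta\ge\beta_0$, $\kappa\ge\kappa_0$ with $3\beta\ge 2\kappa$, and every simple loop $\gamma$ in $\mathbb{Z}^4$, $$\Bigl|\langle W_\gamma\rangle_{\beta,\kappa}-\Upsilon_{\gamma,\beta,\kappa}\Bigr|\le C\Bigl(e^{-4(\beta+\kappa/6)}+\sqrt{|\gamma_c|/|\gamma|}\Bigr)^{2/7},$$ where $$\Upsilon_{\gamma,\beta,\kappa}=\Bigl\langle \exp\Bigl(-2|\gamma|e^{-24\beta-4\kappa}\Bigl(1+\tfrac{|\{e\in\gamma:\sigma_e=1\}|}{|\gamma|}(e^{8\kappa}-1)\Bigr)\Bigr)\Bigr\rangle_{\infty,\kappa}.$$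
   Context: Setup. Work on $\mathbb{Z}^4$ with unit vectors $\mathbf e_1,\dots,\mathbf e_4$. Each pair of nearest neighbours gives two oriented edges $e$ and $-e$ (opposite orientations); $(x,y)$ denotes the edge oriented from $x$ to $y$; $dx_j:=(x,x+\mathbf e_j)$ is positively oriented. For $x\in\mathbb Z^4$, $j_1<j_2$, the positively oriented plaquette $p=dx_{j_1}\wedge dx_{j_2}$ has oriented boundary $\partial p=\{dx_{j_1},\,d(x+\mathbf e_{j_1})_{j_2},\,-d(x+\mathbf e_{j_2})_{j_1},\,-dx_{j_2}\}$, and $-p$ is the oppositely oriented plaquette with $\partial(-p)=-\partial p$. For an oriented edge $e$, $\hat\partial e$ is the set of oriented plaquettes $p$ with $e\in\partial p$ ($|\hat\partial e|=6$); for sets, $\partial A=\bigcup_{p\in A}\partial p$ and $\hat\partial B=\bigcup_{e\in B}\hat\partial e$. $B_N=[-N,N]^4\cap\mathbb Z^4$, $V_N$ its vertices, and $E_N$, $P_N$ are the oriented edges/plaquettes all of whose vertices lie in $B_N$. $G=\mathbb Z_n$ ($n\ge 2$) with a faithful unitary one-dimensional representation $\rho$. $\Sigma_{E_N}$ is the set of maps $\sigma:E_N\to G$ with $\sigma_{-e}=-\sigma_e$; $(d\sigma)_p=\sum_{e\in\partial p}\sigma_e$; $\Sigma^0_{E_N}=\{\sigma\in\Sigma_{E_N}:d\sigma=0\}$. Measures. For $\beta,\kappa\ge0$: $\mu_{N,\infty,\kappa}(\sigma)=Z^{-1}\exp(\kappa\sum_{e\in E_N}\rho(\sigma_e))$ for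 $\sigma\in\Sigma^0_{E_N}$, with expectation $\mathbb E_{N,\infty,\kappa}$. The fixed-length lattice Higgs model is the probability measure on $\Sigma_{E_N}\times\Phi_{V_N}$, where $\Phi_{V_N}$ is the set of maps $\phi:V_N\to\rho(G)$, given by $\mu_{N,\beta,\kappa,\infty}(\sigma,\phi)=Z^{-1}\exp\bigl(\beta\sum_{p\in P_N}\rho((d\sigma)_p)+\kappa\sum_{e=(x,y)\in E_N}\overline{\phi_y}\rho(\sigma_e)\phi_x\bigr)$, expectation $\mathbb E_{N,\beta,\kappa,\infty}$. A simple loop is a finite set $\gamma$ of oriented edges such that $e\in\gamma\Rightarrow -e\notin\gamma$ and the edges of $\gamma$ can be ordered to form an oriented loop. The Wilson loop is $W_\gamma=\rho(\sum_{e\in\gamma}\sigma_e)$. $\gamma_c$ (corner edges) is the set of $e\in\gamma$ sharing a plaquette with at least one other edge of $\gamma\cup(-\gamma)$. $\langle W_\gamma\rangle_{\beta,\kappa}:=\lim_{N\to\infty}\mathbb E_{N,\beta,\kappa,\infty}[W_\gamma]$ and, for a function $f$ of finitely many edge spins, $\langle f\rangle_{\infty,\kappa}:=\lim_{N\to\infty}\mathbb E_{N,\infty,\kappa}[f]$; these limits exist. *)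

theory Defs
  imports Complex_Main
begin

text \<open>Vertices of Z^4 are functions nat => int vanishing at indices >= 4
  (coordinates 0..3 correspond to e_1..e_4). An oriented edge is a pair (x,y).
  The group G = Z_2 is represented by integer representatives (0 or 1),
  with rho g = (-1)^g.\<close>

type_synonym vtx = "nat \<Rightarrow> int"
type_synonym edge = "vtx \<times> vtx"

definition lattice :: "vtx set" where
  "lattice = {x. \<forall>i\<ge>4. x i = 0}"

definition unitv :: "nat \<Rightarrow> vtx" where
  "unitv j = (\<lambda>i. if i = j then 1 else 0)"

definition vplus :: "vtx \<Rightarrow> vtx \<Rightarrow> vtx" where
  "vplus x y = (\<lambda>i. x i + y i)"

definition rev_edge :: "edge \<Rightarrow> edge" where
  "rev_edge e = (snd e, fst e)"

definition nn_edge :: "edge \<Rightarrow> bool" where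
  "nn_edge e \<longleftrightarrow> fst e \<in> lattice \<and>
     (\<exists>j<4. snd e = vplus (fst e) (unitv j) \<or> fst e = vplus (snd e) (unitv j))"

text \<open>An oriented plaquette is identified with its oriented boundary (set of 4 oriented edges).\<close>
definition pos_plaq :: "vtx \<Rightarrow> nat \<Rightarrow> nat \<Rightarrow> edge set" where
  "pos_plaq x j1 j2 =
     {(x, vplus x (unitv j1)),
      (vplus x (unitv j1), vplus (vplus x (unitv j1)) (unitv j2)),
      (vplus (vplus x (unitv j2)) (unitv j1), vplus x (unitv j2)),
      (vplus x (unitv j2), x)}"

definition plaquettes :: "edge set set" where
  "plaquettes = {p. \<exists>x\<in>lattice. \<exists>j1 j2. j1 < j2 \<and> j2 < 4 \<and>
                    (p = pos_plaq x j1 j2 \<or> p = rev_edge ` pos_plaq x j1 j2)}"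

definition box :: "nat \<Rightarrow> vtx set" where
  "box N = {x \<in> lattice. \<forall>i<4. \<bar>x i\<bar> \<le> int N}"

definition edges_box :: "nat \<Rightarrow> edge set" where
  "edges_box N = {e. nn_edge e \<and> fst e \<in> box N \<and> snd e \<in> box N}"

definition plaqs_box :: "nat \<Rightarrow> edge set set" where
  "plaqs_box N = {p \<in> plaquettes. \<forall>e\<in>p. fst e \<in> box N \<and> snd e \<in> box N}"

definition rho :: "int \<Rightarrow> real" where
  "rho g = (if even g then 1 else -1)"

definition dsig :: "(edge \<Rightarrow> int) \<Rightarrow> edge set \<Rightarrow> int" where
  "dsig \<sigma> p = (\<Sum>e\<in>p. \<sigma> e)"

text \<open>Sigma_{E_N} for G = Z_2 (where -g = g); configurations extended by 0 outside E_N.\<close>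
definition spin_configs :: "nat \<Rightarrow> (edge \<Rightarrow> int) set" where
  "spin_configs N = {\<sigma>. (\<forall>e\<in>edges_box N. \<sigma> e \<in> {0,1} \<and> \<sigma> (rev_edge e) = \<sigma> e)
                        \<and> (\<forall>e. e \<notin> edges_box N \<longrightarrow> \<sigma> e = 0)}"

definition flat_configs :: "nat \<Rightarrow> (edge \<Rightarrow> int) set" where
  "flat_configs N = {\<sigma> \<in> spin_configs N. \<forall>p\<in>plaqs_box N. even (dsig \<sigma> p)}"

definition higgs_configs :: "nat \<Rightarrow> (vtx \<Rightarrow> real) set" where
  "higgs_configs N = {\<phi>. (\<forall>x\<in>box N. \<phi> x \<in> {1, -1}) \<and> (\<forall>x. x \<notin> box N \<longrightarrow> \<phi> x = 1)}"

definition higgs_weight :: "nat \<Rightarrow> real \<Rightarrow> real \<Rightarrow> (edge \<Rightarrow> int) \<Rightarrow> (vtx \<Rightarrow> real) \<Rightarrow> real" where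
  "higgs_weight N \<beta> \<kappa> \<sigma> \<phi> =
     exp (\<beta> * (\<Sum>p\<in>plaqs_box N. rho (dsig \<sigma> p))
          + \<kappa> * (\<Sum>e\<in>edges_box N. \<phi> (snd e) * rho (\<sigma> e) * \<phi> (fst e)))"

definition higgs_exp :: "nat \<Rightarrow> real \<Rightarrow> real \<Rightarrow> ((edge \<Rightarrow> int) \<Rightarrow> (vtx \<Rightarrow> real) \<Rightarrow> real) \<Rightarrow> real" where
  "higgs_exp N \<beta> \<kappa> f =
     (\<Sum>(\<sigma>,\<phi>)\<in>spin_configs N \<times> higgs_configs N. higgs_weight N \<beta> \<kappa> \<sigma> \<phi> * f \<sigma> \<phi>)
     / (\<Sum>(\<sigma>,\<phi>)\<in>spin_configs N \<times> higgs_configs N. higgs_weight N \<beta> \<kappa> \<sigma> \<phi>)"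

definition gauge_weight :: "nat \<Rightarrow> real \<Rightarrow> (edge \<Rightarrow> int) \<Rightarrow> real" where
  "gauge_weight N \<kappa> \<sigma> = exp (\<kappa> * (\<Sum>e\<in>edges_box N. rho (\<sigma> e)))"

definition gauge_exp :: "nat \<Rightarrow> real \<Rightarrow> ((edge \<Rightarrow> int) \<Rightarrow> real) \<Rightarrow> real" where
  "gauge_exp N \<kappa> f =
     (\<Sum>\<sigma>\<in>flat_configs N. gauge_weight N \<kappa> \<sigma> * f \<sigma>) / (\<Sum>\<sigma>\<in>flat_configs N. gauge_weight N \<kappa> \<sigma>)"

definition wilson :: "edge set \<Rightarrow> (edge \<Rightarrow> int) \<Rightarrow> real" where
  "wilson \<gamma> \<sigma> = rho (\<Sum>e\<in>\<gamma>. \<sigma> e)"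

text \<open>Infinite-volume limits (which exist by the paper's standing facts).\<close>
definition wilson_lim :: "real \<Rightarrow> real \<Rightarrow> edge set \<Rightarrow> real" where
  "wilson_lim \<beta> \<kappa> \<gamma> = lim (\<lambda>N. higgs_exp N \<beta> \<kappa> (\<lambda>\<sigma> \<phi>. wilson \<gamma> \<sigma>))"

definition gauge_lim :: "real \<Rightarrow> ((edge \<Rightarrow> int) \<Rightarrow> real) \<Rightarrow> real" where
  "gauge_lim \<kappa> f = lim (\<lambda>N. gauge_exp N \<kappa> f)"

definition simple_loop :: "edge set \<Rightarrow> bool" where
  "simple_loop \<gamma> \<longleftrightarrow> finite \<gamma> \<and> (\<forall>e\<in>\<gamma>. nn_edge e) \<and> (\<forall>e\<in>\<gamma>. rev_edge e \<notin> \<gamma>) \<and>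
     (\<exists>l. l \<noteq> [] \<and> distinct l \<and> set l = \<gamma> \<and>
          (\<forall>i. Suc i < length l \<longrightarrow> snd (l ! i) = fst (l ! Suc i)) \<and>
          snd (last l) = fst (hd l))"

definition corner_edges :: "edge set \<Rightarrow> edge set" where
  "corner_edges \<gamma> = {e \<in> \<gamma>. \<exists>p\<in>plaquettes. e \<in> p \<and>
                        (\<exists>e'\<in>\<gamma> \<union> rev_edge ` \<gamma>. e' \<noteq> e \<and> e' \<in> p)}"

definition Upsilon :: "edge set \<Rightarrow> real \<Rightarrow> real \<Rightarrow> real" where
  "Upsilon \<gamma> \<beta> \<kappa> = gauge_lim \<kappa> (\<lambda>\<sigma>.
     exp (- 2 * real (card \<gamma>) * exp (- 24 * \<beta> - 4 * \<kappa>) *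
          (1 + real (card {e \<in> \<gamma>. \<sigma> e = 1}) / real (card \<gamma>) * (exp (8 * \<kappa>) - 1))))"

end

theory Submission
  imports Defs
begin

text \<open>
  In unitary gauge the Higgs field disappears and a configuration is the set \<open>A\<close> of unoriented edges
  with spin 1, of weight \<open>x ^ |A| * y ^ |dA|\<close> with \<open>x = exp (- 4 \<kappa>)\<close> and \<open>y = exp (- 4 \<beta>)\<close>, where \<open>dA\<close>
  is the set of plaquettes with an odd number of edges in \<open>A\<close>; \<open>y = 0\<close> gives the flat measure.
  Since \<open>324 (2 x + x^2) < 1\<close>, the connected clusters of the union of two independent configurations are
  subcritical. Exchanging the two configurations on suitable clusters (an involution preserving the
  product weight) couples different boxes, whence the infinite volume limits, and couples
  \<open>y > 0\<close> with \<open>y = 0\<close>.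

  Resampling a non-corner edge \<open>e\<close> of the loop replaces its sign by \<open>(1 - r) / (1 + r)\<close>, where
  \<open>r = x y ^ (6 - 2 u)\<close> and \<open>u\<close> is the number of frustrated plaquettes at \<open>e\<close> when the spin of \<open>e\<close> is dropped.
  Typically \<open>u = 0\<close> or \<open>u = 6\<close>, and the product of the absolute values of these factors is
  close to the integrand of Upsilon at the coupled flat configuration. A cluster with at most six frustrated
  plaquettes is a single flipped edge up to a flat set, and flat sets meet a loop in an even number of
  edges; hence the product of the signs is 1 outside an event of probability
  of order \<open>x y ^ 6 (n y + m)\<close>, \<open>n\<close> and \<open>m\<close> being the numbers of edges and of corner edges.
  So the error is at most of this order, while both expectations are at most \<open>exp (- x y ^ 6 (n - m))\<close>;
  interpolating between the two bounds even gives the exponent 3/10 in place of 2/7.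
\<close>


section \<open>Clusters in a plaquette complex\<close>

text \<open>The number 324 is 18 squared: an edge has at most 6 plaquettes with 3 further edges
  each, and a walk of 2 (k - 1) steps traces a connected set of k edges. Clusters are formed in the
  union of both configurations because no plaquette then meets two of them: both weights split over
  the clusters, and an exchange on some clusters preserves the product weight if the two weights
  agree there. They do on clusters well inside both boxes, and on clusters whose two parts have
  empty coboundary.

  Since the coboundary arguments live on the whole lattice, the estimates count all plaquettes, also
  those crossing the boundary of the box.

  The odds r may exceed 1, which makes the factors change sign; their absolute values are invariant
  under r \<mapsto> 1 / r. By 3 \<beta> \<ge> 2 \<kappa>, that is y^3 \<le> x^2, u \<ge> 4 implies r
  \<ge> 1. With lam = n x y^6 the two bounds are of order lam (y + m / n) and exp (- lam (1 - m /
  n)). If D is the sum whose power 2/7 is claimed, then y \<le> D^(4/5) and m / n \<le> D^2; cutting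
  at lam = D^(-1/2) gives 4/5 - 1/2 = 3/10.\<close>

locale plaq_complex =
  fixes P :: "'p set" and bd :: "'p \<Rightarrow> 'e set"
  assumes card_bd: "p \<in> P \<Longrightarrow> card (bd p) = 4"
    and finite_cobd: "finite {p\<in>P. e \<in> bd p}"
    and card_cobd_le: "card {p\<in>P. e \<in> bd p} \<le> 6"
begin

lemma finite_bd: "p \<in> P \<Longrightarrow> finite (bd p)"
  using card_bd[of p] by (metis card.infinite zero_neq_numeral)

definition adj :: "'e \<Rightarrow> 'e \<Rightarrow> bool" where
  "adj e f \<longleftrightarrow> (\<exists>p\<in>P. e \<in> bd p \<and> f \<in> bd p)"

definition nbr :: "'e \<Rightarrow> 'e set" where
  "nbr e = {f. adj e f} - {e}"

lemma adj_sym: "adj e f \<Longrightarrow> adj f e"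
  by (auto simp: adj_def)

lemma nbr_eq: "nbr e = (\<Union>p\<in>{p\<in>P. e \<in> bd p}. bd p - {e})"
  by (auto simp: nbr_def adj_def)

lemma finite_nbr: "finite (nbr e)"
  unfolding nbr_eq using finite_cobd finite_bd by auto

lemma card_nbr: "card (nbr e) \<le> 18"
proof -
  have "card (nbr e) \<le> (\<Sum>p\<in>{p\<in>P. e \<in> bd p}. card (bd p - {e}))"
    unfolding nbr_eq by (rule card_UN_le) (rule finite_cobd)
  also have "\<dots> = (\<Sum>p\<in>{p\<in>P. e \<in> bd p}. 3)"
    by (rule sum.cong) (auto simp: card_Diff_singleton card_bd)
  also have "\<dots> \<le> 18"
    using card_cobd_le[of e] by simp
  finally show ?thesis .
qed

definition near :: "'e \<Rightarrow> 'e set" where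
  "near e = insert e (nbr e)"

lemma finite_near: "finite (near e)"
  by (simp add: near_def finite_nbr)

lemma card_near: "card (near e) \<le> 19"
  unfolding near_def using card_nbr[of e] card_insert_le_m1[of 19 "nbr e" e] by simp

lemma mem_near: "adj e f \<Longrightarrow> f \<in> near e"
  by (auto simp: near_def nbr_def)

lemma near_refl: "e \<in> near e"
  by (simp add: near_def)

definition sep :: "'e set \<Rightarrow> 'e set \<Rightarrow> bool" where
  "sep S T \<longleftrightarrow> S \<inter> T = {} \<and> (\<forall>e\<in>S. \<forall>f\<in>T. \<not> adj e f)"

lemma sep_mono: "sep S T \<Longrightarrow> S' \<subseteq> S \<Longrightarrow> T' \<subseteq> T \<Longrightarrow> sep S' T'"
  unfolding sep_def by blast

text \<open>The component of \<open>e\<close> in the graph that \<open>adj\<close> induces on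
  \<open>S\<close>. For \<open>e\<close> outside \<open>S\<close> it is just {e}, so
  \<open>cmp_refl\<close> holds without assumptions.\<close>

definition cmp :: "'e set \<Rightarrow> 'e \<Rightarrow> 'e set" where
  "cmp S e = {(a, b). a \<in> S \<and> b \<in> S \<and> adj a b}\<^sup>* `` {e}"

definition cmps :: "'e set \<Rightarrow> 'e set set" where
  "cmps S = cmp S ` S"

definition conn :: "'e set \<Rightarrow> bool" where
  "conn K \<longleftrightarrow> (\<forall>e\<in>K. cmp K e = K)"

lemma cmp_refl: "e \<in> cmp S e"
  by (simp add: cmp_def)

lemma cmp_subset: "e \<in> S \<Longrightarrow> cmp S e \<subseteq> S"
proof
  fix f assume "e \<in> S" "f \<in> cmp S e"
  then have "(e, f) \<in> {(a, b). a \<in> S \<and> b \<in> S \<and> adj a b}\<^sup>*" by (simp add: cmp_def)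
  then show "f \<in> S" using \<open>e \<in> S\<close> by (induction) auto
qed

lemma sym_adj_rel: "sym ({(a, b). a \<in> S \<and> b \<in> S \<and> adj a b}\<^sup>*)"
  by (rule sym_rtrancl) (auto simp: sym_def intro: adj_sym)

lemma cmp_eq: "f \<in> cmp S e \<Longrightarrow> cmp S f = cmp S e"
  using sym_adj_rel[of S] unfolding cmp_def sym_def
  by (auto intro: rtrancl_trans)

lemma cmp_step: "f \<in> cmp S e \<Longrightarrow> e \<in> S \<Longrightarrow> g \<in> S \<Longrightarrow> adj f g \<Longrightarrow> g \<in> cmp S e"
proof -
  assume a: "f \<in> cmp S e" "e \<in> S" "g \<in> S" "adj f g"
  then have "f \<in> S" using cmp_subset by blast
  with a show ?thesis unfolding cmp_def by (auto intro: rtrancl_into_rtrancl)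
qed

lemma cmp_sep: "e \<in> S \<Longrightarrow> sep (cmp S e) (S - cmp S e)"
  unfolding sep_def using cmp_step by blast

lemma cmp_conn:
  assumes "e \<in> S" shows "conn (cmp S e)"
proof -
  define K where "K = cmp S e"
  have *: "g \<in> cmp K f" if "f \<in> K" "(f, g) \<in> {(a, b). a \<in> S \<and> b \<in> S \<and> adj a b}\<^sup>*" for f g
    using that(2)
  proof (induction)
    case base then show ?case by (rule cmp_refl)
  next
    case (step g h)
    have "g \<in> K" using step.IH cmp_subset[OF that(1)] by blast
    have "h \<in> K" using cmp_step[of g S e h] \<open>g \<in> K\<close> assms step.hyps(2) unfolding K_def by auto
    show ?case by (rule cmp_step[OF step.IH that(1) \<open>h \<in> K\<close>]) (use step.hyps(2) in auto)
  qed
  have "cmp K f = K" if "f \<in> K" for f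
  proof
    show "cmp K f \<subseteq> K" using cmp_subset[OF that] .
    show "K \<subseteq> cmp K f"
    proof
      fix g assume "g \<in> K"
      then have "g \<in> cmp S f" using cmp_eq[of f S e] that unfolding K_def by simp
      then show "g \<in> cmp K f" using *[OF that] by (simp add: cmp_def)
    qed
  qed
  then show ?thesis unfolding conn_def K_def by blast
qed

lemma cmps_disjoint: "K \<in> cmps S \<Longrightarrow> L \<in> cmps S \<Longrightarrow> K \<noteq> L \<Longrightarrow> K \<inter> L = {}"
  unfolding cmps_def using cmp_eq by blast

lemma cmps_eq_cmp: "K \<in> cmps S \<Longrightarrow> e \<in> K \<Longrightarrow> K = cmp S e"
  unfolding cmps_def using cmp_eq by blast

lemma cmps_subset: "K \<in> cmps S \<Longrightarrow> K \<subseteq> S"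
  unfolding cmps_def using cmp_subset by blast

lemma Union_cmps: "\<Union>(cmps S) = S"
  unfolding cmps_def using cmp_refl cmp_subset by blast

lemma cmps_conn: "K \<in> cmps S \<Longrightarrow> conn K"
  unfolding cmps_def using cmp_conn by blast

lemma cmps_sep: "K \<in> cmps S \<Longrightarrow> sep K (S - K)"
  unfolding cmps_def using cmp_sep by blast

lemma finite_cmps: "finite S \<Longrightarrow> finite (cmps S)"
  unfolding cmps_def by simp

lemma cmps_adj_eq: "K \<in> cmps S \<Longrightarrow> L \<in> cmps S \<Longrightarrow> e \<in> K \<Longrightarrow> f \<in> L \<Longrightarrow> adj e f \<Longrightarrow> K = L"
  using cmps_sep[of K S] cmps_subset[of L S] cmps_disjoint[of K S L]
  unfolding sep_def by blast

lemma Union_cmps_sep: "\<K> \<subseteq> cmps S \<Longrightarrow> sep (\<Union>\<K>) (S - \<Union>\<K>)"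
  unfolding sep_def
proof (intro conjI ballI)
  fix e f assume "\<K> \<subseteq> cmps S" "e \<in> \<Union>\<K>" "f \<in> S - \<Union>\<K>"
  then obtain K where K: "K \<in> \<K>" "e \<in> K" "K \<in> cmps S" by blast
  then have "f \<in> S - K" using \<open>f \<in> S - \<Union>\<K>\<close> by blast
  then show "\<not> adj e f" using cmps_sep[OF K(3)] K(2) unfolding sep_def by blast
qed auto

subsection \<open>Counting connected sets\<close>

primrec walks :: "nat \<Rightarrow> 'e \<Rightarrow> 'e list set" where
  "walks 0 v = {[v]}"
| "walks (Suc n) v = (\<Union>u\<in>nbr v. (#) v ` walks n u)"

lemma card_walks: "finite (walks n v) \<and> card (walks n v) \<le> 18 ^ n"
proof (induction n arbitrary: v)
  case (Suc n)
  have "card (walks (Suc n) v) \<le> (\<Sum>u\<in>nbr v. card ((#) v ` walks n u))"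
    unfolding walks.simps by (rule card_UN_le) (rule finite_nbr)
  also have "\<dots> \<le> (\<Sum>u\<in>nbr v. 18 ^ n)"
    by (rule sum_mono) (metis Suc card_image_le order_trans)
  also have "\<dots> \<le> 18 * 18 ^ n"
    using card_nbr[of v] by simp
  finally show ?case using Suc finite_nbr by auto
qed auto

lemma walk_hd: "l \<in> walks n v \<Longrightarrow> v \<in> set l"
  by (cases n) auto

text \<open>The detour is inserted at the first visit of \<open>s\<close>, either right at the start
  or inside the tail, and costs two steps.\<close>

lemma walk_insert:
  "l \<in> walks n v \<Longrightarrow> s \<in> set l \<Longrightarrow> u \<in> nbr s \<Longrightarrow>
    \<exists>l'\<in>walks (Suc (Suc n)) v. set l' = insert u (set l)"
proof (induction n arbitrary: v l)
  case 0
  then have "[v, u, v] \<in> walks (Suc (Suc 0)) v"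
    by (auto simp: nbr_def intro: adj_sym)
  then show ?case using 0 by (intro bexI) auto
next
  case (Suc n)
  then obtain w m where m: "w \<in> nbr v" "m \<in> walks n w" "l = v # m" by auto
  show ?case
  proof (cases "s = v")
    case True
    have vu: "u \<in> nbr v" "v \<in> nbr u" using True Suc.prems by (auto simp: nbr_def intro: adj_sym)
    then have "u # l \<in> walks (Suc (Suc n)) u"
      using Suc.prems(1) unfolding walks.simps(2)[of "Suc n"] by blast
    then have "v # u # l \<in> walks (Suc (Suc (Suc n))) v"
      using vu unfolding walks.simps(2)[of "Suc (Suc n)"] by blast
    moreover have "set (v # u # l) = insert u (set l)" using m by auto
    ultimately show ?thesis by blast
  next
    case False
    then obtain m' where "m' \<in> walks (Suc (Suc n)) w" "set m' = insert u (set m)"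
      using Suc.IH[OF m(2) _ Suc.prems(3)] Suc.prems(2) m(3) by (metis set_ConsD)
    then have "v # m' \<in> walks (Suc (Suc (Suc n))) v"
      using m(1) unfolding walks.simps(2)[of "Suc (Suc n)"] by blast
    moreover have "set (v # m') = insert u (set l)"
      using \<open>set m' = insert u (set m)\<close> m(3) by auto
    ultimately have "v # m' \<in> walks (Suc (Suc (Suc n))) v \<and> set (v # m') = insert u (set l)" by simp
    then show ?thesis by blast
  qed
qed

text \<open>Otherwise no adjacency inside \<open>K\<close> leaves \<open>S\<close>, so the component
  of \<open>v\<close>, which is all of \<open>K\<close>, would lie in \<open>S\<close>.\<close>

lemma conn_grow:
  assumes "conn K" "S \<subset> K" "v \<in> S"
  shows "\<exists>s\<in>S. \<exists>u\<in>K - S. u \<in> nbr s"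
proof (rule ccontr)
  assume no: "\<not> ?thesis"
  have "g \<in> S" if "(v, g) \<in> {(a, b). a \<in> K \<and> b \<in> K \<and> adj a b}\<^sup>*" for g
    using that
  proof induction
    case base then show ?case using assms by simp
  next
    case (step g h)
    then show ?case using no by (auto simp: nbr_def)
  qed
  moreover have "cmp K v = K" using assms unfolding conn_def by blast
  ultimately have "K \<subseteq> S" unfolding cmp_def by auto
  then show False using assms by blast
qed

text \<open>A walk covering part of \<open>K\<close> is extended to a further vertex \<open>u\<close> by a detour \<open>s, u, s\<close>,
  so that \<open>2 (|K| - 1)\<close> steps suffice to cover \<open>K\<close>.\<close>
lemma conn_walk:
  assumes K: "conn K" "finite K" "v \<in> K"
  shows "\<exists>l\<in>walks (2 * (card K - 1)) v. set l = K"
proof -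
  have "\<exists>S l. S \<subseteq> K \<and> card S = Suc m \<and> l \<in> walks (2 * m) v \<and> set l = S" if "m < card K" for m
    using that
  proof (induction m)
    case 0
    show ?case by (rule exI[of _ "{v}"], rule exI[of _ "[v]"]) (use K in auto)
  next
    case (Suc m)
    then obtain S l where S: "S \<subseteq> K" "card S = Suc m" "l \<in> walks (2 * m) v" "set l = S" by auto
    have "S \<subset> K" using S Suc.prems by auto
    then obtain s u where su: "s \<in> S" "u \<in> K - S" "u \<in> nbr s"
      using conn_grow[OF K(1), of S v] walk_hd[OF S(3)] S(4) by auto
    then obtain l' where "l' \<in> walks (Suc (Suc (2 * m))) v" "set l' = insert u S"
      using walk_insert[OF S(3), of s u] S(4) by blast
    moreover have "card (insert u S) = Suc (Suc m)"
      using S su finite_subset[OF S(1) K(2)] by auto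
    ultimately show ?case using S su
      by (intro exI[of _ "insert u S"] exI[of _ l']) auto
  qed
  moreover have "card K > 0" using K card_gt_0_iff by blast
  ultimately obtain S l where S: "S \<subseteq> K" "card S = card K" "l \<in> walks (2 * (card K - 1)) v" "set l = S"
    by (metis Suc_pred' diff_less zero_less_one)
  then have "S = K" using K card_subset_eq by blast
  then show ?thesis using S by blast
qed

lemma card_conn_sets:
  assumes "finite E"
  shows "card {K. K \<subseteq> E \<and> conn K \<and> v \<in> K \<and> card K = m} \<le> 324 ^ (m - 1)"
proof -
  have "{K. K \<subseteq> E \<and> conn K \<and> v \<in> K \<and> card K = m} \<subseteq> set ` walks (2 * (m - 1)) v"
    using conn_walk finite_subset[OF _ assms] by fastforce
  then have "card {K. K \<subseteq> E \<and> conn K \<and> v \<in> K \<and> card K = m} \<le> card (walks (2 * (m - 1)) v)"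
    using card_walks by (meson card_image_le card_mono finite_imageI le_trans)
  also have "\<dots> \<le> 18 ^ (2 * (m - 1))" using card_walks by blast
  also have "\<dots> = 324 ^ (m - 1)" by (simp add: power_mult)
  finally show ?thesis .
qed

text \<open>The sizes from m + 1 on contribute a geometric tail of ratio 324 q. The factor (324 q)^m
  rewards large clusters; it yields decay in the distance and the extra power of \<open>x\<close>
  for clusters of at least two edges.\<close>

lemma conn_sum_bound:
  fixes q :: real
  assumes E: "finite E" and q: "0 \<le> q" "324 * q < 1"
  shows "(\<Sum>K | K \<subseteq> E \<and> conn K \<and> v \<in> K \<and> card K \<ge> Suc m. q ^ card K)
     \<le> q * (324 * q) ^ m / (1 - 324 * q)"
proof -
  let ?S = "{K. K \<subseteq> E \<and> conn K \<and> v \<in> K \<and> card K \<ge> Suc m}"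
  let ?T = "\<lambda>n. {K. K \<subseteq> E \<and> conn K \<and> v \<in> K \<and> card K = n}"
  have fin: "finite ?S" using E by (auto intro: finite_subset[of _ "Pow E"])
  have img: "card ` ?S \<subseteq> {Suc m..<Suc m + Suc (card E)}"
    using E by (auto dest: card_mono[OF E])
  have "(\<Sum>K\<in>?S. q ^ card K) = (\<Sum>n\<in>{Suc m..<Suc m + Suc (card E)}. \<Sum>K\<in>{K\<in>?S. card K = n}. q ^ card K)"
    by (rule sum.group[symmetric]) (use fin img in auto)
  also have "\<dots> \<le> (\<Sum>n\<in>{Suc m..<Suc m + Suc (card E)}. 324 ^ (n - 1) * q ^ n)"
  proof (rule sum_mono)
    fix n assume "n \<in> {Suc m..<Suc m + Suc (card E)}"
    then have *: "{K\<in>?S. card K = n} = ?T n" by auto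
    have "(\<Sum>K\<in>{K\<in>?S. card K = n}. q ^ card K) = real (card (?T n)) * q ^ n"
      unfolding * by simp
    also have "\<dots> \<le> real (324 ^ (n - 1)) * q ^ n"
      by (intro mult_right_mono of_nat_mono card_conn_sets E) (use q in auto)
    finally show "(\<Sum>K\<in>{K\<in>?S. card K = n}. q ^ card K) \<le> 324 ^ (n - 1) * q ^ n" by simp
  qed
  also have "\<dots> = (\<Sum>i<Suc (card E). q * (324 * q) ^ m * (324 * q) ^ i)"
    by (rule sum.reindex_bij_witness[where i = "\<lambda>i. i + Suc m" and j = "\<lambda>n. n - Suc m"])
      (auto simp: power_mult_distrib power_add[symmetric] mult_ac simp flip: power_Suc)
  also have "\<dots> = q * (324 * q) ^ m * (\<Sum>i<Suc (card E). (324 * q) ^ i)"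
    by (simp only: sum_distrib_left)
  also have "\<dots> \<le> q * (324 * q) ^ m * (1 / (1 - 324 * q))"
  proof (rule mult_left_mono)
    have "(\<Sum>i<Suc (card E). (324 * q) ^ i) = (1 - (324 * q) ^ Suc (card E)) / (1 - 324 * q)"
      using q by (simp only: sum_gp_strict) auto
    also have "\<dots> \<le> 1 / (1 - 324 * q)"
      by (rule divide_right_mono) (use q in auto)
    finally show "(\<Sum>i<Suc (card E). (324 * q) ^ i) \<le> 1 / (1 - 324 * q)" .
  qed (use q in auto)
  finally show ?thesis by simp
qed

end

section \<open>Coboundaries modulo 2 and the factorisation of weights\<close>

context plaq_complex
begin

definition dd :: "'p set \<Rightarrow> 'e set \<Rightarrow> 'p set" where
  "dd Q A = {p\<in>Q. odd (card (bd p \<inter> A))}"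

text \<open>The convention 0^0 = 1 lets \<open>y = 0\<close> single out the sets with empty
  \<open>dd\<close>, so no separate flat measure is introduced.\<close>

definition wt :: "real \<Rightarrow> real \<Rightarrow> 'p set \<Rightarrow> 'e set \<Rightarrow> real" where
  "wt x y Q A = x ^ card A * y ^ card (dd Q A)"

lemma dd_empty [simp]: "dd Q {} = {}"
  by (simp add: dd_def)

lemma dd_subset_cobd: "dd Q A \<subseteq> (\<Union>e\<in>A. {p\<in>Q. e \<in> bd p})"
proof
  fix p assume "p \<in> dd Q A"
  then have "p \<in> Q" "bd p \<inter> A \<noteq> {}" unfolding dd_def by auto
  then show "p \<in> (\<Union>e\<in>A. {p\<in>Q. e \<in> bd p})" by auto
qed

lemma finite_dd: "finite A \<Longrightarrow> Q \<subseteq> P \<Longrightarrow> finite (dd Q A)"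
  by (rule finite_subset[OF dd_subset_cobd])
    (auto intro: finite_subset[OF _ finite_cobd])

text \<open>This is the purpose of \<open>sep\<close>: without a common plaquette, coboundaries add
  up disjointly and weights multiply.\<close>

lemma sep_bd: "sep S T \<Longrightarrow> p \<in> P \<Longrightarrow> bd p \<inter> S = {} \<or> bd p \<inter> T = {}"
  unfolding sep_def adj_def by blast

lemma dd_Un:
  assumes "sep S T" "Q \<subseteq> P"
  shows "dd Q (S \<union> T) = dd Q S \<union> dd Q T" "dd Q S \<inter> dd Q T = {}"
proof -
  have *: "odd (card (bd p \<inter> (S \<union> T))) \<longleftrightarrow> odd (card (bd p \<inter> S)) \<or> odd (card (bd p \<inter> T))"
    "\<not> (odd (card (bd p \<inter> S)) \<and> odd (card (bd p \<inter> T)))" if "p \<in> Q" for p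
    using sep_bd[OF assms(1), of p] that assms(2) by (fastforce simp: Int_Un_distrib)+
  show "dd Q (S \<union> T) = dd Q S \<union> dd Q T" "dd Q S \<inter> dd Q T = {}"
    unfolding dd_def using * by auto
qed

lemma wt_Un:
  assumes "sep S T" "Q \<subseteq> P" "finite S" "finite T"
  shows "wt x y Q (S \<union> T) = wt x y Q S * wt x y Q T"
proof -
  have "S \<inter> T = {}" using assms(1) by (simp add: sep_def)
  then show ?thesis
    using dd_Un[OF assms(1,2)] finite_dd[OF _ assms(2)] assms
    by (simp add: wt_def card_Un_disjoint power_add mult_ac)
qed

lemma wt_nonneg: "0 \<le> x \<Longrightarrow> 0 \<le> y \<Longrightarrow> 0 \<le> wt x y Q A"
  by (simp add: wt_def)

lemma wt_empty [simp]: "wt x y Q {} = 1"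
  by (simp add: wt_def)

lemma wt_le: "0 \<le> x \<Longrightarrow> 0 \<le> y \<Longrightarrow> y \<le> 1 \<Longrightarrow> wt x y Q A \<le> x ^ card A"
  by (simp add: wt_def mult_left_le power_le_one)

lemma odd_card_dd_single:
  assumes "K \<in> cmps S" "A \<subseteq> S" "p \<in> P" "odd (card (bd p \<inter> A \<inter> K))"
  shows "odd (card (bd p \<inter> A))"
proof -
  have "bd p \<inter> K \<noteq> {}" using assms(4) by (metis Int_assoc Int_commute card.empty even_zero inf_bot_right)
  then have "bd p \<inter> (S - K) = {}" using sep_bd[OF cmps_sep[OF assms(1)] assms(3)] by blast
  then have "bd p \<inter> A \<inter> K = bd p \<inter> A" using assms(2) by blast
  then show ?thesis using assms(4) by simp
qed

lemma odd_dd_cmps: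
  assumes "A \<subseteq> S" "p \<in> P" "odd (card (bd p \<inter> A))"
  shows "\<exists>K\<in>cmps S. odd (card (bd p \<inter> (A \<inter> K)))"
proof -
  have "bd p \<inter> A \<noteq> {}" using assms(3) by auto
  then obtain e where e: "e \<in> bd p" "e \<in> A" by blast
  let ?K = "cmp S e"
  have K: "?K \<in> cmps S" "e \<in> ?K" using e assms(1) by (auto simp: cmps_def cmp_refl)
  then have "bd p \<inter> (S - ?K) = {}" using sep_bd[OF cmps_sep[OF K(1)] assms(2)] e by blast
  then have "bd p \<inter> (A \<inter> ?K) = bd p \<inter> A" using assms(1) by blast
  then show ?thesis using K assms(3) by (intro bexI[of _ ?K]) auto
qed

text \<open>Each plaquette meets at most one component of \<open>S\<close>, so its parity on
  \<open>A\<close> is decided there. \<open>S\<close> may be larger than \<open>A\<close>: it will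
  be the union of a pair.\<close>

lemma dd_cmps:
  assumes "A \<subseteq> S"
  shows "dd P A = (\<Union>K\<in>cmps S. dd P (A \<inter> K))"
  using odd_dd_cmps[OF assms] odd_card_dd_single[OF _ assms]
  unfolding dd_def by (fastforce simp: Int_assoc)

lemma sum_power_card_Pow:
  fixes t :: real
  assumes "finite a"
  shows "(\<Sum>c\<in>Pow a. t ^ card c) = (1 + t) ^ card a"
  using assms
proof (induction a)
  case (insert e a)
  have "inj_on (insert e) (Pow a)" using insert.hyps by (auto simp: inj_on_def insert_ident subset_iff)
  moreover have "Pow a \<inter> insert e ` Pow a = {}" using insert.hyps by auto
  moreover have "(\<Sum>c\<in>Pow a. t ^ card (insert e c)) = (\<Sum>c\<in>Pow a. t * t ^ card c)"
    using insert.hyps by (intro sum.cong) (auto simp: card_insert_if finite_subset)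
  ultimately show ?case
    using insert by (simp add: Pow_insert sum.union_disjoint sum.reindex sum_distrib_left[symmetric] algebra_simps)
qed simp

text \<open>A pair with union \<open>K\<close> is determined by its first component \<open>a\<close> and the part of the second one inside \<open>a\<close>.\<close>
lemma sum_pairs_Un:
  fixes x :: real and K :: "'e set"
  assumes "finite K"
  shows "(\<Sum>z\<in>{z. fst z \<union> snd z = K}. x ^ (card (fst z) + card (snd z))) = (2 * x + x\<^sup>2) ^ card K"
proof -
  have "(\<Sum>z\<in>{z. fst z \<union> snd z = K}. x ^ (card (fst z) + card (snd z)))
      = (\<Sum>(a, c)\<in>(SIGMA a:Pow K. Pow a). x ^ card K * x ^ card c)"
  proof (rule sum.reindex_bij_witness[where i = "\<lambda>(a, c). (a, K - a \<union> c)" and j = "\<lambda>z. (fst z, fst z \<inter> snd z)"])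
    fix z assume z: "z \<in> {z. fst z \<union> snd z = K}"
    then have "card (fst z) + card (snd z) = card K + card (fst z \<inter> snd z)"
      using card_Un_Int[of "fst z" "snd z"] assms by auto
    then show "(case (fst z, fst z \<inter> snd z) of (a, c) \<Rightarrow> x ^ card K * x ^ card c) = x ^ (card (fst z) + card (snd z))"
      by (simp add: power_add)
    show "(case (fst z, fst z \<inter> snd z) of (a, c) \<Rightarrow> (a, K - a \<union> c)) = z"
      using z by (auto simp: prod_eq_iff)
  qed auto
  also have "\<dots> = (\<Sum>a\<in>Pow K. x ^ card K * (1 + x) ^ card a)"
    using assms by (simp add: sum.Sigma[symmetric] finite_subset sum_distrib_left[symmetric] sum_power_card_Pow)
  also have "\<dots> = (x * (2 + x)) ^ card K"
    using sum_power_card_Pow[OF assms, of "1 + x"] by (simp add: sum_distrib_left[symmetric] power_mult_distrib)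
  finally show ?thesis by (simp add: power2_eq_square distrib_left mult.commute)
qed

end

section \<open>Pairs of independent configurations\<close>

text \<open>Only \<open>x\<close> is common to both systems. The locale is used with equal
  \<open>y\<close> on different plaquette and edge sets, and with \<open>y2 = 0\<close> on equal
  ones.\<close>

locale pair_system = plaq_complex P bd
  for P :: "'p set" and bd :: "'p \<Rightarrow> 'e set" +
  fixes x y1 y2 :: real and P1 P2 :: "'p set" and E1 E2 :: "'e set"
  assumes E: "finite E1" "finite E2" and PP: "P1 \<subseteq> P" "P2 \<subseteq> P"
    and x: "0 < x" "324 * (2 * x + x\<^sup>2) < 1"
    and y: "0 \<le> y1" "y1 \<le> 1" "0 \<le> y2" "y2 \<le> 1"
begin

abbreviation "w1 \<equiv> wt x y1 P1"
abbreviation "w2 \<equiv> wt x y2 P2"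

definition "Z1 = (\<Sum>A\<in>Pow E1. w1 A)"
definition "Z2 = (\<Sum>A\<in>Pow E2. w2 A)"

definition PE :: "('e set \<Rightarrow> 'e set \<Rightarrow> real) \<Rightarrow> real" where
  "PE h = (\<Sum>(A,B)\<in>Pow E1 \<times> Pow E2. w1 A * w2 B * h A B) / (Z1 * Z2)"

lemma w_nonneg: "0 \<le> w1 A" "0 \<le> w2 A"
  using x y by (auto intro: wt_nonneg)

lemma Z_pos: "0 < Z1" "0 < Z2"
proof -
  have "w1 {} \<le> Z1" "w2 {} \<le> Z2"
    unfolding Z1_def Z2_def by (rule member_le_sum; use E w_nonneg in auto)+
  then show "0 < Z1" "0 < Z2" by simp_all
qed

text \<open>Comparing only at pairs of nonzero weight is what later allows the second configuration
  to be taken flat when \<open>y2 = 0\<close>.\<close>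

lemma PE_mono:
  assumes "\<And>A B. A \<subseteq> E1 \<Longrightarrow> B \<subseteq> E2 \<Longrightarrow> w1 A \<noteq> 0 \<Longrightarrow> w2 B \<noteq> 0 \<Longrightarrow> h A B \<le> h' A B"
  shows "PE h \<le> PE h'"
  unfolding PE_def
proof (intro divide_right_mono sum_mono)
  fix z assume "z \<in> Pow E1 \<times> Pow E2"
  then show "(case z of (A, B) \<Rightarrow> w1 A * w2 B * h A B) \<le> (case z of (A, B) \<Rightarrow> w1 A * w2 B * h' A B)"
    using assms[of "fst z" "snd z"] w_nonneg
    by (cases "w1 (fst z) = 0"; cases "w2 (snd z) = 0") (simp_all add: split_beta mult_left_mono mem_Times_iff)
qed (use Z_pos in auto)

lemma PE_add: "PE (\<lambda>A B. h A B + h' A B) = PE h + PE h'"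
  by (simp add: PE_def split_beta distrib_left sum.distrib add_divide_distrib)

lemma PE_cmult: "PE (\<lambda>A B. c * h A B) = c * PE h"
  by (simp add: PE_def split_beta sum_distrib_left mult.left_commute)

lemma PE_diff: "PE (\<lambda>A B. h A B - h' A B) = PE h - PE h'"
  using PE_add[of h "\<lambda>A B. (- 1) * h' A B"] PE_cmult[of "- 1" h'] by simp

lemma PE_fst: "PE (\<lambda>A B. f A) = (\<Sum>A\<in>Pow E1. w1 A * f A) / Z1"
proof -
  have "(\<Sum>(A,B)\<in>Pow E1 \<times> Pow E2. w1 A * w2 B * f A) = (\<Sum>A\<in>Pow E1. w1 A * f A) * Z2"
    unfolding Z2_def sum_product sum.cartesian_product by (rule sum.cong) auto
  then show ?thesis using Z_pos by (simp add: PE_def)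
qed

lemma PE_snd: "PE (\<lambda>A B. f B) = (\<Sum>B\<in>Pow E2. w2 B * f B) / Z2"
proof -
  have "(\<Sum>(A,B)\<in>Pow E1 \<times> Pow E2. w1 A * w2 B * f B) = Z1 * (\<Sum>B\<in>Pow E2. w2 B * f B)"
    unfolding Z1_def sum_product sum.cartesian_product by (rule sum.cong) auto
  then show ?thesis using Z_pos by (simp add: PE_def)
qed

lemma PE_const: "PE (\<lambda>A B. c) = c"
  using PE_fst[of "\<lambda>_. c"] Z_pos by (simp add: Z1_def flip: sum_distrib_right)

lemma PE_abs: "\<bar>PE h\<bar> \<le> PE (\<lambda>A B. \<bar>h A B\<bar>)"
proof -
  have "PE h \<le> PE (\<lambda>A B. \<bar>h A B\<bar>)" "PE (\<lambda>A B. (- 1) * h A B) \<le> PE (\<lambda>A B. \<bar>h A B\<bar>)"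
    by (rule PE_mono; simp)+
  then show ?thesis by (simp only: PE_cmult)
qed

lemma PE_sum: "finite I \<Longrightarrow> PE (\<lambda>A B. \<Sum>i\<in>I. h i A B) = (\<Sum>i\<in>I. PE (h i))"
proof (induction I rule: finite_induct)
  case empty then show ?case using PE_const[of 0] by simp
next
  case (insert i I) then show ?case by (simp add: PE_add)
qed

lemma PE_nonneg: "(\<And>A B. A \<subseteq> E1 \<Longrightarrow> B \<subseteq> E2 \<Longrightarrow> 0 \<le> h A B) \<Longrightarrow> 0 \<le> PE h"
  using PE_mono[of "\<lambda>_ _. 0" h] PE_const[of 0] by simp

definition Pr :: "('e set \<Rightarrow> 'e set \<Rightarrow> bool) \<Rightarrow> real" where
  "Pr \<Phi> = PE (\<lambda>A B. of_bool (\<Phi> A B))"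

lemma Pr_mono:
  assumes "\<And>A B. A \<subseteq> E1 \<Longrightarrow> B \<subseteq> E2 \<Longrightarrow> w1 A \<noteq> 0 \<Longrightarrow> w2 B \<noteq> 0 \<Longrightarrow> \<Phi> A B \<Longrightarrow> \<Psi> A B"
  shows "Pr \<Phi> \<le> Pr \<Psi>"
  unfolding Pr_def by (rule PE_mono) (use assms in auto)

lemma Pr_le_sum:
  assumes "finite I"
    "\<And>A B. A \<subseteq> E1 \<Longrightarrow> B \<subseteq> E2 \<Longrightarrow> w1 A \<noteq> 0 \<Longrightarrow> w2 B \<noteq> 0 \<Longrightarrow> \<Phi> A B \<Longrightarrow> \<exists>i\<in>I. \<Psi> i A B"
  shows "Pr \<Phi> \<le> (\<Sum>i\<in>I. Pr (\<Psi> i))"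
proof -
  have "Pr \<Phi> \<le> PE (\<lambda>A B. \<Sum>i\<in>I. of_bool (\<Psi> i A B))"
    unfolding Pr_def
  proof (rule PE_mono)
    fix A B assume *: "A \<subseteq> E1" "B \<subseteq> E2" "w1 A \<noteq> 0" "w2 B \<noteq> 0"
    show "of_bool (\<Phi> A B) \<le> (\<Sum>i\<in>I. of_bool (\<Psi> i A B) :: real)"
    proof (cases "\<Phi> A B")
      case True
      then obtain i where i: "i \<in> I" "\<Psi> i A B" using assms(2) * by blast
      then have "(of_bool (\<Psi> i A B) :: real) \<le> (\<Sum>i\<in>I. of_bool (\<Psi> i A B))"
        by (intro member_le_sum) (use assms(1) in auto)
      then show ?thesis using i True by simp
    qed (auto intro: sum_nonneg)
  qed
  then show ?thesis using PE_sum[OF assms(1)] by (simp add: Pr_def)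
qed

text \<open>Removing \<open>a\<close> and \<open>b\<close> is injective on this event and, by
  separation, divides the weight by exactly \<open>w1 a * w2 b\<close>; the pairs that remain sum to
  at most \<open>Z1 * Z2\<close>.\<close>

lemma peierls:
  assumes ab: "a \<subseteq> E1" "b \<subseteq> E2"
  shows "Pr (\<lambda>A B. A \<inter> (a \<union> b) = a \<and> B \<inter> (a \<union> b) = b \<and> sep (a \<union> b) (A \<union> B - (a \<union> b)))
    \<le> w1 a * w2 b"
proof -
  define C where "C = a \<union> b"
  define S where "S = {(A,B)\<in>Pow E1 \<times> Pow E2. A \<inter> C = a \<and> B \<inter> C = b \<and> sep C (A \<union> B - C)}"
  have finS: "finite S" unfolding S_def using E by (auto intro: finite_subset[of _ "Pow E1 \<times> Pow E2"])
  have w: "w1 A * w2 B = w1 a * w2 b * (w1 (A - C) * w2 (B - C))" if "(A, B) \<in> S" for A B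
  proof -
    have s: "A \<inter> C = a" "B \<inter> C = b" "sep C (A \<union> B - C)" "A \<subseteq> E1" "B \<subseteq> E2"
      using that by (auto simp: S_def)
    have "sep a (A - C)" "sep b (B - C)"
      by (rule sep_mono[OF s(3)]; use s in auto)+
    moreover have "finite A" "finite B" using s E finite_subset by blast+
    moreover have "A = a \<union> (A - C)" "B = b \<union> (B - C)" using s by auto
    ultimately have "w1 A = w1 a * w1 (A - C)" "w2 B = w2 b * w2 (B - C)"
      using wt_Un[OF _ PP(1), of a "A - C"] wt_Un[OF _ PP(2), of b "B - C"]
        finite_subset[OF ab(1) E(1)] finite_subset[OF ab(2) E(2)] by auto
    then show ?thesis by simp
  qed
  have inj: "inj_on (\<lambda>(A,B). (A - C, B - C)) S"
  proof (rule inj_onI)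
    fix z z' assume *: "z \<in> S" "z' \<in> S" "(case z of (A,B) \<Rightarrow> (A - C, B - C)) = (case z' of (A,B) \<Rightarrow> (A - C, B - C))"
    obtain A B A' B' where zz: "z = (A,B)" "z' = (A',B')" by fastforce
    have "A - C = A' - C" "B - C = B' - C" "A \<inter> C = A' \<inter> C" "B \<inter> C = B' \<inter> C"
      using * zz by (auto simp: S_def)
    then show "z = z'" using zz by blast
  qed
  have "(\<Sum>(A,B)\<in>Pow E1 \<times> Pow E2. w1 A * w2 B * of_bool (A \<inter> C = a \<and> B \<inter> C = b \<and> sep C (A \<union> B - C)))
      = (\<Sum>(A,B)\<in>S. w1 A * w2 B)"
    by (rule sum.mono_neutral_cong_right) (use E in \<open>auto simp: S_def\<close>)
  also have "\<dots> = w1 a * w2 b * (\<Sum>(A,B)\<in>S. w1 (A - C) * w2 (B - C))"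
    unfolding sum_distrib_left by (rule sum.cong) (use w in auto)
  also have "(\<Sum>(A,B)\<in>S. w1 (A - C) * w2 (B - C)) = (\<Sum>(A,B)\<in>(\<lambda>(A,B). (A - C, B - C)) ` S. w1 A * w2 B)"
    unfolding sum.reindex[OF inj] by (rule sum.cong) auto
  also have "\<dots> \<le> (\<Sum>(A,B)\<in>Pow E1 \<times> Pow E2. w1 A * w2 B)"
    by (rule sum_mono2) (use E w_nonneg in \<open>auto simp: S_def\<close>)
  also have "\<dots> = Z1 * Z2"
    unfolding Z1_def Z2_def sum_product sum.cartesian_product by simp
  finally have "(\<Sum>(A,B)\<in>Pow E1 \<times> Pow E2. w1 A * w2 B * of_bool (A \<inter> C = a \<and> B \<inter> C = b \<and> sep C (A \<union> B - C)))
      \<le> w1 a * w2 b * (Z1 * Z2)"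
    using w_nonneg by (simp add: mult_left_mono)
  then show ?thesis
    unfolding Pr_def PE_def C_def[symmetric] using Z_pos by (simp add: pos_divide_le_eq)
qed

definition clus :: "('e set \<Rightarrow> 'e set \<Rightarrow> bool) \<Rightarrow> 'e \<Rightarrow> ('e set \<times> 'e set) set" where
  "clus \<Phi> f = {(a,b). a \<subseteq> E1 \<and> b \<subseteq> E2 \<and> conn (a \<union> b) \<and> f \<in> a \<union> b \<and> \<Phi> a b}"

abbreviation "q \<equiv> 2 * x + x\<^sup>2"

lemma finite_clus: "finite (clus \<Phi> f)"
  by (rule finite_subset[of _ "Pow E1 \<times> Pow E2"]) (use E in \<open>auto simp: clus_def\<close>)

text \<open>Pairs are grouped by their union \<open>K\<close>, which costs \<open>q ^ card K\<close>
  by \<open>sum_pairs_Un\<close>, and then the connected sets through \<open>f\<close> are counted.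
  \<open>t\<close> carries the gain from frustrated plaquettes, \<open>m\<close> the gain from
  size.\<close>

lemma cluster_sum:
  assumes t: "0 \<le> t"
    and \<Phi>: "\<And>a b. a \<subseteq> E1 \<Longrightarrow> b \<subseteq> E2 \<Longrightarrow> f \<in> a \<union> b \<Longrightarrow> conn (a \<union> b) \<Longrightarrow> \<Phi> a b \<Longrightarrow> w1 a * w2 b \<noteq> 0
      \<Longrightarrow> Suc m \<le> card (a \<union> b) \<and> w1 a * w2 b \<le> t * x ^ (card a + card b)"
  shows "(\<Sum>(a,b)\<in>clus \<Phi> f. w1 a * w2 b) \<le> t * (q * (324 * q) ^ m / (1 - 324 * q))"
proof -
  let ?S = "{(a,b)\<in>clus \<Phi> f. w1 a * w2 b \<noteq> 0}"
  let ?K = "{K. K \<subseteq> E1 \<union> E2 \<and> conn K \<and> f \<in> K \<and> card K \<ge> Suc m}"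
  have finK: "finite ?K" by (rule finite_subset[of _ "Pow (E1 \<union> E2)"]) (use E in auto)
  have q: "0 \<le> q" "324 * q < 1" using x by auto
  have fS: "finite ?S" by (rule finite_subset[OF _ finite_clus[of \<Phi> f]]) auto
  have "(\<Sum>(a,b)\<in>clus \<Phi> f. w1 a * w2 b) = (\<Sum>(a,b)\<in>?S. w1 a * w2 b)"
    by (rule sum.mono_neutral_cong_right) (use finite_clus in auto)
  also have "\<dots> \<le> (\<Sum>z\<in>?S. t * x ^ (card (fst z) + card (snd z)))"
    by (rule sum_mono) (use \<Phi> in \<open>auto simp: clus_def\<close>)
  also have "\<dots> = (\<Sum>K\<in>?K. \<Sum>z\<in>{z\<in>?S. fst z \<union> snd z = K}. t * x ^ (card (fst z) + card (snd z)))"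
  proof (rule sum.group[symmetric])
    show "(\<lambda>z. fst z \<union> snd z) ` ?S \<subseteq> ?K" using \<Phi> by (auto simp: clus_def)
  qed (use fS finK in auto)
  also have "\<dots> \<le> (\<Sum>K\<in>?K. t * q ^ card K)"
  proof (rule sum_mono)
    fix K assume K: "K \<in> ?K"
    then have fK: "finite K" using E by (auto intro: finite_subset)
    have "(\<Sum>z\<in>{z\<in>?S. fst z \<union> snd z = K}. t * x ^ (card (fst z) + card (snd z)))
        \<le> (\<Sum>z\<in>{z. fst z \<union> snd z = K}. t * x ^ (card (fst z) + card (snd z)))"
      by (rule sum_mono2) (use fK t x in \<open>auto intro: finite_subset[of _ "Pow K \<times> Pow K"]\<close>)
    also have "\<dots> = t * q ^ card K"
      unfolding sum_pairs_Un[OF fK, symmetric] by (simp add: sum_distrib_left)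
    finally show "(\<Sum>z\<in>{z\<in>?S. fst z \<union> snd z = K}. t * x ^ (card (fst z) + card (snd z))) \<le> t * q ^ card K" .
  qed
  also have "\<dots> = t * (\<Sum>K\<in>?K. q ^ card K)" by (simp add: sum_distrib_left)
  also have "\<dots> \<le> t * (q * (324 * q) ^ m / (1 - 324 * q))"
    by (rule mult_left_mono[OF conn_sum_bound]) (use E q t in auto)
  finally show ?thesis .
qed

text \<open>A union bound over the possible traces of the component on \<open>A\<close> and
  \<open>B\<close>, each of them priced by \<open>peierls\<close>.\<close>

lemma comp_prob:
  "Pr (\<lambda>A B. \<exists>K\<in>cmps (A \<union> B). f \<in> K \<and> \<Phi> (A \<inter> K) (B \<inter> K)) \<le> (\<Sum>(a,b)\<in>clus \<Phi> f. w1 a * w2 b)"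
proof -
  have "Pr (\<lambda>A B. \<exists>K\<in>cmps (A \<union> B). f \<in> K \<and> \<Phi> (A \<inter> K) (B \<inter> K))
     \<le> (\<Sum>z\<in>clus \<Phi> f. Pr (\<lambda>A B. A \<inter> (fst z \<union> snd z) = fst z \<and> B \<inter> (fst z \<union> snd z) = snd z \<and>
          sep (fst z \<union> snd z) (A \<union> B - (fst z \<union> snd z))))"
  proof (rule Pr_le_sum[OF finite_clus])
    fix A B assume "A \<subseteq> E1" "B \<subseteq> E2" and "\<exists>K\<in>cmps (A \<union> B). f \<in> K \<and> \<Phi> (A \<inter> K) (B \<inter> K)"
    then obtain K where K: "K \<in> cmps (A \<union> B)" "f \<in> K" "\<Phi> (A \<inter> K) (B \<inter> K)" by blast
    have KK: "A \<inter> K \<union> B \<inter> K = K" using cmps_subset[OF K(1)] by blast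
    have "conn (A \<inter> K \<union> B \<inter> K)" "f \<in> A \<inter> K \<union> B \<inter> K" unfolding KK using K cmps_conn by blast+
    then have "(A \<inter> K, B \<inter> K) \<in> clus \<Phi> f"
      using K(3) \<open>A \<subseteq> E1\<close> \<open>B \<subseteq> E2\<close> unfolding clus_def by blast
    then show "\<exists>z\<in>clus \<Phi> f. A \<inter> (fst z \<union> snd z) = fst z \<and> B \<inter> (fst z \<union> snd z) = snd z \<and>
          sep (fst z \<union> snd z) (A \<union> B - (fst z \<union> snd z))"
      using cmps_sep[OF K(1)] by (intro bexI[of _ "(A \<inter> K, B \<inter> K)"]) (auto simp: KK)
  qed
  also have "\<dots> \<le> (\<Sum>z\<in>clus \<Phi> f. w1 (fst z) * w2 (snd z))"
    by (intro sum_mono peierls) (auto simp: clus_def)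
  finally show ?thesis by (simp add: split_beta)
qed

text \<open>Distinct components are separated, so \<open>peierls\<close> applies to the union of
  their shapes and its weight factorises. This yields a product bound although the two events are
  not independent.\<close>

lemma two_comp_prob:
  "Pr (\<lambda>A B. \<exists>K\<in>cmps (A \<union> B). \<exists>L\<in>cmps (A \<union> B). K \<noteq> L \<and> f \<in> K \<and> g \<in> L \<and>
        \<Phi> (A \<inter> K) (B \<inter> K) \<and> \<Phi> (A \<inter> L) (B \<inter> L))
    \<le> (\<Sum>(a,b)\<in>clus \<Phi> f. w1 a * w2 b) * (\<Sum>(a,b)\<in>clus \<Phi> g. w1 a * w2 b)"
proof -
  define I where "I = {(z,z')\<in>clus \<Phi> f \<times> clus \<Phi> g. sep (fst z \<union> snd z) (fst z' \<union> snd z')}"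
  let ?a = "\<lambda>u. fst (fst u) \<union> fst (snd u)" and ?b = "\<lambda>u. snd (fst u) \<union> snd (snd u)"
  have finI: "finite I"
    by (rule finite_subset[of _ "clus \<Phi> f \<times> clus \<Phi> g"]) (auto simp: I_def finite_clus)
  have "Pr (\<lambda>A B. \<exists>K\<in>cmps (A \<union> B). \<exists>L\<in>cmps (A \<union> B). K \<noteq> L \<and> f \<in> K \<and> g \<in> L \<and>
        \<Phi> (A \<inter> K) (B \<inter> K) \<and> \<Phi> (A \<inter> L) (B \<inter> L))
     \<le> (\<Sum>u\<in>I. Pr (\<lambda>A B. A \<inter> (?a u \<union> ?b u) = ?a u \<and> B \<inter> (?a u \<union> ?b u) = ?b u \<and>
          sep (?a u \<union> ?b u) (A \<union> B - (?a u \<union> ?b u))))"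
  proof (rule Pr_le_sum[OF finI])
    fix A B assume AB: "A \<subseteq> E1" "B \<subseteq> E2" and "\<exists>K\<in>cmps (A \<union> B). \<exists>L\<in>cmps (A \<union> B). K \<noteq> L \<and> f \<in> K \<and> g \<in> L \<and>
        \<Phi> (A \<inter> K) (B \<inter> K) \<and> \<Phi> (A \<inter> L) (B \<inter> L)"
    then obtain K L where K: "K \<in> cmps (A \<union> B)" "f \<in> K" "\<Phi> (A \<inter> K) (B \<inter> K)"
      and L: "L \<in> cmps (A \<union> B)" "g \<in> L" "\<Phi> (A \<inter> L) (B \<inter> L)" "K \<noteq> L" by blast
    have KK: "A \<inter> K \<union> B \<inter> K = K" using cmps_subset[OF K(1)] by blast
    have LL: "A \<inter> L \<union> B \<inter> L = L" using cmps_subset[OF L(1)] by blast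
    have "sep K L"
      by (rule sep_mono[OF cmps_sep[OF K(1)]])
        (use cmps_disjoint[OF K(1) L(1) L(4)] cmps_subset[OF L(1)] in auto)
    moreover have "conn (A \<inter> K \<union> B \<inter> K)" "f \<in> A \<inter> K \<union> B \<inter> K" unfolding KK using K cmps_conn by blast+
    then have "(A \<inter> K, B \<inter> K) \<in> clus \<Phi> f" using K(3) AB unfolding clus_def by blast
    moreover have "conn (A \<inter> L \<union> B \<inter> L)" "g \<in> A \<inter> L \<union> B \<inter> L" unfolding LL using L cmps_conn by blast+
    then have "(A \<inter> L, B \<inter> L) \<in> clus \<Phi> g" using L(3) AB unfolding clus_def by blast
    ultimately have u: "((A \<inter> K, B \<inter> K), (A \<inter> L, B \<inter> L)) \<in> I"
      unfolding I_def mem_Collect_eq prod.case fst_conv snd_conv KK LL by blast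
    have KL: "A \<inter> K \<union> A \<inter> L \<union> (B \<inter> K \<union> B \<inter> L) = K \<union> L" using KK LL by blast
    have "sep (K \<union> L) (A \<union> B - (K \<union> L))"
      using Union_cmps_sep[of "{K, L}" "A \<union> B"] K L by simp
    then show "\<exists>u\<in>I. A \<inter> (?a u \<union> ?b u) = ?a u \<and> B \<inter> (?a u \<union> ?b u) = ?b u \<and>
          sep (?a u \<union> ?b u) (A \<union> B - (?a u \<union> ?b u))"
      by (intro bexI[OF _ u]) (auto simp: KL)
  qed
  also have "\<dots> \<le> (\<Sum>u\<in>I. w1 (?a u) * w2 (?b u))"
    by (intro sum_mono peierls) (auto simp: clus_def I_def)
  also have "\<dots> = (\<Sum>u\<in>I. (w1 (fst (fst u)) * w2 (snd (fst u))) * (w1 (fst (snd u)) * w2 (snd (snd u))))"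
  proof (rule sum.cong)
    fix u assume u: "u \<in> I"
    then have s: "sep (fst (fst u) \<union> snd (fst u)) (fst (snd u) \<union> snd (snd u))"
      and sub: "fst (fst u) \<subseteq> E1" "fst (snd u) \<subseteq> E1" "snd (fst u) \<subseteq> E2" "snd (snd u) \<subseteq> E2"
      by (auto simp: I_def clus_def)
    have "w1 (?a u) = w1 (fst (fst u)) * w1 (fst (snd u))"
      by (rule wt_Un[OF sep_mono[OF s] PP(1)]) (use sub E finite_subset in auto)
    moreover have "w2 (?b u) = w2 (snd (fst u)) * w2 (snd (snd u))"
      by (rule wt_Un[OF sep_mono[OF s] PP(2)]) (use sub E finite_subset in auto)
    ultimately show "w1 (?a u) * w2 (?b u)
      = (w1 (fst (fst u)) * w2 (snd (fst u))) * (w1 (fst (snd u)) * w2 (snd (snd u)))" by simp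
  qed simp
  also have "\<dots> \<le> (\<Sum>u\<in>clus \<Phi> f \<times> clus \<Phi> g. (w1 (fst (fst u)) * w2 (snd (fst u))) * (w1 (fst (snd u)) * w2 (snd (snd u))))"
    by (rule sum_mono2) (use w_nonneg finite_clus in \<open>auto simp: I_def\<close>)
  also have "\<dots> = (\<Sum>(a,b)\<in>clus \<Phi> f. w1 a * w2 b) * (\<Sum>(a,b)\<in>clus \<Phi> g. w1 a * w2 b)"
    unfolding sum_product sum.cartesian_product by (rule sum.cong) auto
  finally show ?thesis .
qed

end

section \<open>Exchanging the two configurations on selected clusters\<close>

context pair_system
begin

definition swapU :: "('e set \<Rightarrow> 'e set \<Rightarrow> bool) \<Rightarrow> 'e set \<Rightarrow> 'e set \<Rightarrow> 'e set" where
  "swapU \<Phi> A B = \<Union>{K \<in> cmps (A \<union> B). \<Phi> (A \<inter> K) (B \<inter> K)}"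

text \<open>The first configuration after the exchange; for symmetric \<Phi> the second one is
  \<open>swap \<Phi> B A\<close>, as both then use the same \<open>swapU\<close>.\<close>

definition swap :: "('e set \<Rightarrow> 'e set \<Rightarrow> bool) \<Rightarrow> 'e set \<Rightarrow> 'e set \<Rightarrow> 'e set" where
  "swap \<Phi> A B = (A - swapU \<Phi> A B) \<union> (B \<inter> swapU \<Phi> A B)"

lemma swapU_subset: "swapU \<Phi> A B \<subseteq> A \<union> B"
  unfolding swapU_def using cmps_subset by blast

lemma swapU_sep: "sep (swapU \<Phi> A B) (A \<union> B - swapU \<Phi> A B)"
  unfolding swapU_def by (rule Union_cmps_sep) auto

lemma swapU_iff: "K \<in> cmps (A \<union> B) \<Longrightarrow> e \<in> K \<Longrightarrow> e \<in> swapU \<Phi> A B \<longleftrightarrow> \<Phi> (A \<inter> K) (B \<inter> K)"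
  unfolding swapU_def using cmps_eq_cmp by blast

lemma swapU_commute: "(\<And>a b. \<Phi> a b = \<Phi> b a) \<Longrightarrow> swapU \<Phi> B A = swapU \<Phi> A B"
  unfolding swapU_def by (simp add: Un_commute)

text \<open>The union of the pair, hence the family of clusters, does not change, and on each
  cluster \<Phi> sees the same two sets, possibly in the other order.\<close>

lemma swapU_swap:
  assumes "\<And>a b. \<Phi> a b = \<Phi> b a"
  shows "swapU \<Phi> (swap \<Phi> A B) (swap \<Phi> B A) = swapU \<Phi> A B"
proof -
  let ?U = "swapU \<Phi> A B"
  have c: "swapU \<Phi> B A = ?U" using swapU_commute assms by blast
  have un: "swap \<Phi> A B \<union> swap \<Phi> B A = A \<union> B" unfolding swap_def c by blast
  have "\<Phi> (swap \<Phi> A B \<inter> K) (swap \<Phi> B A \<inter> K) = \<Phi> (A \<inter> K) (B \<inter> K)" if K: "K \<in> cmps (A \<union> B)" for K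
  proof (cases "\<Phi> (A \<inter> K) (B \<inter> K)")
    case True
    then have "K \<subseteq> ?U" using K by (auto simp: swapU_def)
    then have "swap \<Phi> A B \<inter> K = B \<inter> K" "swap \<Phi> B A \<inter> K = A \<inter> K" unfolding swap_def c by blast+
    then show ?thesis using assms by simp
  next
    case False
    then have "K \<inter> ?U = {}" using swapU_iff[OF K] by blast
    then have "swap \<Phi> A B \<inter> K = A \<inter> K" "swap \<Phi> B A \<inter> K = B \<inter> K" unfolding swap_def c by blast+
    then show ?thesis by simp
  qed
  then show ?thesis unfolding swapU_def[of \<Phi> "swap \<Phi> A B"] un unfolding swapU_def by blast
qed

lemma swap_swap:
  assumes "\<And>a b. \<Phi> a b = \<Phi> b a"
  shows "swap \<Phi> (swap \<Phi> A B) (swap \<Phi> B A) = A"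
proof -
  have "swapU \<Phi> B A = swapU \<Phi> A B" using swapU_commute assms by blast
  then show ?thesis
    using swapU_subset[of \<Phi> A B]
    unfolding swap_def[of \<Phi> "swap \<Phi> A B"] swapU_swap[of \<Phi>, OF assms] unfolding swap_def by blast
qed

lemma swap_weight:
  assumes sym: "\<And>a b. \<Phi> a b = \<Phi> b a" and AB: "A \<subseteq> E1" "B \<subseteq> E2"
    and H: "w1 (A \<inter> swapU \<Phi> A B) * w2 (B \<inter> swapU \<Phi> A B) = w1 (B \<inter> swapU \<Phi> A B) * w2 (A \<inter> swapU \<Phi> A B)"
  shows "w1 (swap \<Phi> A B) * w2 (swap \<Phi> B A) = w1 A * w2 B"
proof -
  let ?U = "swapU \<Phi> A B"
  have c: "swapU \<Phi> B A = ?U" using swapU_commute sym by blast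
  have fin: "finite A" "finite B" using AB E finite_subset by blast+
  note s = sep_mono[OF swapU_sep[of \<Phi> A B]]
  have 1: "w1 A = w1 (A \<inter> ?U) * w1 (A - ?U)"
  proof -
    have "w1 (A \<inter> ?U \<union> (A - ?U)) = w1 (A \<inter> ?U) * w1 (A - ?U)"
      by (rule wt_Un[OF s PP(1)]) (use fin in auto)
    then show ?thesis by (simp only: Int_Diff_Un)
  qed
  have 2: "w2 B = w2 (B \<inter> ?U) * w2 (B - ?U)"
  proof -
    have "w2 (B \<inter> ?U \<union> (B - ?U)) = w2 (B \<inter> ?U) * w2 (B - ?U)"
      by (rule wt_Un[OF s PP(2)]) (use fin in auto)
    then show ?thesis by (simp only: Int_Diff_Un)
  qed
  have 3: "w1 (swap \<Phi> A B) = w1 (B \<inter> ?U) * w1 (A - ?U)"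
    unfolding swap_def Un_commute[of "A - ?U"] by (rule wt_Un[OF s PP(1)]) (use fin in auto)
  have 4: "w2 (swap \<Phi> B A) = w2 (A \<inter> ?U) * w2 (B - ?U)"
    unfolding swap_def c Un_commute[of "B - ?U"] by (rule wt_Un[OF s PP(2)]) (use fin in auto)
  show ?thesis unfolding 3 4 using H by (subst 1, subst 2) (simp add: mult_ac)
qed

text \<open>The exchange is an involution, hence a change of variables. The two weights have to
  agree on the exchanged part only, because the rest is separated from it.\<close>

lemma PE_swap:
  assumes sym: "\<And>a b. \<Phi> a b = \<Phi> b a"
    and H: "\<And>A B. A \<subseteq> E1 \<Longrightarrow> B \<subseteq> E2 \<Longrightarrow> A \<inter> swapU \<Phi> A B \<subseteq> E2 \<and> B \<inter> swapU \<Phi> A B \<subseteq> E1 \<and>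
      w1 (A \<inter> swapU \<Phi> A B) * w2 (B \<inter> swapU \<Phi> A B) = w1 (B \<inter> swapU \<Phi> A B) * w2 (A \<inter> swapU \<Phi> A B)"
  shows "PE h = PE (\<lambda>A B. h (swap \<Phi> A B) (swap \<Phi> B A))"
proof -
  let ?T = "\<lambda>(A, B). (swap \<Phi> A B, swap \<Phi> B A)"
  have mem: "swap \<Phi> A B \<subseteq> E1 \<and> swap \<Phi> B A \<subseteq> E2" if "A \<subseteq> E1" "B \<subseteq> E2" for A B
    using H[OF that] that swapU_commute[of \<Phi> B A, OF sym] unfolding swap_def by auto
  have "(\<Sum>(A,B)\<in>Pow E1 \<times> Pow E2. w1 A * w2 B * h A B)
      = (\<Sum>(A,B)\<in>Pow E1 \<times> Pow E2. w1 A * w2 B * h (swap \<Phi> A B) (swap \<Phi> B A))"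
  proof (rule sum.reindex_bij_witness[where i = ?T and j = ?T])
    fix z assume z: "z \<in> Pow E1 \<times> Pow E2"
    obtain A B where AB: "z = (A, B)" "A \<subseteq> E1" "B \<subseteq> E2" using z by blast
    show "?T (?T z) = z" using AB swap_swap[of \<Phi>, OF sym] by simp
    show "?T (?T z) = z" by fact
    show "?T z \<in> Pow E1 \<times> Pow E2" using AB mem by simp
    show "?T z \<in> Pow E1 \<times> Pow E2" by fact
    show "(case ?T z of (A, B) \<Rightarrow> w1 A * w2 B * h (swap \<Phi> A B) (swap \<Phi> B A)) = (case z of (A, B) \<Rightarrow> w1 A * w2 B * h A B)"
      using AB swap_swap[of \<Phi>, OF sym] swap_weight[of \<Phi> A B, OF sym AB(2,3)] H[OF AB(2,3)] by simp
  qed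
  then show ?thesis by (simp add: PE_def)
qed

end

section \<open>Resampling the spin of a single edge\<close>

context plaq_complex
begin

definition upl :: "'e \<Rightarrow> 'e set \<Rightarrow> nat" where
  "upl e A = card {p\<in>P. e \<in> bd p \<and> odd (card (bd p \<inter> (A - {e})))}"

text \<open>The odds of spin 1 against spin 0 at an edge, given all others. The quotient replaces
  \<open>y ^ (6 - 2 * u)\<close>, whose exponent, a natural number, would be cut off at 0 for u >
  3.\<close>

definition ratio :: "real \<Rightarrow> real \<Rightarrow> nat \<Rightarrow> real" where
  "ratio x y u = x * y ^ 6 / y ^ (2 * u)"

text \<open>\<open>theta x y (upl e A)\<close> is the expectation of the sign of \<open>e\<close> given the other edges of \<open>A\<close>, see \<open>sum_flip\<close>.\<close>
definition theta :: "real \<Rightarrow> real \<Rightarrow> nat \<Rightarrow> real" where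
  "theta x y u = (1 - ratio x y u) / (1 + ratio x y u)"

text \<open>Adding \<open>e\<close> changes the status of exactly its six plaquettes:
  \<open>upl e A\<close> of them become even, the others odd.\<close>

lemma card_dd_insert:
  assumes "finite A" "e \<notin> A" "card {p\<in>P. e \<in> bd p} = 6"
  shows "card (dd P (insert e A)) + 2 * upl e A = card (dd P A) + 6"
proof -
  let ?O = "{p\<in>P. e \<in> bd p \<and> odd (card (bd p \<inter> A))}"
  let ?V = "{p\<in>P. e \<in> bd p \<and> even (card (bd p \<inter> A))}"
  let ?R = "{p\<in>P. e \<notin> bd p \<and> odd (card (bd p \<inter> A))}"
  have u: "upl e A = card ?O" unfolding upl_def using assms(2) by simp
  have fin: "finite ?O" "finite ?V" using finite_cobd[of e] by (auto elim: finite_subset[rotated])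
  have "dd P A = ?O \<union> ?R" by (auto simp: dd_def)
  moreover have finR: "finite ?R"
    using finite_dd[OF assms(1) subset_refl] by (rule finite_subset[rotated]) (auto simp: dd_def)
  ultimately have 1: "card (dd P A) = card ?O + card ?R"
    using fin by (simp add: card_Un_disjoint disjoint_iff)
  have "card (bd p \<inter> insert e A) = (if e \<in> bd p then Suc (card (bd p \<inter> A)) else card (bd p \<inter> A))" for p
    using assms(1,2) by simp
  then have "dd P (insert e A) = ?V \<union> ?R" by (auto simp: dd_def)
  then have 2: "card (dd P (insert e A)) = card ?V + card ?R"
    using fin finR by (simp add: card_Un_disjoint disjoint_iff)
  have "{p\<in>P. e \<in> bd p} = ?O \<union> ?V" by auto
  then have "6 = card ?O + card ?V"
    using fin assms(3) by (simp add: card_Un_disjoint disjoint_iff)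
  then show ?thesis using 1 2 u by simp
qed

lemma wt_insert:
  assumes "finite A" "e \<notin> A" "card {p\<in>P. e \<in> bd p} = 6" "0 < y"
  shows "wt x y P (insert e A) = wt x y P A * ratio x y (upl e A)"
proof -
  have "y ^ card (dd P (insert e A)) * y ^ (2 * upl e A) = y ^ card (dd P A) * y ^ 6"
    using card_dd_insert[OF assms(1-3)] by (simp only: power_add[symmetric])
  then have "y ^ card (dd P (insert e A)) = y ^ card (dd P A) * y ^ 6 / y ^ (2 * upl e A)"
    using assms(4) by (simp add: field_simps)
  then show ?thesis using assms by (simp add: wt_def ratio_def)
qed

lemma upl_insert: "upl e (insert e A) = upl e A"
  by (simp add: upl_def)

lemma ratio_nonneg: "0 \<le> x \<Longrightarrow> 0 \<le> y \<Longrightarrow> 0 \<le> ratio x y u"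
  by (simp add: ratio_def)

text \<open>Sets are paired as \<open>A\<close> and \<open>insert e A\<close>. Their weights are as
  1 to r, so the sign averages to (1 - r) / (1 + r), while \<open>g\<close> and \<open>upl e\<close>
  do not see \<open>e\<close>.\<close>

lemma sum_flip:
  fixes g :: "'e set \<Rightarrow> real"
  assumes "finite E" "e \<in> E" "card {p\<in>P. e \<in> bd p} = 6" "0 < y" "0 \<le> x"
    and g: "\<And>A. g (insert e A) = g A"
  shows "(\<Sum>A\<in>Pow E. wt x y P A * (g A * (if e \<in> A then - 1 else 1)))
       = (\<Sum>A\<in>Pow E. wt x y P A * (g A * theta x y (upl e A)))"
proof -
  define D where "D = E - {e}"
  have D: "finite D" "e \<notin> D" "E = insert e D" using assms by (auto simp: D_def)
  have split: "(\<Sum>A\<in>Pow E. F A) = (\<Sum>A\<in>Pow D. F A + F (insert e A))" for F :: "'e set \<Rightarrow> real"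
  proof -
    have "inj_on (insert e) (Pow D)" using D(2) by (auto simp: inj_on_def insert_ident subset_iff)
    moreover have "Pow D \<inter> insert e ` Pow D = {}" using D(2) by auto
    ultimately show ?thesis unfolding D(3) Pow_insert
      using D(1) by (simp add: sum.union_disjoint sum.reindex sum.distrib)
  qed
  show ?thesis
    unfolding split
  proof (rule sum.cong)
    fix A assume "A \<in> Pow D"
    then have A: "finite A" "e \<notin> A" using D finite_subset by auto
    have "1 + ratio x y (upl e A) \<noteq> 0" using ratio_nonneg[of x y "upl e A"] assms by simp
    then have "(1 - ratio x y (upl e A)) = (1 + ratio x y (upl e A)) * theta x y (upl e A)"
      by (simp add: theta_def)
    then have "wt x y P A * g A * (1 - ratio x y (upl e A))
        = wt x y P A * g A * ((1 + ratio x y (upl e A)) * theta x y (upl e A))" by simp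
    then show "wt x y P A * (g A * (if e \<in> A then - 1 else 1)) +
         wt x y P (insert e A) * (g (insert e A) * (if e \<in> insert e A then - 1 else 1)) =
         wt x y P A * (g A * theta x y (upl e A)) +
         wt x y P (insert e A) * (g (insert e A) * theta x y (upl e (insert e A)))"
      using A g wt_insert[OF A assms(3,4)] by (simp add: upl_insert algebra_simps)
  qed simp
qed

lemma upl_far: "\<not> adj e f \<Longrightarrow> upl e (insert f A) = upl e A"
  unfolding upl_def adj_def
  by (intro arg_cong[where f = card] Collect_cong) (auto simp: insert_Diff_if)

text \<open>The edges are resampled one at a time. As edges of \<open>G\<close> share no plaquette,
  flipping one of them does not affect \<open>theta\<close> at the others.\<close>

lemma sum_flip_all:
  fixes c :: "'e set \<Rightarrow> real"
  assumes "finite E" "0 < y" "0 \<le> x" "finite G" "G \<subseteq> E"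
    and "\<And>e. e \<in> G \<Longrightarrow> card {p\<in>P. e \<in> bd p} = 6"
    and "\<And>e f. e \<in> G \<Longrightarrow> f \<in> G \<Longrightarrow> e \<noteq> f \<Longrightarrow> \<not> adj e f"
    and "\<And>e A. e \<in> G \<Longrightarrow> c (insert e A) = c A"
  shows "(\<Sum>A\<in>Pow E. wt x y P A * (c A * (\<Prod>e\<in>G. if e \<in> A then - 1 else 1)))
       = (\<Sum>A\<in>Pow E. wt x y P A * (c A * (\<Prod>e\<in>G. theta x y (upl e A))))"
  using assms(4-8)
proof (induction G arbitrary: c rule: finite_induct)
  case (insert e G)
  let ?s = "\<lambda>e A. if e \<in> A then - 1 else (1 :: real)"
  have "(\<Sum>A\<in>Pow E. wt x y P A * (c A * (\<Prod>e\<in>insert e G. ?s e A)))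
      = (\<Sum>A\<in>Pow E. wt x y P A * ((c A * ?s e A) * (\<Prod>e\<in>G. ?s e A)))"
    using insert by (simp add: mult_ac)
  \<comment> \<open>The sign of \<open>e\<close> is absorbed into \<open>c\<close>, which is why
    \<open>c\<close> is arbitrary in the induction.\<close>
  also have "\<dots> = (\<Sum>A\<in>Pow E. wt x y P A * ((c A * ?s e A) * (\<Prod>e\<in>G. theta x y (upl e A))))"
    by (rule insert.IH) (use insert in auto)
  also have "\<dots> = (\<Sum>A\<in>Pow E. wt x y P A * ((c A * (\<Prod>e\<in>G. theta x y (upl e A))) * ?s e A))"
    by (simp only: mult_ac)
  also have "\<dots> = (\<Sum>A\<in>Pow E. wt x y P A * ((c A * (\<Prod>e\<in>G. theta x y (upl e A))) * theta x y (upl e A)))"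
  proof (rule sum_flip)
    fix A
    have "(\<Prod>f\<in>G. theta x y (upl f (insert e A))) = (\<Prod>f\<in>G. theta x y (upl f A))"
      by (rule prod.cong) (use insert in \<open>auto intro!: arg_cong[where f = "theta x y"] upl_far\<close>)
    then show "c (insert e A) * (\<Prod>f\<in>G. theta x y (upl f (insert e A))) = c A * (\<Prod>f\<in>G. theta x y (upl f A))"
      using insert.prems(4)[of e A] by simp
  qed (use assms insert in auto)
  finally show ?case using insert by (simp add: mult_ac)
qed simp

end

section \<open>The cubical complex of the lattice\<close>

type_synonym uedge = "vtx \<times> nat"
type_synonym uplaq = "vtx \<times> nat \<times> nat"

definition up :: "vtx \<Rightarrow> nat \<Rightarrow> vtx" where "up x i = vplus x (unitv i)"
definition dn :: "vtx \<Rightarrow> nat \<Rightarrow> vtx" where "dn x i = (\<lambda>k. x k - unitv i k)"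

lemma up_app: "up x i k = x k + (if k = i then 1 else 0)"
  by (simp add: up_def vplus_def unitv_def)

lemma dn_app: "dn x i k = x k - (if k = i then 1 else 0)"
  by (simp add: dn_def unitv_def)

lemma up_dn [simp]: "up (dn x i) i = x" "dn (up x i) i = x"
  by (auto simp: fun_eq_iff up_app dn_app)

lemma up_up: "up (up x i) j = up (up x j) i"
  by (auto simp: fun_eq_iff up_app)

lemma dn_up: "dn (up x i) j = up (dn x j) i"
  by (auto simp: fun_eq_iff up_app dn_app)

lemma up_inj [simp]: "up x i = up y i \<longleftrightarrow> x = y"
  by (metis up_dn(2))

lemma up_neq [simp]: "up x i \<noteq> x" "x \<noteq> up x i" "dn x i \<noteq> x" "x \<noteq> dn x i"
proof -
  have "up x i i \<noteq> x i" "dn x i i \<noteq> x i" by (simp_all add: up_app dn_app)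
  then show "up x i \<noteq> x" "x \<noteq> up x i" "dn x i \<noteq> x" "x \<noteq> dn x i" by metis+
qed

lemma up_eq_up [simp]: "up x i = up x j \<longleftrightarrow> i = j"
proof
  assume "up x i = up x j"
  then have "up x i i = up x j i" by simp
  then show "i = j" by (simp add: up_app split: if_splits)
qed simp

lemma dn_eq_dn [simp]: "dn x i = dn x j \<longleftrightarrow> i = j"
proof
  assume "dn x i = dn x j"
  then have "dn x i i = dn x j i" by simp
  then show "i = j" by (simp add: dn_app split: if_splits)
qed simp

lemma up_neq_dn [simp]: "up x i \<noteq> dn x j" "dn x j \<noteq> up x i"
proof -
  have "up x i i > dn x j i" by (simp add: up_app dn_app)
  then show "up x i \<noteq> dn x j" "dn x j \<noteq> up x i" by (metis less_irrefl)+
qed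

lemma up_lattice [simp]: "i < 4 \<Longrightarrow> up x i \<in> lattice \<longleftrightarrow> x \<in> lattice"
  by (auto simp: lattice_def up_app)

lemma dn_lattice [simp]: "i < 4 \<Longrightarrow> dn x i \<in> lattice \<longleftrightarrow> x \<in> lattice"
  using up_lattice[of i "dn x i"] by simp

definition UE :: "uedge set" where "UE = lattice \<times> {..<4}"

definition PL :: "uplaq set" where "PL = {(x, i, j). x \<in> lattice \<and> i < j \<and> j < 4}"

definition bd4 :: "vtx \<Rightarrow> nat \<Rightarrow> nat \<Rightarrow> uedge set" where
  "bd4 x i j = {(x, i), (up x i, j), (up x j, i), (x, j)}"

definition bdp :: "uplaq \<Rightarrow> uedge set" where
  "bdp p = bd4 (fst p) (fst (snd p)) (snd (snd p))"

text \<open>Plaquettes are stored with increasing directions; \<open>pt\<close> accepts them in either order.\<close>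
definition pt :: "vtx \<Rightarrow> nat \<Rightarrow> nat \<Rightarrow> uplaq" where
  "pt x i j = (x, min i j, max i j)"

lemma pt_commute: "pt x i j = pt x j i"
  by (simp add: pt_def min.commute max.commute)

lemma bdp_pt: "bdp (pt x i j) = bd4 x i j"
  by (auto simp: bdp_def pt_def bd4_def min_def max_def)

lemma pt_PL: "i \<noteq> j \<Longrightarrow> pt x i j \<in> PL \<longleftrightarrow> x \<in> lattice \<and> i < 4 \<and> j < 4"
  by (auto simp: PL_def pt_def min_def max_def)

lemma pt_eq: "pt x i j = pt y i k \<longleftrightarrow> x = y \<and> j = k"
  by (auto simp: pt_def min_def max_def split: if_splits)

lemma PL_cases:
  assumes "p \<in> PL" obtains x i j where "p = pt x i j" "x \<in> lattice" "i \<noteq> j" "i < 4" "j < 4"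
  using assms that[of "fst p" "fst (snd p)" "snd (snd p)"] by (auto simp: PL_def pt_def)

lemma card_bdp: "p \<in> PL \<Longrightarrow> card (bdp p) = 4"
  by (auto simp: PL_def bdp_def bd4_def card_insert_if)

definition cob :: "uedge \<Rightarrow> uplaq set" where
  "cob e = {p\<in>PL. e \<in> bdp p}"

text \<open>For each of the three directions k other than j there is one plaquette on either side of
  the edge, based at \<open>x\<close> and at \<open>dn x k\<close>.\<close>

lemma mem_cob_cases:
  assumes "p \<in> cob (x, j)"
  obtains k where "k \<noteq> j" "k < 4" "j < 4" "x \<in> lattice" "p = pt x j k \<or> p = pt (dn x k) j k"
proof -
  obtain z a b where p: "p = pt z a b" "z \<in> lattice" "a \<noteq> b" "a < 4" "b < 4"
    using assms PL_cases[of p] by (auto simp: cob_def)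
  have "(x, j) \<in> bd4 z a b" using assms p by (simp add: cob_def bdp_pt)
  then consider "x = z" "j = a" | "x = up z a" "j = b" | "x = up z b" "j = a" | "x = z" "j = b"
    by (auto simp: bd4_def)
  then show thesis
  proof cases
    case 1 then show thesis using p that[of b] by simp
  next
    case 2 then show thesis using p that[of a] by (simp add: pt_commute)
  next
    case 3 then show thesis using p that[of b] by simp
  next
    case 4 then show thesis using p that[of a] by (simp add: pt_commute)
  qed
qed

lemma cob_eq:
  assumes "x \<in> lattice" "j < 4"
  shows "cob (x, j) = (\<lambda>k. pt x j k) ` ({..<4} - {j}) \<union> (\<lambda>k. pt (dn x k) j k) ` ({..<4} - {j})"
proof (intro equalityI subsetI)
  fix p assume "p \<in> cob (x, j)"
  then show "p \<in> (\<lambda>k. pt x j k) ` ({..<4} - {j}) \<union> (\<lambda>k. pt (dn x k) j k) ` ({..<4} - {j})"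
    by (rule mem_cob_cases) auto
next
  fix p assume "p \<in> (\<lambda>k. pt x j k) ` ({..<4} - {j}) \<union> (\<lambda>k. pt (dn x k) j k) ` ({..<4} - {j})"
  then show "p \<in> cob (x, j)"
    using assms by (auto simp: cob_def bdp_pt bd4_def pt_PL)
qed

lemma card_cob:
  assumes "e \<in> UE" shows "card (cob e) = 6"
proof -
  obtain x j where e: "e = (x, j)" "x \<in> lattice" "j < 4" using assms by (auto simp: UE_def)
  have "inj_on (\<lambda>k. pt x j k) ({..<4} - {j})" "inj_on (\<lambda>k. pt (dn x k) j k) ({..<4} - {j})"
    by (auto simp: inj_on_def pt_eq)
  moreover have "(\<lambda>k. pt x j k) ` ({..<4} - {j}) \<inter> (\<lambda>k. pt (dn x k) j k) ` ({..<4} - {j}) = {}"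
    by (auto simp: pt_eq)
  ultimately show ?thesis unfolding e(1) cob_eq[OF e(2,3)]
    using e(3) by (simp add: card_Un_disjoint card_image)
qed

lemma cob_nonUE: "e \<notin> UE \<Longrightarrow> cob e = {}"
  by (cases e) (auto simp: UE_def elim!: mem_cob_cases)

interpretation lat: plaq_complex PL bdp
proof
  fix e
  have "card (cob e) \<le> 6 \<and> finite (cob e)"
  proof (cases "e \<in> UE")
    case True
    then have "card (cob e) = 6" by (rule card_cob)
    then show ?thesis by (metis card.infinite le_refl zero_neq_numeral)
  qed (simp add: cob_nonUE)
  then show "card {p \<in> PL. e \<in> bdp p} \<le> 6" "finite {p \<in> PL. e \<in> bdp p}" by (simp_all add: cob_def)
qed (rule card_bdp)

lemma finite_cob: "finite (cob e)"
  unfolding cob_def by (rule lat.finite_cobd)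

text \<open>A plaquette at \<open>e\<close> is fixed by its transverse direction and its side, and
  any second edge of it reveals both.\<close>

lemma share_unique:
  assumes "e \<noteq> f" "p \<in> cob e" "p \<in> cob f" "p' \<in> cob e" "p' \<in> cob f"
  shows "p = p'"
proof -
  obtain x a y b where ef: "e = (x, a)" "f = (y, b)" by fastforce
  obtain k where k: "k \<noteq> a" "p = pt x a k \<or> p = pt (dn x k) a k"
    using mem_cob_cases assms(2) unfolding ef by metis
  obtain l where l: "l \<noteq> a" "p' = pt x a l \<or> p' = pt (dn x l) a l"
    using mem_cob_cases assms(4) unfolding ef by metis
  have f: "(y, b) \<in> bdp p" "(y, b) \<in> bdp p'" "(y, b) \<noteq> (x, a)" using assms ef by (auto simp: cob_def)
  have nd: "up (dn x m) a \<noteq> x" "up (dn x m) a \<noteq> up x a" if "m \<noteq> a" for m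
    using that by (metis up_dn(1) up_eq_up up_inj) (simp)
  have nd2: "up (dn x m) a = up (dn x n) a \<longleftrightarrow> m = n" for m n by simp
  show ?thesis
    using k l f nd[of k] nd[of l] by (auto simp: bdp_pt bd4_def)
qed

lemma card_share: "e \<noteq> f \<Longrightarrow> card (cob e \<inter> cob f) \<le> 1"
  using share_unique[of e f] by (metis (no_types, lifting) Int_iff One_nat_def card_le_Suc0_iff_eq finite_Int finite_cob)

lemma cob_inj: "e \<in> UE \<Longrightarrow> cob e = cob f \<Longrightarrow> e = f"
  using card_share[of e f] card_cob[of e] by force

subsection \<open>Small coboundaries\<close>

text \<open>The parity of \<open>A\<close> on a plaquette as an exclusive or of memberships, so that
  relations between plaquettes become propositional.\<close>

definition nu :: "uedge set \<Rightarrow> vtx \<Rightarrow> nat \<Rightarrow> nat \<Rightarrow> bool" where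
  "nu A x i j \<longleftrightarrow> (((x, i) \<in> A) \<noteq> ((up x i, j) \<in> A)) \<noteq> (((up x j, i) \<in> A) \<noteq> ((x, j) \<in> A))"

abbreviation "cb \<equiv> lat.dd PL"

lemma odd_bd4: "i \<noteq> j \<Longrightarrow> odd (card (bd4 x i j \<inter> A)) \<longleftrightarrow> nu A x i j"
  unfolding bd4_def nu_def by (auto simp: Int_insert_left card_insert_if)

lemma pt_cb: "i \<noteq> j \<Longrightarrow> pt x i j \<in> cb A \<longleftrightarrow> x \<in> lattice \<and> i < 4 \<and> j < 4 \<and> nu A x i j"
  by (auto simp: lat.dd_def pt_PL bdp_pt odd_bd4)

text \<open>The coboundary of a coboundary vanishes: each edge of the cube lies in two of its six
  faces, so an even number of faces is frustrated.\<close>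

lemma cube_closed:
  assumes "x \<in> lattice" "i < 4" "j < 4" "k < 4" "i \<noteq> j" "i \<noteq> k" "j \<noteq> k"
  shows "((pt x i j \<in> cb A) \<noteq> (pt (up x k) i j \<in> cb A)) \<noteq>
    (((pt x i k \<in> cb A) \<noteq> (pt (up x j) i k \<in> cb A)) \<noteq>
    ((pt x j k \<in> cb A) \<noteq> (pt (up x i) j k \<in> cb A))) \<longleftrightarrow> False"
proof -
  have "up (up x k) i = up (up x i) k" "up (up x k) j = up (up x j) k" "up (up x j) i = up (up x i) j"
    by (rule up_up)+
  then show ?thesis using assms by (simp add: pt_cb nu_def) argo
qed

context
  fixes A :: "uedge set"
  assumes finA: "finite A"
begin

private abbreviation "D \<equiv> cb A"

lemma finD: "finite D"
  by (rule lat.finite_dd[OF finA]) simp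

lemma D_cases:
  assumes "p \<in> D" obtains x i j where "p = pt x i j" "x \<in> lattice" "i \<noteq> j" "i < 4" "j < 4"
  using assms PL_cases[of p] by (auto simp: lat.dd_def)

lemma no_infinite_line:
  fixes X :: "nat \<Rightarrow> vtx"
  assumes "\<And>t. pt (X t) j k \<in> D" "inj X"
  shows False
proof -
  have "inj (\<lambda>t :: nat. pt (X t) j k)" using assms(2) by (auto simp: inj_def pt_eq)
  then have "infinite (range (\<lambda>t. pt (X t) j k))" using finite_imageD infinite_UNIV_nat by blast
  then show False using assms(1) finD by (meson finite_subset image_subsetI)
qed

text \<open>If no plaquette in direction \<open>i\<close> lies above, membership in \<open>D\<close> propagates upwards
  in direction \<open>i\<close> forever; similarly downwards in \<open>level_dn\<close>.\<close>
lemma level_up: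
  assumes i: "i < 4" "j < 4" "k < 4" "i \<noteq> j" "i \<noteq> k" "j \<noteq> k" and x: "x \<in> lattice"
    and no: "\<And>z b. b \<noteq> i \<Longrightarrow> x i \<le> z i \<Longrightarrow> pt z i b \<notin> D"
  shows "pt x j k \<notin> D"
proof
  assume in0: "pt x j k \<in> D"
  define X where "X t = ((\<lambda>y. up y i) ^^ t) x" for t
  have XS: "X (Suc t) = up (X t) i" for t by (simp add: X_def)
  have Xi: "X t i = x i + int t" for t by (induction t) (simp_all add: XS up_app X_def[of 0])
  have "X t \<in> lattice \<and> pt (X t) j k \<in> D" for t
  proof (induction t)
    case 0 then show ?case using in0 x by (simp add: X_def)
  next
    case (Suc t)
    have "pt (X t) i j \<notin> D" "pt (up (X t) k) i j \<notin> D" "pt (X t) i k \<notin> D" "pt (up (X t) j) i k \<notin> D"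
      by (rule no; use i in \<open>simp add: Xi up_app\<close>)+
    then show ?case using cube_closed[of "X t" i j k A] Suc i by (simp add: XS)
  qed
  moreover have "inj X" by (rule injI) (metis Xi add_left_cancel of_nat_eq_iff)
  ultimately show False using no_infinite_line by blast
qed

lemma level_dn:
  assumes i: "i < 4" "j < 4" "k < 4" "i \<noteq> j" "i \<noteq> k" "j \<noteq> k" and x: "x \<in> lattice"
    and no: "\<And>z b. b \<noteq> i \<Longrightarrow> z i < x i \<Longrightarrow> pt z i b \<notin> D"
  shows "pt x j k \<notin> D"
proof
  assume in0: "pt x j k \<in> D"
  define X where "X t = ((\<lambda>y. dn y i) ^^ t) x" for t
  have XS: "X (Suc t) = dn (X t) i" for t by (simp add: X_def)
  have Xi: "X t i = x i - int t" for t by (induction t) (simp_all add: XS dn_app X_def[of 0])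
  have "X t \<in> lattice \<and> pt (X t) j k \<in> D" for t
  proof (induction t)
    case 0 then show ?case using in0 x by (simp add: X_def)
  next
    case (Suc t)
    let ?y = "dn (X t) i"
    have "pt ?y i j \<notin> D" "pt (up ?y k) i j \<notin> D" "pt ?y i k \<notin> D" "pt (up ?y j) i k \<notin> D"
      by (rule no; use i in \<open>simp add: Xi up_app dn_app\<close>)+
    then show ?case using cube_closed[of ?y i j k A] Suc i by (simp add: XS)
  qed
  moreover have "inj X" by (rule injI) (metis Xi diff_left_imp_eq of_nat_eq_iff)
  ultimately show False using no_infinite_line by blast
qed

definition Dd :: "nat \<Rightarrow> uplaq set" where
  "Dd i = {p \<in> D. fst (snd p) = i \<or> snd (snd p) = i}"

lemma Dd_pt: "pt z i b \<in> D \<Longrightarrow> pt z i b \<in> Dd i"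
  by (auto simp: Dd_def pt_def)

lemma Dd_cases:
  assumes "p \<in> Dd i" obtains x j where "p = pt x i j" "x \<in> lattice" "i \<noteq> j" "i < 4" "j < 4"
proof -
  obtain x a b where p: "p = pt x a b" "x \<in> lattice" "a \<noteq> b" "a < 4" "b < 4"
    using assms D_cases[of p] by (auto simp: Dd_def)
  then have "i = a \<or> i = b" using assms by (auto simp: Dd_def pt_def min_def max_def split: if_splits)
  then show thesis using that[of x a] that[of x b] p by (auto simp: pt_commute)
qed

lemma finDd: "finite (Dd i)"
  using finD by (auto simp: Dd_def)

lemma not_Dd: "pt x j k \<in> D \<Longrightarrow> j \<noteq> k \<Longrightarrow> pt x j k \<notin> Dd i \<Longrightarrow> i \<noteq> j \<and> i \<noteq> k"
  by (auto simp: Dd_def pt_def min_def max_def split: if_splits)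

text \<open>A plaquette of \<open>D\<close> without direction \<open>i\<close> would propagate away
  from the level \<open>a\<close>, by \<open>level_up\<close> or \<open>level_dn\<close>, to
  infinitely many others.\<close>

lemma one_level:
  assumes "i < 4" "\<And>p. p \<in> Dd i \<Longrightarrow> fst p i = a"
  shows "D = Dd i"
proof (rule ccontr)
  assume "D \<noteq> Dd i"
  then obtain p where p: "p \<in> D" "p \<notin> Dd i" by (auto simp: Dd_def)
  obtain x j k where x: "p = pt x j k" "x \<in> lattice" "j \<noteq> k" "j < 4" "k < 4"
    using D_cases[OF p(1)] .
  have ijk: "i \<noteq> j" "i \<noteq> k" using not_Dd[of x j k i] p x by auto
  have lev: "z i = a" if "pt z i b \<in> D" for z b
    using assms(2)[OF Dd_pt[OF that]] by (simp add: pt_def)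
  have "pt x j k \<notin> D"
  proof (cases "x i \<le> a")
    case True
    show ?thesis by (rule level_dn[of i]) (use x ijk assms(1) True lev in force)+
  next
    case False
    show ?thesis by (rule level_up[of i]) (use x ijk assms(1) False lev in force)+
  qed
  then show False using p x by simp
qed

lemma dir_nonempty: "D \<noteq> {} \<Longrightarrow> i < 4 \<Longrightarrow> Dd i \<noteq> {}"
  using one_level[of i] by force

lemma sum_Dd: "(\<Sum>i<4. card (Dd i)) = 2 * card D"
proof -
  have "(\<Sum>i<4. card (Dd i)) = (\<Sum>i<4. \<Sum>p\<in>D. if fst (snd p) = i \<or> snd (snd p) = i then 1 else 0)"
    using finD by (simp add: Dd_def sum.If_cases Int_def)
  also have "\<dots> = (\<Sum>p\<in>D. \<Sum>i<4. if fst (snd p) = i \<or> snd (snd p) = i then 1 else 0)"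
    by (rule sum.swap)
  also have "\<dots> = (\<Sum>p\<in>D. 2)"
  proof (rule sum.cong)
    fix p assume "p \<in> D"
    then obtain x a b where p: "p = (x, a, b)" "a < b" "b < 4" by (auto simp: lat.dd_def PL_def)
    then have "{..<4} \<inter> {i. a = i \<or> b = i} = {a, b}" by auto
    then show "(\<Sum>i<4. if fst (snd p) = i \<or> snd (snd p) = i then 1 else 0) = (2::nat)"
      using p by (simp add: sum.If_cases)
  qed simp
  finally show ?thesis by simp
qed

text \<open>Three plaquettes have 6 < 4 * 2 incidences with the four directions, so some direction
  would occur only once. Then \<open>D\<close> is a single plaquette, by \<open>one_level\<close>,
  and misses two directions, against \<open>dir_nonempty\<close>.\<close>

lemma card_D_ge:
  assumes "D \<noteq> {}" shows "4 \<le> card D"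
proof (rule ccontr)
  assume "\<not> 4 \<le> card D"
  then have "(\<Sum>i<4. card (Dd i)) < (\<Sum>i<(4::nat). 2)" using sum_Dd by simp
  then obtain i where i: "i < 4" "card (Dd i) < 2" by (meson lessThan_iff not_le sum_mono)
  then have "card (Dd i) = 1" using dir_nonempty[OF assms i(1)] finDd
    by (metis One_nat_def card_0_eq less_2_cases)
  then obtain p where p: "Dd i = {p}" by (rule card_1_singletonE)
  then have D: "D = {p}" using one_level[of i "fst p i"] i by auto
  obtain x a b where x: "p = (x, a, b)" using prod_cases3 by blast
  have "\<exists>l<4. l \<noteq> a \<and> l \<noteq> b"
  proof -
    have "card {a, b} \<le> 2" by (simp add: card_insert_if)
    then have "\<not> {..<4} \<subseteq> {a, b}" using card_mono[of "{a,b}" "{..<4}"] by auto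
    then show ?thesis by auto
  qed
  then obtain l where l: "l < 4" "l \<noteq> a" "l \<noteq> b" by blast
  have "Dd l = {}" using l x D unfolding Dd_def by auto
  then show False using dir_nonempty[OF assms l(1)] by blast
qed

end

lemma cb_toggle:
  assumes "finite A"
  shows "cb (if f \<in> A then A - {f} else insert f A) = (cb A - cob f) \<union> (cob f - cb A)"
proof -
  let ?A = "if f \<in> A then A - {f} else insert f A"
  have "odd (card (bdp p \<inter> ?A)) \<longleftrightarrow> odd (card (bdp p \<inter> A)) \<noteq> (f \<in> bdp p)" for p
  proof (cases "f \<in> bdp p")
    case True
    show ?thesis
    proof (cases "f \<in> A")
      case fA: True
      then have "bdp p \<inter> A = insert f (bdp p \<inter> ?A)" "f \<notin> bdp p \<inter> ?A" using True by auto
      then show ?thesis using assms True fA by simp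
    qed (use True assms in simp)
  next
    case False
    then have "bdp p \<inter> ?A = bdp p \<inter> A" by auto
    then show ?thesis using False by simp
  qed
  then show ?thesis by (auto simp: lat.dd_def cob_def)
qed

text \<open>At least five of the six plaquettes of \<open>cob f\<close> lie in \<open>cb A\<close>.
  Toggling \<open>f\<close> therefore leaves at most two plaquettes, fewer than a nonempty
  coboundary has.\<close>

lemma cb_eq_cob:
  assumes "finite A" "f \<in> UE" "cob f \<subseteq> insert z (cb A)" "card (cb A) \<le> 6"
  shows "cb A = cob f"
proof -
  let ?A = "if f \<in> A then A - {f} else insert f A"
  have fin: "finite (cb A)" by (rule finD[OF assms(1)])
  have 1: "card (cob f - cb A) \<le> 1"
  proof -
    have "cob f - cb A \<subseteq> {z}" using assms(3) by auto
    then show ?thesis using card_mono[of "{z}"] by fastforce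
  qed
  have "card (cob f) = card (cob f - cb A) + card (cob f \<inter> cb A)"
    using finite_cob[of f] by (metis add.commute card_Int_Diff)
  moreover have "card (cb A) = card (cb A - cob f) + card (cob f \<inter> cb A)"
    using fin by (metis add.commute card_Int_Diff inf_commute)
  ultimately have "card (cb A - cob f) + card (cob f - cb A) < 4"
    using 1 card_cob[OF assms(2)] assms(4) by linarith
  then have "card (cb ?A) < 4"
    unfolding cb_toggle[OF assms(1)] using card_Un_le le_less_trans by blast
  moreover have "finite ?A" using assms(1) by simp
  ultimately have "cb ?A = {}" using card_D_ge[of ?A] by fastforce
  then show ?thesis unfolding cb_toggle[OF assms(1)] by blast
qed

text \<open>Some direction \<open>i\<close> occurs in at most three of the plaquettes, so those of them at the highest or at the
  lowest level reduce to a single one; the cubes containing it force a further four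
  plaquettes of the coboundary of an edge.\<close>
lemma small_cb:
  assumes finA: "finite A" and ne: "cb A \<noteq> {}" and le: "card (cb A) \<le> 6"
  shows "\<exists>f\<in>UE. cb A = cob f"
proof -
  note [simp] = finA
  have "\<exists>i<4. card (Dd A i) \<le> 3"
  proof (rule ccontr)
    assume "\<not> ?thesis"
    then have "(\<Sum>i<(4::nat). 4) \<le> (\<Sum>i<4. card (Dd A i))" by (intro sum_mono) force
    then show False using sum_Dd[OF finA] le by simp
  qed
  then obtain i where i: "i < 4" "card (Dd A i) \<le> 3" by blast
  have fin: "finite (Dd A i)" by (rule finDd[OF finA])
  have nonempty: "Dd A i \<noteq> {}" by (rule dir_nonempty[OF finA ne i(1)])
  let ?L = "(\<lambda>p. fst p i) ` Dd A i"
  define a where "a = Max ?L"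
  define b where "b = Min ?L"
  have ab: "a \<in> ?L" "b \<in> ?L" unfolding a_def b_def using fin nonempty by (auto intro: Max_in Min_in)
  have bnd: "b \<le> fst p i" "fst p i \<le> a" if "p \<in> Dd A i" for p
    unfolding a_def b_def using fin that by auto
  \<comment> \<open>On a single level all of \<open>cb A\<close> would have direction i, hence at
    most three members, against the minimum of four.\<close>
  have "a \<noteq> b"
  proof
    assume "a = b"
    then have "cb A = Dd A i" using one_level[OF finA i(1), of a] bnd by force
    then show False using card_D_ge[OF finA ne] i by simp
  qed
  define T where "T c = {p \<in> Dd A i. fst p i = c}" for c
  have finT: "finite (T c)" for c using fin by (simp add: T_def)
  have "T a \<inter> T b = {}" using \<open>a \<noteq> b\<close> by (auto simp: T_def)
  then have "card (T a) + card (T b) \<le> 3"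
    using card_mono[OF fin, of "T a \<union> T b"] finT i(2) by (auto simp: card_Un_disjoint T_def)
  moreover have "T a \<noteq> {}" "T b \<noteq> {}" using ab unfolding T_def by blast+
  then have "card (T a) \<noteq> 0" "card (T b) \<noteq> 0" using finT by simp_all
  ultimately have "card (T a) = 1 \<or> card (T b) = 1" by linarith
  then obtain c p where c: "c = a \<or> c = b" "T c = {p}" by (metis card_1_singletonE)
  then have pT: "p \<in> Dd A i" "fst p i = c" by (auto simp: T_def)
  obtain x j where x: "p = pt x i j" "x \<in> lattice" "i \<noteq> j" "j < 4" using Dd_cases[OF finA pT(1)] by blast
  have xc: "x i = c" using pT x by (simp add: pt_def)
  have pD: "pt x i j \<in> cb A" using pT x by (simp add: Dd_def[OF finA])
  have only: "z = x \<and> m = j" if "pt z i m \<in> cb A" "z i = c" for z m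
  proof -
    have "pt z i m \<in> T c" using Dd_pt[OF finA that(1)] that(2) by (simp add: T_def pt_def)
    then show ?thesis using c(2) x(1) by (simp add: pt_eq)
  qed
  have lev: "b \<le> z i" "z i \<le> a" if "pt z i m \<in> cb A" for z m
    using bnd[OF Dd_pt[OF finA that]] by (simp_all add: pt_def)
  \<comment> \<open>A plaquette in direction i at level c extends from c to c + 1. Hence the
    asymmetry: plaquettes without direction i are excluded from level \<open>a + 1\<close> upwards,
    but already from \<open>b\<close> downwards.\<close>
  have above: "pt z m n \<notin> cb A" if "a < z i" "m < 4" "n < 4" "i \<noteq> m" "i \<noteq> n" "m \<noteq> n" "z \<in> lattice" for z m n
    by (rule level_up[OF finA, of i]) (use that i lev in force)+
  have below: "pt z m n \<notin> cb A" if "z i \<le> b" "m < 4" "n < 4" "i \<noteq> m" "i \<noteq> n" "m \<noteq> n" "z \<in> lattice" for z m n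
    by (rule level_dn[OF finA, of i]) (use that i lev in force)+
  \<comment> \<open>In each of the two cubes spanned by i, j, k at this plaquette it is the only
    frustrated face in direction i, so exactly one of the two faces without direction i is
    frustrated.\<close>
  have side: "(pt x j k \<in> cb A) \<noteq> (pt (up x i) j k \<in> cb A)"
    "(pt (dn x k) j k \<in> cb A) \<noteq> (pt (up (dn x k) i) j k \<in> cb A)" if k: "k < 4" "k \<noteq> i" "k \<noteq> j" for k
  proof -
    have "pt (up x k) i j \<notin> cb A" "pt x i k \<notin> cb A" "pt (up x j) i k \<notin> cb A"
      using only[of "up x k" j] only[of x k] only[of "up x j" k] k x(3) xc by (auto simp: up_app)
    then show "(pt x j k \<in> cb A) \<noteq> (pt (up x i) j k \<in> cb A)"
      using cube_closed[of x i j k A] pD x i k by auto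
    have "pt (dn x k) i j \<notin> cb A" "pt (dn x k) i k \<notin> cb A" "pt (up (dn x k) j) i k \<notin> cb A"
      using only[of "dn x k" j] only[of "dn x k" k] only[of "up (dn x k) j" k] k x(3) xc
      by (auto simp: up_app dn_app)
    then show "(pt (dn x k) j k \<in> cb A) \<noteq> (pt (up (dn x k) i) j k \<in> cb A)"
      using cube_closed[of "dn x k" i j k A] pD x i k by auto
  qed
  show ?thesis
  proof (cases "c = a")
    case True
    \<comment> \<open>At the top level the faces above are excluded, so the four at \<open>x\<close>
      are in \<open>cb A\<close>. With \<open>pt x i j\<close> they make five of the six plaquettes
      at the edge (x, j); the sixth is the exception. At the bottom level the opposite edge (up x i,
      j) plays this role.\<close>
    have "q \<in> insert (pt (dn x i) j i) (cb A)" if "q \<in> cob (x, j)" for q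
    proof (rule mem_cob_cases[OF that])
      fix k assume k: "k \<noteq> j" "k < 4" "q = pt x j k \<or> q = pt (dn x k) j k"
      show ?thesis
      proof (cases "k = i")
        case True then show ?thesis using k pD by (auto simp: pt_commute)
      next
        case False
        have "pt (up x i) j k \<notin> cb A" "pt (up (dn x k) i) j k \<notin> cb A"
          by (rule above; use xc \<open>c = a\<close> k x i False in \<open>simp add: up_app dn_app\<close>)+
        then show ?thesis using side[of k] k False by auto
      qed
    qed
    then have "cob (x, j) \<subseteq> insert (pt (dn x i) j i) (cb A)" by blast
    moreover have "(x, j) \<in> UE" using x by (simp add: UE_def)
    ultimately show ?thesis using cb_eq_cob[OF finA _ _ le] by blast
  next
    case False
    then have cb': "c = b" using c by simp
    have "q \<in> insert (pt (up x i) j i) (cb A)" if "q \<in> cob (up x i, j)" for q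
    proof (rule mem_cob_cases[OF that])
      fix k assume k: "k \<noteq> j" "k < 4" "q = pt (up x i) j k \<or> q = pt (dn (up x i) k) j k"
      show ?thesis
      proof (cases "k = i")
        case True then show ?thesis using k pD by (auto simp: pt_commute)
      next
        case False
        have "pt x j k \<notin> cb A" "pt (dn x k) j k \<notin> cb A"
          by (rule below; use xc cb' k x i False in \<open>simp add: up_app dn_app\<close>)+
        then show ?thesis using side[of k] k False by (auto simp: dn_up)
      qed
    qed
    then have "cob (up x i, j) \<subseteq> insert (pt (up x i) j i) (cb A)" by blast
    moreover have "(up x i, j) \<in> UE" using x i by (simp add: UE_def)
    ultimately show ?thesis using cb_eq_cob[OF finA _ _ le] by blast
  qed
qed

lemma card_cb_ge6: "finite A \<Longrightarrow> cb A \<noteq> {} \<Longrightarrow> 6 \<le> card (cb A)"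
  using small_cb[of A] card_cob by (cases "card (cb A) \<le> 6") auto

subsection \<open>Flat sets of edges are exact\<close>

text \<open>The potential is the parity of the number of edges on the ray in direction 0 from \<open>x\<close>.\<close>

primrec line_par :: "uedge set \<Rightarrow> nat \<Rightarrow> vtx \<Rightarrow> bool" where
  "line_par A 0 x = False"
| "line_par A (Suc n) x = (((x, 0) \<in> A) \<noteq> line_par A n (up x 0))"

lemma flat_potential:
  assumes finA: "finite A" and flat: "cb A = {}"
  shows "\<exists>\<phi>. \<forall>x\<in>lattice. \<forall>j<4. (x, j) \<in> A \<longleftrightarrow> \<phi> x \<noteq> (\<phi> (up x j) :: bool)"
proof -
  \<comment> \<open>\<open>T\<close> lies beyond every edge of \<open>A\<close> in direction 0;
    inserting 0 makes \<open>Max\<close> meaningful for empty \<open>A\<close>.\<close>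
  define T where "T = Max (insert 0 ((\<lambda>e. fst e 0 + 1) ` A))"
  have T: "(z, j) \<notin> A" if "z 0 \<ge> T" for z j
  proof
    assume "(z, j) \<in> A"
    then have "fst (z, j) 0 + 1 \<in> (\<lambda>e. fst e 0 + 1) ` A" by (rule imageI)
    then have "z 0 + 1 \<le> T" unfolding T_def using finA by (intro Max_ge) auto
    then show False using that by simp
  qed
  define \<phi> where "\<phi> x = line_par A (nat (T - x 0)) x" for x
  \<comment> \<open>The plaquettes between the rays from \<open>x\<close> and \<open>up x j\<close>
    form a ladder. As they are flat, the two ray parities differ by the first and the last rung, and
    the last one will lie beyond \<open>T\<close>.\<close>
  have tr: "line_par A n x \<noteq> line_par A n (up x j) \<longleftrightarrow> ((x, j) \<in> A) \<noteq> ((((\<lambda>y. up y 0) ^^ n) x, j) \<in> A)"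
    if "x \<in> lattice" "0 < j" "j < 4" for n x j
    using that(1)
  proof (induction n arbitrary: x)
    case (Suc n)
    have "pt x 0 j \<notin> cb A" using flat by simp
    then have "\<not> nu A x 0 j" using pt_cb[of 0 j x A] Suc.prems that by simp
    moreover have "((\<lambda>y. up y 0) ^^ n) (up x 0) = ((\<lambda>y. up y 0) ^^ Suc n) x"
      using funpow_swap1[of "\<lambda>y. up y 0" n x] by simp
    moreover have "up (up x j) 0 = up (up x 0) j" by (rule up_up)
    ultimately show ?case using Suc.IH[of "up x 0"] Suc.prems by (simp add: nu_def) argo
  qed simp
  have lev: "((\<lambda>y. up y 0) ^^ n) x 0 = x 0 + int n" for n x
    by (induction n) (simp_all add: up_app)
  have "(x, j) \<in> A \<longleftrightarrow> \<phi> x \<noteq> \<phi> (up x j)" if x: "x \<in> lattice" "j < 4" for x j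
  proof (cases "j = 0")
    case True
    show ?thesis
    proof (cases "x 0 \<ge> T")
      case xT: True
      then show ?thesis using T[of x 0] True by (simp add: \<phi>_def up_app)
    next
      case False
      then have "nat (T - x 0) = Suc (nat (T - up x 0 0))" by (simp add: up_app)
      then show ?thesis using True by (simp add: \<phi>_def) argo
    qed
  next
    case False
    have "(((\<lambda>y. up y 0) ^^ nat (T - x 0)) x, j) \<notin> A" by (rule T) (simp add: lev)
    then show ?thesis using tr[OF x(1) _ x(2), of "nat (T - x 0)"] False
      by (simp add: \<phi>_def up_app)
  qed
  then show ?thesis by blast
qed

lemma up_vplus: "vplus x (unitv j) = up x j"
  by (simp add: up_def)

lemma up_up_neq: "up (up x j) i \<noteq> x" "x \<noteq> up (up x j) i"
proof -
  have "up (up x j) i j > x j" by (simp add: up_app)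
  then show "up (up x j) i \<noteq> x" "x \<noteq> up (up x j) i" by (metis less_irrefl)+
qed

definition und :: "edge \<Rightarrow> uedge" where
  "und e = (if \<exists>j. snd e = up (fst e) j then (fst e, THE j. snd e = up (fst e) j)
            else (snd e, THE j. fst e = up (snd e) j))"

lemma und_pos [simp]: "und (x, up x j) = (x, j)"
  by (auto simp: und_def)

lemma und_neg [simp]: "und (up x j, x) = (x, j)"
  by (auto simp: und_def up_up_neq)

lemma nn_cases:
  assumes "nn_edge e"
  obtains x j where "x \<in> lattice" "j < 4" "e = (x, up x j) \<or> e = (up x j, x)"
proof -
  obtain j where j: "fst e \<in> lattice" "j < 4" "snd e = up (fst e) j \<or> fst e = up (snd e) j"
    using assms by (auto simp: nn_edge_def up_vplus)
  from j(3) show thesis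
  proof
    assume "snd e = up (fst e) j"
    then show thesis using that[of "fst e" j] j by (simp add: prod_eq_iff)
  next
    assume h: "fst e = up (snd e) j"
    then have "snd e \<in> lattice" using j(1,2) up_lattice by simp
    then show thesis using that[of "snd e" j] j h by (simp add: prod_eq_iff)
  qed
qed

lemma nn_edge_pos: "x \<in> lattice \<Longrightarrow> j < 4 \<Longrightarrow> nn_edge (x, up x j) \<and> nn_edge (up x j, x)"
  by (auto simp: nn_edge_def up_vplus)

lemma und_UE: "nn_edge e \<Longrightarrow> und e \<in> UE"
  by (erule nn_cases) (auto simp: UE_def)

lemma und_rev: "nn_edge e \<Longrightarrow> und (rev_edge e) = und e"
  by (erule nn_cases) (auto simp: rev_edge_def)

lemma und_eqD: "nn_edge e \<Longrightarrow> nn_edge e' \<Longrightarrow> und e = und e' \<Longrightarrow> e' = e \<or> e' = rev_edge e"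
  by (elim nn_cases) (auto simp: rev_edge_def)

lemma potential_und:
  assumes "\<And>x j. x \<in> lattice \<Longrightarrow> j < 4 \<Longrightarrow> (x, j) \<in> A \<longleftrightarrow> \<phi> x \<noteq> (\<phi> (up x j) :: bool)" "nn_edge e"
  shows "und e \<in> A \<longleftrightarrow> \<phi> (fst e) \<noteq> \<phi> (snd e)"
  using assms(2) by (rule nn_cases) (auto simp: assms(1))

subsection \<open>Loops\<close>

lemma simple_loopD: "simple_loop \<gamma> \<Longrightarrow> finite \<gamma> \<and> (\<forall>e\<in>\<gamma>. nn_edge e)"
  unfolding simple_loop_def by (rule conjI, erule conjunct1, rule conjunct1[OF conjunct2])

lemma simple_loop_nonempty: "simple_loop \<gamma> \<Longrightarrow> \<gamma> \<noteq> {}"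
  unfolding simple_loop_def by force

lemma simple_loop_inj: "simple_loop \<gamma> \<Longrightarrow> inj_on und \<gamma>"
  unfolding simple_loop_def inj_on_def using und_eqD by metis

lemma path_parity:
  assumes "l \<noteq> []" "\<forall>i. Suc i < length l \<longrightarrow> snd (l ! i) = fst (l ! Suc i)"
  shows "odd (length (filter (\<lambda>e. \<phi> (fst e) \<noteq> \<phi> (snd e)) l)) \<longleftrightarrow> \<phi> (fst (hd l)) \<noteq> (\<phi> (snd (last l)) :: bool)"
  using assms
proof (induction l)
  case (Cons e l)
  show ?case
  proof (cases "l = []")
    case False
    have "\<forall>i. Suc i < length l \<longrightarrow> snd (l ! i) = fst (l ! Suc i)"
      using Cons.prems(2) by (metis Suc_less_eq length_Cons nth_Cons_Suc)
    moreover have "snd e = fst (hd l)"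
      using Cons.prems(2)[rule_format, of 0] False by (simp add: hd_conv_nth)
    ultimately show ?thesis using Cons.IH False by simp
  qed simp
qed simp

text \<open>Around a closed path a potential changes an even number of times, and a simple loop uses
  each unoriented edge at most once. The assumption is a potential rather than flatness so that the
  gradient of a Higgs field is covered too.\<close>

lemma loop_parity:
  assumes "simple_loop \<gamma>"
    "\<And>x j. x \<in> lattice \<Longrightarrow> j < 4 \<Longrightarrow> (x, j) \<in> A \<longleftrightarrow> \<phi> x \<noteq> (\<phi> (up x j) :: bool)"
  shows "even (card (A \<inter> und ` \<gamma>))"
proof -
  obtain l where l: "l \<noteq> []" "distinct l" "set l = \<gamma>" "\<forall>i. Suc i < length l \<longrightarrow> snd (l ! i) = fst (l ! Suc i)"
    "snd (last l) = fst (hd l)" and nn: "\<forall>e\<in>\<gamma>. nn_edge e"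
    using assms(1) unfolding simple_loop_def by blast
  have "A \<inter> und ` \<gamma> = und ` {e\<in>\<gamma>. und e \<in> A}" by auto
  then have "card (A \<inter> und ` \<gamma>) = card {e\<in>\<gamma>. und e \<in> A}"
    using card_image[OF inj_on_subset[OF simple_loop_inj[OF assms(1)]], of "{e\<in>\<gamma>. und e \<in> A}"] by simp
  also have "{e\<in>\<gamma>. und e \<in> A} = set (filter (\<lambda>e. \<phi> (fst e) \<noteq> \<phi> (snd e)) l)"
    using nn l(3) potential_und[where A = A and \<phi> = \<phi>, OF assms(2)] by auto
  also have "card \<dots> = length (filter (\<lambda>e. \<phi> (fst e) \<noteq> \<phi> (snd e)) l)"
    using l(2) by (intro distinct_card distinct_filter)
  finally show ?thesis using path_parity[OF l(1,4), of \<phi>] l(5) by simp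
qed

lemma flat_loop_parity:
  assumes "simple_loop \<gamma>" "finite A" "cb A = {}"
  shows "even (card (A \<inter> und ` \<gamma>))"
proof -
  obtain \<phi> where "\<forall>x\<in>lattice. \<forall>j<4. (x, j) \<in> A \<longleftrightarrow> \<phi> x \<noteq> (\<phi> (up x j) :: bool)"
    using flat_potential[OF assms(2,3)] by blast
  then show ?thesis using loop_parity[OF assms(1), of A \<phi>] by blast
qed

subsection \<open>Unoriented plaquettes\<close>

definition posp :: "uplaq \<Rightarrow> edge set" where
  "posp p = pos_plaq (fst p) (fst (snd p)) (snd (snd p))"

lemma posp_eq: "posp (x, i, j) = {(x, up x i), (up x i, up (up x i) j), (up (up x j) i, up x j), (up x j, x)}"
  by (simp add: posp_def pos_plaq_def up_vplus)

lemma und_posp: "und ` posp p = bdp p"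
proof -
  obtain x i j where p: "p = (x, i, j)" using prod_cases3 by blast
  show ?thesis by (auto simp: p posp_eq bdp_def bd4_def)
qed

lemma nn_posp: "p \<in> PL \<Longrightarrow> e \<in> posp p \<Longrightarrow> nn_edge e"
proof -
  assume "p \<in> PL" "e \<in> posp p"
  moreover obtain x i j where p: "p = (x, i, j)" using prod_cases3 by blast
  ultimately show ?thesis
    using nn_edge_pos[of x i] nn_edge_pos[of "up x i" j] nn_edge_pos[of "up x j" i] nn_edge_pos[of x j]
    by (auto simp: PL_def posp_eq)
qed

lemma und_rev_posp: "p \<in> PL \<Longrightarrow> und ` (rev_edge ` posp p) = bdp p"
  using nn_posp und_rev und_posp unfolding image_image by (metis (no_types, lifting) image_cong)

lemma card_posp: "card (posp p) \<le> 4"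
proof -
  obtain x i j where p: "p = (x, i, j)" using prod_cases3 by blast
  show ?thesis by (simp add: p posp_eq card_insert_if)
qed

lemma finite_posp: "finite (posp p)"
  by (simp add: posp_def pos_plaq_def)

lemma inj_und_posp: "p \<in> PL \<Longrightarrow> inj_on und (posp p)"
  using card_posp[of p] card_bdp[of p] und_posp[of p] card_image_le[OF finite_posp, of und p]
  by (intro eq_card_imp_inj_on finite_posp) simp

lemma rev_rev [simp]: "rev_edge (rev_edge e) = e"
  by (simp add: rev_edge_def)

lemma inj_rev: "inj rev_edge"
  by (metis injI rev_rev)

lemma inj_und_rev_posp: "p \<in> PL \<Longrightarrow> inj_on und (rev_edge ` posp p)"
proof -
  assume p: "p \<in> PL"
  have "card (rev_edge ` posp p) = card (posp p)" using inj_rev by (simp add: card_image inj_on_subset)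
  then show ?thesis
    using card_posp[of p] card_bdp[OF p] und_rev_posp[OF p]
      card_image_le[of "rev_edge ` posp p" und] finite_posp[of p]
    by (intro eq_card_imp_inj_on) simp_all
qed

lemma bdp_inj: "p \<in> PL \<Longrightarrow> p' \<in> PL \<Longrightarrow> bdp p = bdp p' \<Longrightarrow> p = p'"
proof -
  assume p: "p \<in> PL" "p' \<in> PL" "bdp p = bdp p'"
  have "\<not> card (bdp p) \<le> Suc 0" using card_bdp[OF p(1)] by simp
  then obtain e f where "e \<in> bdp p" "f \<in> bdp p" "e \<noteq> f"
    using lat.finite_bd[OF p(1)] by (metis card_le_Suc0_iff_eq)
  then show ?thesis using share_unique[of e f p p'] p by (simp add: cob_def)
qed

lemma posp_not_rev: "p \<in> PL \<Longrightarrow> posp p \<noteq> rev_edge ` posp p'" if "p' \<in> PL"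
proof
  assume p: "p \<in> PL" and eq: "posp p = rev_edge ` posp p'"
  then have "bdp p = bdp p'" using und_posp[of p] und_rev_posp[OF that] by simp
  then have "p = p'" using bdp_inj p that by blast
  obtain x i j where x: "p = (x, i, j)" "i < j" using p by (auto simp: PL_def)
  have "(x, up x i) \<in> posp p" using x by (simp add: posp_eq)
  then have "(up x i, x) \<in> posp p" using eq \<open>p = p'\<close> by (force simp: rev_edge_def)
  then show False using x(2) by (auto simp: x posp_eq up_up_neq)
qed

lemma plaquettes_eq: "plaquettes = posp ` PL \<union> (\<lambda>p. rev_edge ` posp p) ` PL"
proof (intro equalityI subsetI)
  fix p assume "p \<in> plaquettes"
  then obtain x i j where x: "x \<in> lattice" "i < j" "j < 4" "p = pos_plaq x i j \<or> p = rev_edge ` pos_plaq x i j"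
    unfolding plaquettes_def by blast
  then have "(x, i, j) \<in> PL" "p = posp (x, i, j) \<or> p = rev_edge ` posp (x, i, j)"
    by (simp_all add: PL_def posp_def)
  then show "p \<in> posp ` PL \<union> (\<lambda>p. rev_edge ` posp p) ` PL" by blast
next
  fix p assume "p \<in> posp ` PL \<union> (\<lambda>p. rev_edge ` posp p) ` PL"
  then obtain t where t: "t \<in> PL" "p = posp t \<or> p = rev_edge ` posp t" by blast
  obtain x i j where "t = (x, i, j)" using prod_cases3 by blast
  then have "x \<in> lattice" "i < j" "j < 4" "p = pos_plaq x i j \<or> p = rev_edge ` pos_plaq x i j"
    using t by (simp_all add: PL_def posp_def)
  then show "p \<in> plaquettes" unfolding plaquettes_def by blast
qed

section \<open>Edges and plaquettes of a box\<close>

definition EN :: "nat \<Rightarrow> uedge set" where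
  "EN N = {(x, j). j < 4 \<and> x \<in> box N \<and> up x j \<in> box N}"

definition PN :: "nat \<Rightarrow> uplaq set" where
  "PN N = {p\<in>PL. bdp p \<subseteq> EN N}"

lemma box_lattice: "x \<in> box N \<Longrightarrow> x \<in> lattice"
  by (simp add: box_def)

lemma EN_UE: "EN N \<subseteq> UE"
  by (auto simp: EN_def UE_def box_lattice)

lemma PN_PL: "PN N \<subseteq> PL"
  by (auto simp: PN_def)

lemma finite_box: "finite (box N)"
proof (rule finite_subset)
  show "box N \<subseteq> {x. \<forall>i. (i \<in> {..<4} \<longrightarrow> x i \<in> {- int N..int N}) \<and> (i \<notin> {..<4} \<longrightarrow> x i = 0)}"
    by (simp add: box_def lattice_def abs_le_iff subset_iff not_less minus_le_iff)
qed (rule finite_set_of_finite_funs; simp)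

lemma finite_EN: "finite (EN N)"
  by (rule finite_subset[of _ "box N \<times> {..<4}"]) (auto simp: EN_def finite_box)

lemma edges_box_cases:
  assumes "e \<in> edges_box N"
  obtains x j where "(x, j) \<in> EN N" "x \<in> lattice" "j < 4" "e = (x, up x j) \<or> e = (up x j, x)"
proof -
  have "nn_edge e" using assms by (simp add: edges_box_def)
  then obtain x j where "x \<in> lattice" "j < 4" "e = (x, up x j) \<or> e = (up x j, x)"
    by (rule nn_cases)
  then show thesis using assms by (intro that[of x j]) (auto simp: edges_box_def EN_def)
qed

lemma edges_box_eq: "edges_box N = (\<lambda>(x, j). (x, up x j)) ` EN N \<union> (\<lambda>(x, j). (up x j, x)) ` EN N"
proof (intro equalityI subsetI)
  fix e assume "e \<in> edges_box N"
  then show "e \<in> (\<lambda>(x, j). (x, up x j)) ` EN N \<union> (\<lambda>(x, j). (up x j, x)) ` EN N"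
    by (rule edges_box_cases) force
next
  fix e assume "e \<in> (\<lambda>(x, j). (x, up x j)) ` EN N \<union> (\<lambda>(x, j). (up x j, x)) ` EN N"
  then show "e \<in> edges_box N"
    using nn_edge_pos box_lattice by (auto simp: edges_box_def EN_def)
qed

lemma edges_box_iff: "nn_edge e \<Longrightarrow> e \<in> edges_box N \<longleftrightarrow> und e \<in> EN N"
  by (erule nn_cases) (auto simp: edges_box_def EN_def nn_edge_pos)

lemma nn_edges_box: "e \<in> edges_box N \<Longrightarrow> nn_edge e"
  by (simp add: edges_box_def)

lemma sum_edges_box:
  fixes F :: "uedge \<Rightarrow> real"
  shows "(\<Sum>e\<in>edges_box N. F (und e)) = 2 * (\<Sum>f\<in>EN N. F f)"
proof -
  let ?p = "\<lambda>(x, j). (x, up x j)" and ?m = "\<lambda>(x, j). (up x j, x)"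
  have inv: "und (?p f) = f" "und (?m f) = f" for f by (simp_all add: split_beta)
  have inj: "inj_on ?p (EN N)" "inj_on ?m (EN N)" by (rule inj_on_inverseI[where g = und], rule inv)+
  have disj: "?p ` EN N \<inter> ?m ` EN N = {}"
    by (auto simp: up_up_neq)
  have "(\<Sum>e\<in>edges_box N. F (und e)) = (\<Sum>e\<in>?p ` EN N. F (und e)) + (\<Sum>e\<in>?m ` EN N. F (und e))"
    unfolding edges_box_eq by (rule sum.union_disjoint) (use finite_EN disj in auto)
  also have "\<dots> = (\<Sum>f\<in>EN N. F f) + (\<Sum>f\<in>EN N. F f)"
    unfolding sum.reindex[OF inj(1)] sum.reindex[OF inj(2)] o_def inv ..
  finally show ?thesis by simp
qed

lemma plaqs_box_eq: "plaqs_box N = posp ` PN N \<union> (\<lambda>p. rev_edge ` posp p) ` PN N"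
proof -
  have 1: "(\<forall>e\<in>posp p. fst e \<in> box N \<and> snd e \<in> box N) \<longleftrightarrow> bdp p \<subseteq> EN N" if "p \<in> PL" for p
  proof -
    have "fst e \<in> box N \<and> snd e \<in> box N \<longleftrightarrow> und e \<in> EN N" if "e \<in> posp p" for e
      using edges_box_iff[OF nn_posp[OF \<open>p \<in> PL\<close> that], of N] nn_posp[OF \<open>p \<in> PL\<close> that]
      by (simp add: edges_box_def)
    then have "(\<forall>e\<in>posp p. fst e \<in> box N \<and> snd e \<in> box N) \<longleftrightarrow> und ` posp p \<subseteq> EN N"
      unfolding image_subset_iff by blast
    then show ?thesis unfolding und_posp .
  qed
  have 2: "(\<forall>e\<in>rev_edge ` posp p. fst e \<in> box N \<and> snd e \<in> box N) \<longleftrightarrow> (\<forall>e\<in>posp p. fst e \<in> box N \<and> snd e \<in> box N)" for p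
    by (auto simp: rev_edge_def)
  have 3: "posp p \<in> plaqs_box N \<longleftrightarrow> p \<in> PN N" "rev_edge ` posp p \<in> plaqs_box N \<longleftrightarrow> p \<in> PN N" if "p \<in> PL" for p
  proof -
    have "posp p \<in> plaquettes" "rev_edge ` posp p \<in> plaquettes"
      unfolding plaquettes_eq using that by (rule UnI1[OF imageI], rule UnI2[OF imageI])
    then show "posp p \<in> plaqs_box N \<longleftrightarrow> p \<in> PN N" "rev_edge ` posp p \<in> plaqs_box N \<longleftrightarrow> p \<in> PN N"
      unfolding plaqs_box_def PN_def mem_Collect_eq 2 1[OF that] using that by simp_all
  qed
  have sub: "plaqs_box N \<subseteq> posp ` PL \<union> (\<lambda>p. rev_edge ` posp p) ` PL"
    unfolding plaqs_box_def plaquettes_eq by (rule Collect_restrict)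
  show ?thesis
  proof (intro equalityI subsetI)
    fix p assume p: "p \<in> plaqs_box N"
    then consider t where "t \<in> PL" "p = posp t" | t where "t \<in> PL" "p = rev_edge ` posp t" using sub by blast
    then show "p \<in> posp ` PN N \<union> (\<lambda>p. rev_edge ` posp p) ` PN N"
    proof cases
      case (1 t) then show ?thesis using 3(1)[of t] p by simp
    next
      case (2 t) then show ?thesis using 3(2)[of t] p by simp
    qed
  next
    fix p assume "p \<in> posp ` PN N \<union> (\<lambda>p. rev_edge ` posp p) ` PN N"
    then consider t where "t \<in> PN N" "p = posp t" | t where "t \<in> PN N" "p = rev_edge ` posp t" by blast
    then show "p \<in> plaqs_box N" using 3 PN_PL by cases blast+
  qed
qed

lemma finite_PN: "finite (PN N)"
proof (rule finite_subset)
  show "PN N \<subseteq> (\<Union>e\<in>EN N. cob e)"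
  proof
    fix p assume p: "p \<in> PN N"
    then have "bdp p \<noteq> {}" using card_bdp[of p] by (auto simp: PN_def)
    then show "p \<in> (\<Union>e\<in>EN N. cob e)" using p by (auto simp: PN_def cob_def)
  qed
  show "finite (\<Union>e\<in>EN N. cob e)" using finite_EN finite_cob by auto
qed

lemma sum_plaqs_box:
  fixes F :: "edge set \<Rightarrow> real"
  assumes "\<And>p. p \<in> PN N \<Longrightarrow> F (posp p) = H p \<and> F (rev_edge ` posp p) = H p"
  shows "(\<Sum>p\<in>plaqs_box N. F p) = 2 * (\<Sum>p\<in>PN N. H p)"
proof -
  have fin: "finite (PN N)" by (rule finite_PN)
  have inj: "inj_on posp (PN N)" "inj_on (\<lambda>p. rev_edge ` posp p) (PN N)"
  proof -
    have "p = p'" if "p \<in> PN N" "p' \<in> PN N" "posp p = posp p'" for p p'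
    proof -
      have "p \<in> PL" "p' \<in> PL" using that PN_PL by blast+
      then show ?thesis using bdp_inj[of p p'] und_posp[of p] und_posp[of p'] that(3) by simp
    qed
    then show "inj_on posp (PN N)" by (rule inj_onI)
    have "p = p'" if "p \<in> PN N" "p' \<in> PN N" "rev_edge ` posp p = rev_edge ` posp p'" for p p'
    proof -
      have "p \<in> PL" "p' \<in> PL" using that PN_PL by blast+
      then show ?thesis using bdp_inj[of p p'] und_rev_posp[of p] und_rev_posp[of p'] that(3) by simp
    qed
    then show "inj_on (\<lambda>p. rev_edge ` posp p) (PN N)" by (rule inj_onI)
  qed
  have "posp ` PN N \<inter> (\<lambda>p. rev_edge ` posp p) ` PN N = {}"
    using posp_not_rev PN_PL by blast
  then have "(\<Sum>p\<in>plaqs_box N. F p) = (\<Sum>p\<in>posp ` PN N. F p) + (\<Sum>p\<in>(\<lambda>p. rev_edge ` posp p) ` PN N. F p)"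
    unfolding plaqs_box_eq by (intro sum.union_disjoint) (use fin in auto)
  also have "\<dots> = (\<Sum>p\<in>PN N. H p) + (\<Sum>p\<in>PN N. H p)"
    unfolding sum.reindex[OF inj(1)] sum.reindex[OF inj(2)] o_def using assms by simp
  finally show ?thesis by simp
qed

subsection \<open>Spin configurations as sets of edges\<close>

definition sg :: "nat \<Rightarrow> uedge set \<Rightarrow> edge \<Rightarrow> int" where
  "sg N A e = (if e \<in> edges_box N \<and> und e \<in> A then 1 else 0)"

lemma rev_edges_box: "e \<in> edges_box N \<Longrightarrow> rev_edge e \<in> edges_box N"
  by (erule edges_box_cases) (auto simp: edges_box_def EN_def rev_edge_def nn_edge_pos)

lemma bij_sg: "bij_betw (sg N) (Pow (EN N)) (spin_configs N)"
proof (rule bij_betw_byWitness[where f' = "\<lambda>\<sigma>. {f \<in> EN N. \<sigma> (fst f, up (fst f) (snd f)) = 1}"])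
  have pe: "(x, up x j) \<in> edges_box N" if "(x, j) \<in> EN N" for x j
    using that unfolding edges_box_eq by force
  show "sg N ` Pow (EN N) \<subseteq> spin_configs N"
    using rev_edges_box und_rev[OF nn_edges_box] by (auto simp: spin_configs_def sg_def)
  show "(\<lambda>\<sigma>. {f \<in> EN N. \<sigma> (fst f, up (fst f) (snd f)) = 1}) ` spin_configs N \<subseteq> Pow (EN N)" by auto
  show "\<forall>A\<in>Pow (EN N). {f \<in> EN N. sg N A (fst f, up (fst f) (snd f)) = 1} = A"
    using pe by (auto simp: sg_def)
  have "sg N {f \<in> EN N. \<sigma> (fst f, up (fst f) (snd f)) = 1} = \<sigma>" if s: "\<sigma> \<in> spin_configs N" for \<sigma>
  proof
    fix e
    show "sg N {f \<in> EN N. \<sigma> (fst f, up (fst f) (snd f)) = 1} e = \<sigma> e"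
    proof (cases "e \<in> edges_box N")
      case True
      then obtain x j where x: "(x, j) \<in> EN N" "e = (x, up x j) \<or> e = (up x j, x)"
        by (rule edges_box_cases)
      have "\<sigma> (up x j, x) = \<sigma> (x, up x j)"
        using s pe[OF x(1)] by (auto simp: spin_configs_def rev_edge_def)
      moreover have "\<sigma> e \<in> {0, 1}" using s True by (auto simp: spin_configs_def)
      ultimately show ?thesis using x True by (auto simp: sg_def)
    next
      case False
      moreover have "\<sigma> e = 0" using s False unfolding spin_configs_def by blast
      ultimately show ?thesis by (simp add: sg_def)
    qed
  qed
  then show "\<forall>\<sigma>\<in>spin_configs N. sg N {f \<in> EN N. \<sigma> (fst f, up (fst f) (snd f)) = 1} = \<sigma>" by blast
qed

abbreviation sgn_in :: "bool \<Rightarrow> real" where "sgn_in b \<equiv> (if b then - 1 else 1)"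

lemma rho_sg: "e \<in> edges_box N \<Longrightarrow> rho (sg N A e) = sgn_in (und e \<in> A)"
  by (simp add: rho_def sg_def)

lemma sum_sg:
  assumes "S \<subseteq> edges_box N" "inj_on und S" "finite S"
  shows "(\<Sum>e\<in>S. sg N A e) = int (card (und ` S \<inter> A))"
proof -
  have "(\<Sum>e\<in>S. sg N A e) = (\<Sum>e\<in>S. if und e \<in> A then 1 else 0)"
    by (rule sum.cong) (use assms(1) in \<open>auto simp: sg_def\<close>)
  also have "\<dots> = (\<Sum>f\<in>und ` S. if f \<in> A then 1 else 0)"
    unfolding sum.reindex[OF assms(2)] by simp
  finally show ?thesis using assms(3) by (simp add: sum.If_cases Int_def)
qed

lemma dsig_sg:
  assumes "p \<in> PN N"
  shows "dsig (sg N A) (posp p) = int (card (bdp p \<inter> A))"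
    "dsig (sg N A) (rev_edge ` posp p) = int (card (bdp p \<inter> A))"
proof -
  have p: "p \<in> PL" "bdp p \<subseteq> EN N" using assms by (auto simp: PN_def)
  have "e \<in> edges_box N" if "e \<in> posp p" for e
    using edges_box_iff[OF nn_posp[OF p(1) that]] und_posp[of p] that p(2) by blast
  then have "posp p \<subseteq> edges_box N" "rev_edge ` posp p \<subseteq> edges_box N"
    using rev_edges_box by auto
  then show "dsig (sg N A) (posp p) = int (card (bdp p \<inter> A))"
    "dsig (sg N A) (rev_edge ` posp p) = int (card (bdp p \<inter> A))"
    unfolding dsig_def using sum_sg[of "posp p" N A] sum_sg[of "rev_edge ` posp p" N A]
      inj_und_posp[OF p(1)] inj_und_rev_posp[OF p(1)] finite_posp[of p] und_posp[of p] und_rev_posp[OF p(1)]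
    by auto
qed

lemma wilson_sg:
  assumes "simple_loop \<gamma>" "und ` \<gamma> \<subseteq> EN N"
  shows "wilson \<gamma> (sg N A) = (- 1) ^ card (A \<inter> und ` \<gamma>)"
    "{e \<in> \<gamma>. sg N A e = 1} = {e \<in> \<gamma>. und e \<in> A}"
proof -
  have nn: "\<forall>e\<in>\<gamma>. nn_edge e" and fin: "finite \<gamma>"
    using simple_loopD[OF assms(1)] by blast+
  have g: "\<gamma> \<subseteq> edges_box N" "finite \<gamma>"
    using nn assms(2) edges_box_iff fin by auto
  show "wilson \<gamma> (sg N A) = (- 1) ^ card (A \<inter> und ` \<gamma>)"
    unfolding wilson_def sum_sg[OF g(1) simple_loop_inj[OF assms(1)] g(2)]
    by (simp add: rho_def Int_commute)
  show "{e \<in> \<gamma>. sg N A e = 1} = {e \<in> \<gamma>. und e \<in> A}"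
    using g(1) by (auto simp: sg_def)
qed

section \<open>Expectations and unitary gauge\<close>

context plaq_complex
begin

definition Ex :: "real \<Rightarrow> real \<Rightarrow> 'p set \<Rightarrow> 'e set \<Rightarrow> ('e set \<Rightarrow> real) \<Rightarrow> real" where
  "Ex x y Q E f = (\<Sum>A\<in>Pow E. wt x y Q A * f A) / (\<Sum>A\<in>Pow E. wt x y Q A)"

lemma wt_zero: "finite (dd Q A) \<Longrightarrow> wt x 0 Q A = (if dd Q A = {} then x ^ card A else 0)"
  by (auto simp: wt_def power_0_left)

end

lemma (in pair_system) PE_fst_Ex: "PE (\<lambda>A B. f A) = Ex x y1 P1 E1 f"
  by (simp add: PE_fst Ex_def Z1_def)

lemma (in pair_system) PE_snd_Ex: "PE (\<lambda>A B. f B) = Ex x y2 P2 E2 f"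
  by (simp add: PE_snd Ex_def Z2_def)

lemma odd_card_symdiff:
  assumes "finite S"
  shows "odd (card (S \<inter> ((A - B) \<union> (B - A)))) \<longleftrightarrow> odd (card (S \<inter> A)) \<noteq> odd (card (S \<inter> B))"
proof -
  have "S \<inter> ((A - B) \<union> (B - A)) = (S \<inter> A - S \<inter> B) \<union> (S \<inter> B - S \<inter> A)" by auto
  moreover have "card (S \<inter> A) = card (S \<inter> A - S \<inter> B) + card (S \<inter> A \<inter> (S \<inter> B))"
    using assms by (metis add.commute card_Int_Diff finite_Int)
  moreover have "card (S \<inter> B) = card (S \<inter> B - S \<inter> A) + card (S \<inter> A \<inter> (S \<inter> B))"
    using assms by (metis add.commute card_Int_Diff finite_Int Int_commute)
  ultimately show ?thesis
    using assms by (simp add: card_Un_disjoint disjoint_iff) argo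
qed

lemma sum_sgn_in:
  assumes "finite S"
  shows "(\<Sum>s\<in>S. sgn_in (Q s)) = real (card S) - 2 * real (card {s\<in>S. Q s})"
proof -
  have "(\<Sum>s\<in>S. sgn_in (Q s)) = (\<Sum>s\<in>S. 1 - 2 * (if Q s then 1 else 0))"
    by (rule sum.cong) auto
  also have "\<dots> = real (card S) - 2 * (\<Sum>s\<in>S. if Q s then 1 else 0)"
    by (simp add: sum_subtractf sum_distrib_left)
  also have "(\<Sum>s\<in>S. if Q s then 1 else (0::real)) = real (card {s\<in>S. Q s})"
    using assms by (simp add: sum.If_cases Int_def)
  finally show ?thesis .
qed

lemma exp_power_nat: "exp (- c) ^ n = exp (- c * real n)"
  by (simp add: exp_of_nat_mult[symmetric] mult.commute)

definition grad :: "nat \<Rightarrow> (vtx \<Rightarrow> real) \<Rightarrow> uedge set" where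
  "grad N \<phi> = {(x, j) \<in> EN N. (\<phi> x = 1) \<noteq> (\<phi> (up x j) = 1)}"

definition sdiff :: "'a set \<Rightarrow> 'a set \<Rightarrow> 'a set" where
  "sdiff A B = (A - B) \<union> (B - A)"

lemma sdiff_sdiff: "sdiff (sdiff A B) B = A"
  by (auto simp: sdiff_def)

lemma even_grad_plaq:
  assumes "p \<in> PN N" shows "even (card (bdp p \<inter> grad N \<phi>))"
proof -
  have "p \<in> PL" using assms PN_PL by blast
  then obtain x i j where p: "p = pt x i j" "i \<noteq> j" by (rule PL_cases)
  have "bd4 x i j \<subseteq> EN N" using assms p by (auto simp: PN_def bdp_pt)
  moreover have "up (up x i) j = up (up x j) i" by (rule up_up)
  ultimately have "\<not> nu (grad N \<phi>) x i j"
    by (simp add: nu_def grad_def bd4_def) argo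
  then show ?thesis using odd_bd4[OF p(2), of x "grad N \<phi>"] unfolding p(1) bdp_pt by blast
qed

text \<open>Each unoriented edge or plaquette enters the action twice, and a spin 1 lowers both
  terms from 1 to -1: hence exp (- 4 \<kappa>) and exp (- 4 \<beta>). Plaquettes do not see the
  gauge change by \<open>grad N \<phi>\<close>.\<close>

lemma higgs_weight_sg:
  assumes A: "A \<subseteq> EN N" and \<phi>: "\<phi> \<in> higgs_configs N"
  shows "higgs_weight N \<beta> \<kappa> (sg N A) \<phi> = exp (2 * \<beta> * real (card (PN N)) + 2 * \<kappa> * real (card (EN N)))
    * lat.wt (exp (- 4 * \<kappa>)) (exp (- 4 * \<beta>)) (PN N) (sdiff A (grad N \<phi>))"
proof -
  let ?B = "sdiff A (grad N \<phi>)"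
  have BE: "?B \<subseteq> EN N" using A by (auto simp: sdiff_def grad_def)
  have "(\<Sum>e\<in>edges_box N. \<phi> (snd e) * rho (sg N A e) * \<phi> (fst e)) = (\<Sum>e\<in>edges_box N. sgn_in (und e \<in> ?B))"
  proof (rule sum.cong)
    fix e assume e: "e \<in> edges_box N"
    obtain x j where x: "(x, j) \<in> EN N" "e = (x, up x j) \<or> e = (up x j, x)"
      using edges_box_cases[OF e] .
    have "\<phi> x \<in> {1, - 1}" "\<phi> (up x j) \<in> {1, - 1}"
      using x(1) \<phi> by (auto simp: EN_def higgs_configs_def)
    then show "\<phi> (snd e) * rho (sg N A e) * \<phi> (fst e) = sgn_in (und e \<in> ?B)"
      using x e by (auto simp: rho_sg sdiff_def grad_def)
  qed simp
  also have "\<dots> = 2 * (\<Sum>f\<in>EN N. sgn_in (f \<in> ?B))" by (rule sum_edges_box)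
  also have "{f \<in> EN N. f \<in> ?B} = ?B" using BE by auto
  then have "2 * (\<Sum>f\<in>EN N. sgn_in (f \<in> ?B)) = 2 * real (card (EN N)) - 4 * real (card ?B)"
    by (simp add: sum_sgn_in finite_EN)
  finally have 1: "(\<Sum>e\<in>edges_box N. \<phi> (snd e) * rho (sg N A e) * \<phi> (fst e))
    = 2 * real (card (EN N)) - 4 * real (card ?B)" .
  have "(\<Sum>p\<in>plaqs_box N. rho (dsig (sg N A) p)) = 2 * (\<Sum>p\<in>PN N. sgn_in (odd (card (bdp p \<inter> ?B))))"
  proof (rule sum_plaqs_box)
    fix p assume p: "p \<in> PN N"
    have "odd (card (bdp p \<inter> ?B)) \<longleftrightarrow> odd (card (bdp p \<inter> A))"
      unfolding sdiff_def using odd_card_symdiff[of "bdp p" A "grad N \<phi>"] even_grad_plaq[OF p, of \<phi>]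
        lat.finite_bd p PN_PL by blast
    then show "rho (dsig (sg N A) (posp p)) = sgn_in (odd (card (bdp p \<inter> ?B))) \<and>
       rho (dsig (sg N A) (rev_edge ` posp p)) = sgn_in (odd (card (bdp p \<inter> ?B)))"
      unfolding dsig_sg[OF p] by (simp add: rho_def)
  qed
  then have 2: "(\<Sum>p\<in>plaqs_box N. rho (dsig (sg N A) p))
     = 2 * real (card (PN N)) - 4 * real (card (lat.dd (PN N) ?B))"
    by (simp add: sum_sgn_in finite_PN lat.dd_def)
  show ?thesis
    unfolding higgs_weight_def 1 2 lat.wt_def
    using exp_power_nat[of "4 * \<kappa>" "card ?B"] exp_power_nat[of "4 * \<beta>" "card (lat.dd (PN N) ?B)"]
    by (simp add: exp_add[symmetric] algebra_simps)
qed

lemma gauge_weight_sg: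
  assumes "A \<subseteq> EN N"
  shows "gauge_weight N \<kappa> (sg N A) = exp (2 * \<kappa> * real (card (EN N))) * exp (- 4 * \<kappa>) ^ card A"
proof -
  have "gauge_weight N \<kappa> (sg N A) = higgs_weight N 0 \<kappa> (sg N A) (\<lambda>_. 1)"
    by (simp add: gauge_weight_def higgs_weight_def)
  moreover have "sdiff A (grad N (\<lambda>_. 1)) = A" by (auto simp: sdiff_def grad_def)
  ultimately show ?thesis
    using higgs_weight_sg[OF assms, of "\<lambda>_. 1" 0 \<kappa>] by (simp add: higgs_configs_def lat.wt_def)
qed

lemma flat_sg:
  assumes "A \<subseteq> EN N"
  shows "(\<forall>p\<in>plaqs_box N. even (dsig (sg N A) p)) \<longleftrightarrow> lat.dd (PN N) A = {}"
proof -
  have "(\<forall>p\<in>plaqs_box N. even (dsig (sg N A) p)) \<longleftrightarrow> (\<forall>p\<in>PN N. even (card (bdp p \<inter> A)))"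
    unfolding plaqs_box_eq ball_Un ball_simps(9) using dsig_sg[of _ N A] by auto
  then show ?thesis by (auto simp: lat.dd_def)
qed

lemma gauge_exp_eq:
  "gauge_exp N \<kappa> f = lat.Ex (exp (- 4 * \<kappa>)) 0 (PN N) (EN N) (\<lambda>A. f (sg N A))"
proof -
  let ?c = "exp (2 * \<kappa> * real (card (EN N)))" and ?w = "lat.wt (exp (- 4 * \<kappa>)) 0 (PN N)"
  have fin: "finite (spin_configs N)"
    using bij_betw_finite[OF bij_sg[of N]] finite_EN by simp
  have *: "(\<Sum>\<sigma>\<in>flat_configs N. gauge_weight N \<kappa> \<sigma> * g \<sigma>) = ?c * (\<Sum>A\<in>Pow (EN N). ?w A * g (sg N A))" for g
  proof -
    have "(\<Sum>\<sigma>\<in>flat_configs N. gauge_weight N \<kappa> \<sigma> * g \<sigma>)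
      = (\<Sum>\<sigma>\<in>spin_configs N. if \<forall>p\<in>plaqs_box N. even (dsig \<sigma> p) then gauge_weight N \<kappa> \<sigma> * g \<sigma> else 0)"
      unfolding flat_configs_def by (rule sum.inter_filter[OF fin])
    also have "\<dots> = (\<Sum>A\<in>Pow (EN N). if \<forall>p\<in>plaqs_box N. even (dsig (sg N A) p) then gauge_weight N \<kappa> (sg N A) * g (sg N A) else 0)"
      by (rule sum.reindex_bij_betw[OF bij_sg, symmetric])
    also have "\<dots> = (\<Sum>A\<in>Pow (EN N). ?c * (?w A * g (sg N A)))"
    proof (rule sum.cong)
      fix A assume "A \<in> Pow (EN N)"
      then have A: "A \<subseteq> EN N" "finite A" using finite_EN finite_subset by auto
      show "(if \<forall>p\<in>plaqs_box N. even (dsig (sg N A) p) then gauge_weight N \<kappa> (sg N A) * g (sg N A) else 0)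
        = ?c * (?w A * g (sg N A))"
        unfolding flat_sg[OF A(1)] gauge_weight_sg[OF A(1)] lat.wt_zero[OF lat.finite_dd[OF A(2) PN_PL]]
        by simp
    qed simp
    finally show ?thesis by (simp add: sum_distrib_left)
  qed
  show ?thesis
    unfolding gauge_exp_def lat.Ex_def using *[of f] *[of "\<lambda>_. 1"] by simp
qed

lemma finite_higgs_configs: "finite (higgs_configs N)"
proof -
  have "higgs_configs N = {\<phi>. \<forall>x. (x \<in> box N \<longrightarrow> \<phi> x \<in> {1, - 1}) \<and> (x \<notin> box N \<longrightarrow> \<phi> x = 1)}"
    by (auto simp: higgs_configs_def)
  then show ?thesis using finite_set_of_finite_funs[OF finite_box, of "{1, - 1 :: real}" N 1] by simp
qed

text \<open>For fixed \<phi>, substituting \<open>sdiff A (grad N \<phi>)\<close> removes \<phi>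
  from the weight and leaves the observable alone, since the loop meets a gradient evenly. All Higgs
  fields then contribute equally and their number cancels.\<close>

lemma higgs_exp_eq:
  assumes \<gamma>: "simple_loop \<gamma>" and G: "und ` \<gamma> \<subseteq> EN N"
  shows "higgs_exp N \<beta> \<kappa> (\<lambda>\<sigma> \<phi>. wilson \<gamma> \<sigma>) =
    lat.Ex (exp (- 4 * \<kappa>)) (exp (- 4 * \<beta>)) (PN N) (EN N) (\<lambda>A. (- 1) ^ card (A \<inter> und ` \<gamma>))"
proof -
  let ?c = "exp (2 * \<beta> * real (card (PN N)) + 2 * \<kappa> * real (card (EN N)))"
  let ?w = "lat.wt (exp (- 4 * \<kappa>)) (exp (- 4 * \<beta>)) (PN N)"
  let ?H = "higgs_configs N"
  have finG: "finite (und ` \<gamma>)" using simple_loopD[OF \<gamma>] by simp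
  have *: "(\<Sum>(\<sigma>,\<phi>)\<in>spin_configs N \<times> ?H. higgs_weight N \<beta> \<kappa> \<sigma> \<phi> * g \<sigma>)
      = real (card ?H) * ?c * (\<Sum>A\<in>Pow (EN N). ?w A * f A)"
    if gf: "\<And>A. A \<subseteq> EN N \<Longrightarrow> g (sg N A) = f A"
      and inv: "\<And>A \<phi>. f (sdiff A (grad N \<phi>)) = f A" for g f
  proof -
    have "(\<Sum>(\<sigma>,\<phi>)\<in>spin_configs N \<times> ?H. higgs_weight N \<beta> \<kappa> \<sigma> \<phi> * g \<sigma>)
        = (\<Sum>\<sigma>\<in>spin_configs N. \<Sum>\<phi>\<in>?H. higgs_weight N \<beta> \<kappa> \<sigma> \<phi> * g \<sigma>)"
      by (rule sum.cartesian_product[symmetric])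
    also have "\<dots> = (\<Sum>A\<in>Pow (EN N). \<Sum>\<phi>\<in>?H. higgs_weight N \<beta> \<kappa> (sg N A) \<phi> * g (sg N A))"
      by (rule sum.reindex_bij_betw[OF bij_sg, symmetric])
    also have "\<dots> = (\<Sum>A\<in>Pow (EN N). \<Sum>\<phi>\<in>?H. ?c * (?w (sdiff A (grad N \<phi>)) * f (sdiff A (grad N \<phi>))))"
      by (intro sum.cong refl) (simp add: higgs_weight_sg gf inv)
    also have "\<dots> = (\<Sum>\<phi>\<in>?H. \<Sum>A\<in>Pow (EN N). ?c * (?w (sdiff A (grad N \<phi>)) * f (sdiff A (grad N \<phi>))))"
      by (rule sum.swap)
    also have "\<dots> = (\<Sum>\<phi>\<in>?H. \<Sum>A\<in>Pow (EN N). ?c * (?w A * f A))"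
    proof (rule sum.cong)
      fix \<phi>
      show "(\<Sum>A\<in>Pow (EN N). ?c * (?w (sdiff A (grad N \<phi>)) * f (sdiff A (grad N \<phi>)))) = (\<Sum>A\<in>Pow (EN N). ?c * (?w A * f A))"
        by (rule sum.reindex_bij_witness[where i = "\<lambda>A. sdiff A (grad N \<phi>)" and j = "\<lambda>A. sdiff A (grad N \<phi>)"])
          (auto simp: sdiff_sdiff, auto simp: sdiff_def grad_def)
    qed simp
    finally show ?thesis by (simp add: sum_distrib_left mult_ac)
  qed
  have even: "even (card (und ` \<gamma> \<inter> grad N \<phi>))" for \<phi>
  proof -
    let ?A = "{(x, j) \<in> UE. (\<phi> x = 1) \<noteq> (\<phi> (up x j) = 1)}"
    have "even (card (?A \<inter> und ` \<gamma>))"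
      by (rule loop_parity[OF \<gamma>, of _ "\<lambda>x. \<phi> x = 1"]) (simp add: UE_def)
    moreover have "?A \<inter> und ` \<gamma> = und ` \<gamma> \<inter> grad N \<phi>"
      using G EN_UE by (auto simp: grad_def)
    ultimately show ?thesis by simp
  qed
  have inv: "(- 1 :: real) ^ card (sdiff A (grad N \<phi>) \<inter> und ` \<gamma>) = (- 1) ^ card (A \<inter> und ` \<gamma>)" for A \<phi>
    using odd_card_symdiff[OF finG, of A "grad N \<phi>"] even[of \<phi>]
    by (simp add: minus_one_power_iff sdiff_def Int_commute)
  have num: "(\<Sum>(\<sigma>,\<phi>)\<in>spin_configs N \<times> ?H. higgs_weight N \<beta> \<kappa> \<sigma> \<phi> * wilson \<gamma> \<sigma>)
      = real (card ?H) * ?c * (\<Sum>A\<in>Pow (EN N). ?w A * (- 1) ^ card (A \<inter> und ` \<gamma>))"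
    by (rule *) (use wilson_sg(1)[OF \<gamma> G] inv in auto)
  have den: "(\<Sum>(\<sigma>,\<phi>)\<in>spin_configs N \<times> ?H. higgs_weight N \<beta> \<kappa> \<sigma> \<phi>)
      = real (card ?H) * ?c * (\<Sum>A\<in>Pow (EN N). ?w A)"
    using *[of "\<lambda>_. 1" "\<lambda>_. 1"] by simp
  have "(\<lambda>_. 1) \<in> ?H" by (simp add: higgs_configs_def)
  then have "card ?H \<noteq> 0" using finite_higgs_configs by auto
  then show ?thesis unfolding higgs_exp_def num den lat.Ex_def by simp
qed

subsection \<open>Infinite volume limits\<close>

definition int_ed :: "nat \<Rightarrow> uedge set" where
  "int_ed R = {(x, j) \<in> UE. \<forall>i<4. \<bar>x i\<bar> \<le> int R}"

lemma finite_int_ed: "finite (int_ed R)"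
proof (rule finite_subset)
  show "int_ed R \<subseteq> box R \<times> {..<4}" by (auto simp: int_ed_def UE_def box_def)
qed (simp add: finite_box)

lemma int_ed_mono: "R \<le> R' \<Longrightarrow> int_ed R \<subseteq> int_ed R'"
  by (force simp: int_ed_def)

lemma finite_subset_int_ed:
  assumes "finite F" "F \<subseteq> UE" shows "\<exists>r. F \<subseteq> int_ed r"
  using assms
proof (induction F rule: finite_induct)
  case (insert e F)
  then obtain r where r: "F \<subseteq> int_ed r" by auto
  define s where "s = nat (\<Sum>i<4. \<bar>fst e i\<bar>)"
  have "\<bar>fst e i\<bar> \<le> int s" if "i < 4" for i
  proof -
    have "\<bar>fst e i\<bar> \<le> (\<Sum>i<4. \<bar>fst e i\<bar>)" by (rule member_le_sum) (use that in auto)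
    then show ?thesis by (simp add: s_def)
  qed
  then have "e \<in> int_ed s" using insert.prems by (auto simp: int_ed_def)
  then show ?case using r int_ed_mono[of r "max r s"] int_ed_mono[of s "max r s"] by (intro exI[of _ "max r s"]) auto
qed simp

lemma int_ed_EN: "R + 1 \<le> N \<Longrightarrow> int_ed R \<subseteq> EN N"
  by (force simp: int_ed_def UE_def EN_def box_def up_app)

lemma bdp_base:
  assumes "p \<in> PL" "e \<in> bdp p" shows "fst p i \<le> fst e i" "fst e i \<le> fst p i + 1" "e \<in> UE"
proof -
  obtain x a b where p: "p = (x, a, b)" "x \<in> lattice" "a < b" "b < 4" using assms(1) by (auto simp: PL_def)
  then show "fst p i \<le> fst e i" "fst e i \<le> fst p i + 1" "e \<in> UE"
    using assms(2) by (auto simp: bdp_def bd4_def up_app UE_def)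
qed

lemma adj_level: "lat.adj e f \<Longrightarrow> \<bar>fst f i\<bar> \<le> \<bar>fst e i\<bar> + 1"
proof -
  assume "lat.adj e f"
  then obtain p where p: "p \<in> PL" "e \<in> bdp p" "f \<in> bdp p" by (auto simp: lat.adj_def)
  show ?thesis using bdp_base(1,2)[OF p(1,2), of i] bdp_base(1,2)[OF p(1,3), of i] by linarith
qed

lemma int_ed_cob_PN:
  assumes "e \<in> int_ed R" "R + 2 \<le> N" "p \<in> cob e" shows "p \<in> PN N"
proof -
  have p: "p \<in> PL" "e \<in> bdp p" using assms(3) by (auto simp: cob_def)
  have "f \<in> EN N" if f: "f \<in> bdp p" for f
  proof -
    have "lat.adj e f" using p f by (auto simp: lat.adj_def)
    then have "\<bar>fst f i\<bar> \<le> int (R + 1)" if "i < 4" for i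
      using adj_level[of e f i] assms(1) that by (force simp: int_ed_def)
    then have "f \<in> int_ed (R + 1)" using bdp_base(3)[OF p(1) f] by (auto simp: int_ed_def)
    then show ?thesis using int_ed_EN[of "R + 1" N] assms(2) by auto
  qed
  then show ?thesis using p by (auto simp: PN_def)
qed

lemma dd_PN:
  assumes "A \<subseteq> int_ed R" "R + 2 \<le> N" shows "lat.dd (PN N) A = cb A"
proof -
  have "p \<in> PN N" if p: "p \<in> cb A" for p
  proof -
    obtain e where "e \<in> A" "p \<in> PL" "e \<in> bdp p" using p lat.dd_subset_cobd[of PL A] by blast
    then show ?thesis using int_ed_cob_PN[of e R N p] assms by (auto simp: cob_def)
  qed
  then have "cb A \<subseteq> PN N" by (rule subsetI)
  then show ?thesis using PN_PL[of N] unfolding lat.dd_def by blast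
qed

text \<open>Along an adjacency the absolute value of a coordinate grows by at most 1, so in a
  suitable coordinate \<open>K\<close> takes all absolute values from r to R.\<close>

lemma conn_reach_card:
  assumes K: "lat.conn K" "finite K" "e \<in> K" "e \<in> int_ed r" "\<not> K \<subseteq> int_ed R" "K \<subseteq> UE"
  shows "Suc (R - r) \<le> card K"
proof -
  obtain f where f: "f \<in> K" "f \<notin> int_ed R" using K(5) by blast
  then obtain i where i: "i < 4" "\<bar>fst f i\<bar> > int R" using K(6) by (force simp: int_ed_def)
  let ?lev = "\<lambda>g :: uedge. \<bar>fst g i\<bar>"
  have "(e, f) \<in> {(a, b). a \<in> K \<and> b \<in> K \<and> lat.adj a b}\<^sup>*"
    using K(1,3) f(1) unfolding lat.conn_def lat.cmp_def by blast
  then have "\<forall>t. ?lev e \<le> t \<and> t \<le> ?lev f \<longrightarrow> t \<in> ?lev ` K"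
  proof induction
    case base
    show ?case
    proof (intro allI impI)
      fix t assume "?lev e \<le> t \<and> t \<le> ?lev e"
      then have "t = ?lev e" by simp
      then show "t \<in> ?lev ` K" using K(3) by blast
    qed
  next
    case (step g h)
    show ?case
    proof (intro allI impI)
      fix t assume t: "?lev e \<le> t \<and> t \<le> ?lev h"
      have "?lev h \<le> ?lev g + 1" using adj_level[of g h i] step.hyps by simp
      then have "t \<le> ?lev g \<or> t = ?lev h" using t by linarith
      then show "t \<in> ?lev ` K" using step t by blast
    qed
  qed
  moreover have "?lev e \<le> int r" using K(4) i by (auto simp: int_ed_def)
  ultimately have "{int r..int R} \<subseteq> ?lev ` K" using i by auto
  then have "card {int r..int R} \<le> card (?lev ` K)" using K(2) by (intro card_mono) auto
  also have "\<dots> \<le> card K" by (rule card_image_le[OF K(2)])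
  moreover have "0 < card K" using K(2,3) card_gt_0_iff by blast
  ultimately show ?thesis by auto
qed

text \<open>The pair is exchanged on clusters inside \<open>int_ed R\<close>; there both weights
  agree, as the margin 2 leaves room for all plaquettes at these edges. Afterwards the observable
  can differ only if a cluster joins \<open>F\<close> to the outside of \<open>int_ed R\<close>,
  which is exponentially unlikely in R - r.\<close>

lemma free_close:
  fixes x y :: real and f :: "uedge set \<Rightarrow> real"
  assumes x: "0 < x" "324 * (2 * x + x\<^sup>2) < 1" and y: "0 \<le> y" "y \<le> 1"
    and F: "F \<subseteq> int_ed r" and f: "\<And>A. f A = f (A \<inter> F)" "\<And>A. \<bar>f A\<bar> \<le> 1"
    and N: "R + 2 \<le> N" "R + 2 \<le> M"
  shows "\<bar>lat.Ex x y (PN N) (EN N) f - lat.Ex x y PL (EN M) f\<bar>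
    \<le> 2 * (real (card F) * ((2 * x + x\<^sup>2) * (324 * (2 * x + x\<^sup>2)) ^ (R - r) / (1 - 324 * (2 * x + x\<^sup>2))))"
proof -
  interpret S: pair_system PL bdp x y y "PN N" PL "EN N" "EN M"
    by unfold_locales (use x y finite_EN PN_PL in auto)
  define \<Phi> where "\<Phi> a b \<longleftrightarrow> a \<union> b \<subseteq> int_ed R" for a b
  have sym: "\<Phi> a b = \<Phi> b a" for a b by (simp add: \<Phi>_def Un_commute)
  let ?bad = "\<lambda>A B. \<exists>e\<in>F. \<exists>K\<in>lat.cmps (A \<union> B). e \<in> K \<and> \<not> \<Phi> (A \<inter> K) (B \<inter> K)"
  have U: "S.swapU \<Phi> A B \<subseteq> int_ed R" for A B
    unfolding S.swapU_def \<Phi>_def using lat.cmps_subset by blast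
  have w: "S.w1 C = S.w2 C" if "C \<subseteq> int_ed R" for C
    using dd_PN[OF that N(1)] by (simp add: lat.wt_def)
  have "S.PE (\<lambda>A B. f B) = S.PE (\<lambda>A B. f (S.swap \<Phi> B A))"
  proof (rule S.PE_swap[OF sym])
    fix A B assume AB: "A \<subseteq> EN N" "B \<subseteq> EN M"
    have "A \<inter> S.swapU \<Phi> A B \<subseteq> EN M" "B \<inter> S.swapU \<Phi> A B \<subseteq> EN N"
      using U[of A B] int_ed_EN[of R N] int_ed_EN[of R M] N by auto
    moreover have "S.w1 (A \<inter> S.swapU \<Phi> A B) = S.w2 (A \<inter> S.swapU \<Phi> A B)"
      "S.w1 (B \<inter> S.swapU \<Phi> A B) = S.w2 (B \<inter> S.swapU \<Phi> A B)"
      using U[of A B] by (auto intro!: w)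
    ultimately show "A \<inter> S.swapU \<Phi> A B \<subseteq> EN M \<and> B \<inter> S.swapU \<Phi> A B \<subseteq> EN N \<and>
      S.w1 (A \<inter> S.swapU \<Phi> A B) * S.w2 (B \<inter> S.swapU \<Phi> A B) = S.w1 (B \<inter> S.swapU \<Phi> A B) * S.w2 (A \<inter> S.swapU \<Phi> A B)"
      by (simp add: mult.commute)
  qed
  then have "lat.Ex x y (PN N) (EN N) f - lat.Ex x y PL (EN M) f = S.PE (\<lambda>A B. f A - f (S.swap \<Phi> B A))"
    unfolding S.PE_diff by (simp add: S.PE_fst_Ex S.PE_snd_Ex)
  then have "\<bar>lat.Ex x y (PN N) (EN N) f - lat.Ex x y PL (EN M) f\<bar> \<le> S.PE (\<lambda>A B. \<bar>f A - f (S.swap \<Phi> B A)\<bar>)"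
    using S.PE_abs by simp
  also have "\<dots> \<le> S.PE (\<lambda>A B. 2 * of_bool (?bad A B))"
  proof (rule S.PE_mono)
    fix A B
    show "\<bar>f A - f (S.swap \<Phi> B A)\<bar> \<le> 2 * of_bool (?bad A B)"
    proof (cases "?bad A B")
      case True
      then show ?thesis using f(2)[of A] f(2)[of "S.swap \<Phi> B A"] by simp
    next
      case False
      have c: "S.swapU \<Phi> B A = S.swapU \<Phi> A B" by (rule S.swapU_commute[OF sym])
      have "e \<in> A \<longleftrightarrow> e \<in> S.swap \<Phi> B A" if "e \<in> F" for e
      proof (cases "e \<in> A \<union> B")
        case True
        then obtain K where K: "K \<in> lat.cmps (A \<union> B)" "e \<in> K" using lat.Union_cmps[of "A \<union> B"] by blast
        then have "e \<in> S.swapU \<Phi> A B" using S.swapU_iff[OF K] False that by blast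
        then show ?thesis unfolding S.swap_def c by blast
      next
        case False
        then show ?thesis unfolding S.swap_def c by blast
      qed
      then have "A \<inter> F = S.swap \<Phi> B A \<inter> F" by blast
      then have "f A = f (S.swap \<Phi> B A)" using f(1) by metis
      then show ?thesis by simp
    qed
  qed
  also have "\<dots> = 2 * S.Pr (\<lambda>A B. ?bad A B)"
    unfolding S.PE_cmult S.Pr_def ..
  also have "S.Pr (\<lambda>A B. ?bad A B)
      \<le> (\<Sum>e\<in>F. S.Pr (\<lambda>A B. \<exists>K\<in>lat.cmps (A \<union> B). e \<in> K \<and> \<not> \<Phi> (A \<inter> K) (B \<inter> K)))"
    by (rule S.Pr_le_sum) (use F finite_int_ed finite_subset in auto)
  also have "\<dots> \<le> (\<Sum>e\<in>F. 1 * (S.q * (324 * S.q) ^ (R - r) / (1 - 324 * S.q)))"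
  proof (rule sum_mono, rule order_trans[OF S.comp_prob[of _ "\<lambda>a b. \<not> \<Phi> a b"]], rule S.cluster_sum)
    fix e a b assume e: "e \<in> F" and ab: "a \<subseteq> EN N" "b \<subseteq> EN M" "e \<in> a \<union> b" "lat.conn (a \<union> b)" "\<not> \<Phi> a b"
    have fin: "finite a" "finite b" using ab finite_EN finite_subset by blast+
    have "a \<union> b \<subseteq> UE" using ab EN_UE[of N] EN_UE[of M] by blast
    moreover have "e \<in> int_ed r" "\<not> a \<union> b \<subseteq> int_ed R" using e F ab(5) by (auto simp: \<Phi>_def)
    ultimately have "Suc (R - r) \<le> card (a \<union> b)"
      using conn_reach_card[OF ab(4) _ ab(3)] fin by blast
    moreover have "S.w1 a * S.w2 b \<le> x ^ card a * x ^ card b"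
      by (intro mult_mono lat.wt_le S.w_nonneg) (use x y in auto)
    ultimately show "Suc (R - r) \<le> card (a \<union> b) \<and> S.w1 a * S.w2 b \<le> 1 * x ^ (card a + card b)"
      by (simp add: power_add)
  qed simp
  finally show ?thesis by simp
qed

text \<open>Any two late members of the first sequence are close to one and the same member of the
  second, so it is Cauchy. The second one, with all plaquettes of the lattice, is the one that gets
  estimated.\<close>

lemma limit_free:
  fixes x y :: real and f :: "uedge set \<Rightarrow> real"
  assumes x: "0 < x" "324 * (2 * x + x\<^sup>2) < 1" and y: "0 \<le> y" "y \<le> 1"
    and F: "finite F" "F \<subseteq> UE" and f: "\<And>A. f A = f (A \<inter> F)" "\<And>A. \<bar>f A\<bar> \<le> 1"
  shows "\<exists>L. (\<lambda>N. lat.Ex x y (PN N) (EN N) f) \<longlonglongrightarrow> L \<and> (\<lambda>M. lat.Ex x y PL (EN M) f) \<longlonglongrightarrow> L"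
proof -
  let ?a = "\<lambda>N. lat.Ex x y (PN N) (EN N) f" and ?b = "\<lambda>M. lat.Ex x y PL (EN M) f"
  let ?q = "2 * x + x\<^sup>2"
  obtain r where r: "F \<subseteq> int_ed r" using finite_subset_int_ed[OF F] by blast
  have q: "0 < ?q" using x by (simp add: add_pos_pos)
  have "(\<lambda>n. 2 * (real (card F) * (?q * (324 * ?q) ^ n / (1 - 324 * ?q)))) \<longlonglongrightarrow> 2 * (real (card F) * (?q * 0 / (1 - 324 * ?q)))"
    by (intro tendsto_intros LIMSEQ_realpow_zero) (use x q in auto)
  then have lim0: "(\<lambda>n. 2 * (real (card F) * (?q * (324 * ?q) ^ n / (1 - 324 * ?q)))) \<longlonglongrightarrow> 0" by simp
  have close: "\<exists>R. \<forall>N\<ge>R. \<forall>M\<ge>R. \<bar>?a N - ?b M\<bar> < e" if e: "0 < e" for e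
  proof -
    obtain n where n: "2 * (real (card F) * (?q * (324 * ?q) ^ n / (1 - 324 * ?q))) < e"
      using order_tendstoD(2)[OF lim0 e] by (auto simp: eventually_sequentially)
    have "\<bar>?a N - ?b M\<bar> < e" if "n + r + 2 \<le> N" "n + r + 2 \<le> M" for N M
      using free_close[where f = f and F = F, OF x y r f that] n by simp
    then show ?thesis by blast
  qed
  have "Cauchy ?a"
  proof (rule metric_CauchyI)
    fix e :: real assume "0 < e"
    then obtain R where R: "\<And>N M. N \<ge> R \<Longrightarrow> M \<ge> R \<Longrightarrow> \<bar>?a N - ?b M\<bar> < e / 2"
      using close[of "e / 2"] by auto
    have "dist (?a m) (?a n) < e" if "m \<ge> R" "n \<ge> R" for m n
      using R[OF that(1) order_refl] R[OF that(2) order_refl] unfolding dist_real_def by linarith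
    then show "\<exists>M. \<forall>m\<ge>M. \<forall>n\<ge>M. dist (?a m) (?a n) < e" by blast
  qed
  then obtain L where L: "?a \<longlonglongrightarrow> L" using Cauchy_convergent_iff convergent_def by blast
  have "?b \<longlonglongrightarrow> L"
  proof (rule LIMSEQ_I)
    fix e :: real assume "0 < e"
    then obtain R where R: "\<And>N M. N \<ge> R \<Longrightarrow> M \<ge> R \<Longrightarrow> \<bar>?a N - ?b M\<bar> < e / 2"
      using close[of "e / 2"] by auto
    obtain R' where R': "\<And>N. N \<ge> R' \<Longrightarrow> norm (?a N - L) < e / 2"
      using LIMSEQ_D[OF L, of "e / 2"] \<open>0 < e\<close> by auto
    have "norm (?b M - L) < e" if "M \<ge> R" for M
      using R[OF max.cobounded1 that, of R'] R'[OF max.cobounded2, of R] unfolding real_norm_def by linarith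
    then show "\<exists>no. \<forall>n\<ge>no. norm (?b n - L) < e" by blast
  qed
  then show ?thesis using L by blast
qed

section \<open>The Wilson loop expectation in finite volume\<close>

text \<open>Both terms lie between 1 - 2 r and 1 - 2 r + 2 r^2.\<close>

lemma half_ratio_exp_diff:
  fixes r :: real
  assumes "0 \<le> r" "r \<le> 1"
  shows "\<bar>(1 - r) / (1 + r) - exp (- 2 * r)\<bar> \<le> 2 * r\<^sup>2"
proof -
  have 1: "(1 - r) / (1 + r) \<ge> 1 - 2 * r" "(1 - r) / (1 + r) \<le> 1 - 2 * r + 2 * r\<^sup>2"
    using assms by (simp_all add: field_simps power2_eq_square)
  have 2: "1 - 2 * r \<le> exp (- 2 * r)" using exp_ge_add_one_self[of "- 2 * r"] by simp
  have "exp (- (2 * r)) \<le> 1 / (1 + 2 * r + (2 * r)\<^sup>2 / 2)"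
    using exp_lower_Taylor_quadratic[of "2 * r"] assms by (simp add: exp_minus field_simps add_pos_nonneg)
  also have "\<dots> \<le> 1 - 2 * r + 2 * r\<^sup>2"
  proof -
    have "(1 - 2 * r + 2 * r\<^sup>2) * (1 + 2 * r + (2 * r)\<^sup>2 / 2) = 1 + 4 * (r\<^sup>2)\<^sup>2"
      by (simp add: power2_eq_square algebra_simps)
    then have "1 \<le> (1 - 2 * r + 2 * r\<^sup>2) * (1 + 2 * r + (2 * r)\<^sup>2 / 2)" by simp
    moreover have "0 < 1 + 2 * r + (2 * r)\<^sup>2 / 2" using assms by (simp add: add_pos_nonneg)
    ultimately show ?thesis by (simp add: pos_divide_le_eq)
  qed
  finally show ?thesis using 1 2 by (simp add: abs_le_iff)
qed

text \<open>\<open>G1\<close> and \<open>Gc\<close> will be the non-corner and the corner edges of a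
  loop, of which only isolation and parity are kept. \<open>K0\<close> bounds the geometric series
  for a whole range of \<open>x\<close>, which makes the constants uniform.\<close>

locale main_est =
  fixes x y K0 :: real and \<Lambda> G1 Gc :: "uedge set"
  assumes x: "0 < x" "324 * (2 * x + x\<^sup>2) < 1" and y: "0 < y" "y \<le> 1" and yx: "y ^ 3 \<le> x\<^sup>2"
    and K0: "1 / (1 - 324 * (2 * x + x\<^sup>2)) \<le> K0"
    and \<Lambda>: "finite \<Lambda>" "\<Lambda> \<subseteq> UE" and G: "G1 \<union> Gc \<subseteq> \<Lambda>" "G1 \<inter> Gc = {}"
    and isol: "\<And>e f. e \<in> G1 \<Longrightarrow> f \<in> G1 \<Longrightarrow> e \<noteq> f \<Longrightarrow> \<not> lat.adj e f"
    and parity: "\<And>A. finite A \<Longrightarrow> cb A = {} \<Longrightarrow> even (card (A \<inter> (G1 \<union> Gc)))"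
begin

sublocale S: pair_system PL bdp x y 0 PL PL \<Lambda> \<Lambda>
  by unfold_locales (use x y \<Lambda> in auto)

lemma x_le1: "x \<le> 1"
proof -
  have "324 * (2 * x) \<le> 324 * (2 * x + x\<^sup>2)" by simp
  then show ?thesis using x(2) by linarith
qed

lemma K0_pos: "0 < K0"
  using K0 x by (smt (verit) divide_pos_pos)

lemma q_le: "S.q \<le> 3 * x"
  using x_le1 x(1) by (simp add: power2_eq_square)

lemma q_nonneg: "0 \<le> S.q"
  using x(1) by simp

text \<open>57 = 19 * 3: at most 19 edges in \<open>near e\<close>, and the factor 3 of
  \<open>q_le\<close>.\<close>

definition c1 where "c1 = 57 * K0"

lemma cluster1: "S.q * (324 * S.q) ^ 0 / (1 - 324 * S.q) \<le> 3 * K0 * x"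
proof -
  have "S.q * (1 / (1 - 324 * S.q)) \<le> (3 * x) * K0"
    by (rule mult_mono[OF q_le K0]) (use x in auto)
  then show ?thesis by (simp add: mult_ac)
qed

lemma cluster2: "S.q * (324 * S.q) ^ 1 / (1 - 324 * S.q) \<le> 2916 * K0 * x\<^sup>2"
proof -
  have "(S.q * (324 * S.q)) * (1 / (1 - 324 * S.q)) \<le> ((3 * x) * (324 * (3 * x))) * K0"
    by (rule mult_mono[OF mult_mono K0]) (use q_le q_nonneg x in auto)
  then show ?thesis by (simp add: mult_ac power2_eq_square)
qed

text \<open>Here and in \<open>Hit\<close> and \<open>Two\<close> only frustration in
  \<open>A\<close> matters, because \<open>B\<close> has weight 0 unless it is flat. Clusters that
  avoid \<open>near e\<close> do not meet any plaquette of \<open>e\<close>.\<close>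

definition NearE :: "uedge \<Rightarrow> uedge set \<Rightarrow> uedge set \<Rightarrow> bool" where
  "NearE e A B \<longleftrightarrow> (\<exists>f\<in>lat.near e. \<exists>K\<in>lat.cmps (A \<union> B). f \<in> K \<and> cb (A \<inter> K) \<noteq> {})"

definition Hit :: "nat \<Rightarrow> uedge \<Rightarrow> uedge set \<Rightarrow> uedge set \<Rightarrow> bool" where
  "Hit k e A B \<longleftrightarrow> (\<exists>f\<in>lat.near e. \<exists>K\<in>lat.cmps (A \<union> B). f \<in> K \<and> k \<le> card (cb (A \<inter> K)))"

definition Two :: "uedge \<Rightarrow> uedge set \<Rightarrow> uedge set \<Rightarrow> bool" where
  "Two e A B \<longleftrightarrow> (\<exists>u\<in>lat.near e \<times> lat.near e. \<exists>K\<in>lat.cmps (A \<union> B). \<exists>L\<in>lat.cmps (A \<union> B). K \<noteq> L \<and>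
     fst u \<in> K \<and> snd u \<in> L \<and> cb (A \<inter> K) \<noteq> {} \<and> cb (A \<inter> L) \<noteq> {})"

text \<open>Unless \<open>Bd e\<close> occurs, \<open>upl e\<close> takes one of the values 0, 1, 5 and 6.\<close>
definition Bd :: "uedge \<Rightarrow> uedge set \<Rightarrow> uedge set \<Rightarrow> bool" where
  "Bd e A B \<longleftrightarrow> Hit 7 e A B \<or> Two e A B"

lemma weight_bound:
  assumes "a \<subseteq> \<Lambda>" "b \<subseteq> \<Lambda>" "k \<le> card (cb a)"
  shows "S.w1 a * S.w2 b \<le> y ^ k * x ^ (card a + card b)"
proof -
  have "y ^ card (cb a) \<le> y ^ k" using assms(3) y by (intro power_decreasing) auto
  then have "S.w1 a \<le> x ^ card a * y ^ k" unfolding lat.wt_def using x by simp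
  moreover have "S.w2 b \<le> x ^ card b" using x by (intro lat.wt_le) auto
  ultimately have "S.w1 a * S.w2 b \<le> (x ^ card a * y ^ k) * x ^ card b"
    by (rule mult_mono) (use S.w_nonneg x y in auto)
  then show ?thesis by (simp add: power_add mult_ac)
qed

lemma card_pos_cluster: "a \<subseteq> \<Lambda> \<Longrightarrow> b \<subseteq> \<Lambda> \<Longrightarrow> f \<in> a \<union> b \<Longrightarrow> Suc 0 \<le> card (a \<union> b)"
  using \<Lambda>(1) finite_subset by (metis Suc_le_eq card_gt_0_iff empty_iff finite_UnI)

lemma cluster_hit: "(\<Sum>(a,b)\<in>S.clus (\<lambda>a b. k \<le> card (cb a)) f. S.w1 a * S.w2 b) \<le> 3 * K0 * x * y ^ k"
proof -
  have "(\<Sum>(a,b)\<in>S.clus (\<lambda>a b. k \<le> card (cb a)) f. S.w1 a * S.w2 b) \<le> y ^ k * (S.q * (324 * S.q) ^ 0 / (1 - 324 * S.q))"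
  proof (rule S.cluster_sum)
    fix a b assume ab: "a \<subseteq> \<Lambda>" "b \<subseteq> \<Lambda>" "f \<in> a \<union> b" "k \<le> card (cb a)"
    then show "Suc 0 \<le> card (a \<union> b) \<and> S.w1 a * S.w2 b \<le> y ^ k * x ^ (card a + card b)"
      using weight_bound[OF ab(1,2)] card_pos_cluster[OF ab(1-3)] by blast
  qed (use y in simp)
  also have "\<dots> \<le> y ^ k * (3 * K0 * x)" by (rule mult_left_mono[OF cluster1]) (use y in simp)
  finally show ?thesis by (simp add: mult_ac)
qed

lemma nonflat_card: "A \<subseteq> \<Lambda> \<Longrightarrow> cb (A \<inter> K) \<noteq> {} \<Longrightarrow> 6 \<le> card (cb (A \<inter> K))"
  using card_cb_ge6[of "A \<inter> K"] finite_subset[OF _ \<Lambda>(1), of "A \<inter> K"] by blast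

lemma Pr_Hit: "S.Pr (Hit k e) \<le> c1 * x * y ^ k"
proof -
  have "S.Pr (Hit k e) \<le> (\<Sum>f\<in>lat.near e. S.Pr (\<lambda>A B. \<exists>K\<in>lat.cmps (A \<union> B). f \<in> K \<and> k \<le> card (cb (A \<inter> K))))"
    by (rule S.Pr_le_sum[OF lat.finite_near]) (auto simp: Hit_def)
  also have "\<dots> \<le> (\<Sum>f\<in>lat.near e. 3 * K0 * x * y ^ k)"
    by (rule sum_mono, rule order_trans[OF S.comp_prob[of _ "\<lambda>a b. k \<le> card (cb a)"] cluster_hit])
  also have "\<dots> = real (card (lat.near e)) * (3 * K0 * x * y ^ k)" by simp
  also have "\<dots> \<le> 19 * (3 * K0 * x * y ^ k)"
    by (rule mult_right_mono) (use lat.card_near[of e] K0_pos x y in auto)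
  finally show ?thesis by (simp add: c1_def mult_ac)
qed

lemma Pr_NearE: "S.Pr (NearE e) \<le> c1 * x * y ^ 6"
proof -
  have "S.Pr (NearE e) \<le> S.Pr (Hit 6 e)"
  proof (rule S.Pr_mono)
    fix A B assume A: "A \<subseteq> \<Lambda>" and "NearE e A B"
    then obtain f K where "f \<in> lat.near e" "K \<in> lat.cmps (A \<union> B)" "f \<in> K" "cb (A \<inter> K) \<noteq> {}"
      by (auto simp: NearE_def)
    then show "Hit 6 e A B" using nonflat_card[OF A] unfolding Hit_def by blast
  qed
  also have "\<dots> \<le> c1 * x * y ^ 6" by (rule Pr_Hit)
  finally show ?thesis .
qed

lemma Pr_Two: "S.Pr (Two e) \<le> c1\<^sup>2 * x * y ^ 7"
proof -
  let ?N = "lat.near e"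
  have "S.Pr (Two e) \<le> (\<Sum>u\<in>?N \<times> ?N. S.Pr (\<lambda>A B. \<exists>K\<in>lat.cmps (A \<union> B). \<exists>L\<in>lat.cmps (A \<union> B). K \<noteq> L \<and>
     fst u \<in> K \<and> snd u \<in> L \<and> 6 \<le> card (cb (A \<inter> K)) \<and> 6 \<le> card (cb (A \<inter> L))))"
  proof (rule S.Pr_le_sum)
    show "finite (?N \<times> ?N)" by (simp add: lat.finite_near)
    fix A B assume A: "A \<subseteq> \<Lambda>" and "Two e A B"
    then obtain u K L where u: "u \<in> ?N \<times> ?N" "K \<in> lat.cmps (A \<union> B)" "L \<in> lat.cmps (A \<union> B)" "K \<noteq> L"
      "fst u \<in> K" "snd u \<in> L" "cb (A \<inter> K) \<noteq> {}" "cb (A \<inter> L) \<noteq> {}"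
      unfolding Two_def by blast
    then show "\<exists>u\<in>?N \<times> ?N. \<exists>K\<in>lat.cmps (A \<union> B). \<exists>L\<in>lat.cmps (A \<union> B). K \<noteq> L \<and>
        fst u \<in> K \<and> snd u \<in> L \<and> 6 \<le> card (cb (A \<inter> K)) \<and> 6 \<le> card (cb (A \<inter> L))"
      using nonflat_card[OF A] by (intro bexI[OF _ u(1)] bexI[OF _ u(2)] bexI[OF _ u(3)]) auto
  qed
  also have "\<dots> \<le> (\<Sum>u\<in>?N \<times> ?N. (3 * K0 * x * y ^ 6) * (3 * K0 * x * y ^ 6))"
  proof (rule sum_mono, rule order_trans[OF S.two_comp_prob[of _ _ "\<lambda>a b. 6 \<le> card (cb a)"]])
    fix u
    show "(\<Sum>(a,b)\<in>S.clus (\<lambda>a b. 6 \<le> card (cb a)) (fst u). S.w1 a * S.w2 b) * (\<Sum>(a,b)\<in>S.clus (\<lambda>a b. 6 \<le> card (cb a)) (snd u). S.w1 a * S.w2 b)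
      \<le> (3 * K0 * x * y ^ 6) * (3 * K0 * x * y ^ 6)"
      by (intro mult_mono cluster_hit) (use K0_pos x y S.w_nonneg in \<open>auto intro!: sum_nonneg\<close>)
  qed
  also have "\<dots> = (real (card ?N) * (3 * K0 * x * y ^ 6))\<^sup>2"
    by (simp add: card_cartesian_product power2_eq_square)
  also have "\<dots> \<le> (19 * (3 * K0 * x * y ^ 6))\<^sup>2"
    by (intro power_mono mult_right_mono) (use lat.card_near[of e] K0_pos x y in auto)
  also have "\<dots> = c1\<^sup>2 * x * (x * y ^ 12)" by (simp add: c1_def power2_eq_square algebra_simps flip: power_add)
  \<comment> \<open>Two clusters give x^2 y^12; the bound is weakened to the order of
    \<open>Hit 7\<close>.\<close>
  also have "\<dots> \<le> c1\<^sup>2 * x * (1 * y ^ 7)"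
    by (intro mult_left_mono mult_mono power_decreasing) (use x_le1 x y in auto)
  finally show ?thesis by simp
qed

lemma Pr_Bd: "S.Pr (Bd e) \<le> (c1 + c1\<^sup>2) * x * y ^ 7"
proof -
  have "S.Pr (Bd e) \<le> (\<Sum>b\<in>{True, False}. S.Pr (if b then Hit 7 e else Two e))"
    by (rule S.Pr_le_sum) (auto simp: Bd_def)
  then show ?thesis using Pr_Hit[of 7 e] Pr_Two[of e] by (simp add: algebra_simps)
qed

subsection \<open>The local structure around an edge\<close>

lemma upl_eq:
  assumes "finite A" "e \<in> UE"
  shows "lat.upl e A = (if e \<in> A then 6 - card (cb A \<inter> cob e) else card (cb A \<inter> cob e))"
proof -
  have fin: "finite (cob e)" by (rule finite_cob)
  show ?thesis
  proof (cases "e \<in> A")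
    case False
    then have "{p \<in> PL. e \<in> bdp p \<and> odd (card (bdp p \<inter> (A - {e})))} = cb A \<inter> cob e"
      by (auto simp: lat.dd_def cob_def)
    then show ?thesis using False by (simp add: lat.upl_def)
  next
    case True
    have "odd (card (bdp p \<inter> (A - {e}))) \<longleftrightarrow> even (card (bdp p \<inter> A))" if "e \<in> bdp p" for p
    proof -
      have "bdp p \<inter> A = insert e (bdp p \<inter> (A - {e}))" using that True by auto
      then show ?thesis using assms(1) by simp
    qed
    then have "{p \<in> PL. e \<in> bdp p \<and> odd (card (bdp p \<inter> (A - {e})))} = cob e - (cb A \<inter> cob e)"
      by (auto simp: lat.dd_def cob_def)
    then show ?thesis using True fin card_cob[OF assms(2)] by (simp add: lat.upl_def card_Diff_subset)
  qed
qed

lemma near_cmp: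
  assumes "p \<in> cb (A \<inter> K)" "p \<in> cob e"
  shows "\<exists>f\<in>lat.near e. f \<in> K"
proof -
  have "odd (card (bdp p \<inter> (A \<inter> K)))" "p \<in> PL" "e \<in> bdp p" using assms by (auto simp: lat.dd_def cob_def)
  then have "bdp p \<inter> (A \<inter> K) \<noteq> {}" by auto
  then obtain f where "f \<in> bdp p" "f \<in> K" by blast
  then show ?thesis using \<open>p \<in> PL\<close> \<open>e \<in> bdp p\<close> by (auto intro!: bexI[of _ f] lat.mem_near simp: lat.adj_def)
qed

text \<open>Outside \<open>Bd\<close> at most one non-flat cluster touches the plaquettes of
  \<open>e\<close>, and it has at most six frustrated plaquettes, so by \<open>small_cb\<close> its
  coboundary is that of an edge h. If h = e, all six plaquettes of \<open>e\<close> are frustrated,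
  otherwise at most one is, by \<open>card_share\<close>.\<close>

lemma local_struct:
  assumes fin: "finite A" and e: "e \<in> UE" and nb: "\<not> Bd e A B"
  shows "((\<exists>K\<in>lat.cmps (A \<union> B). cb (A \<inter> K) = cob e) \<and> card (cb A \<inter> cob e) = 6) \<or>
    ((\<forall>K\<in>lat.cmps (A \<union> B). cb (A \<inter> K) \<noteq> cob e) \<and> card (cb A \<inter> cob e) \<le> 1)"
proof -
  have dec: "cb A = (\<Union>K\<in>lat.cmps (A \<union> B). cb (A \<inter> K))" by (rule lat.dd_cmps) simp
  have ne: "cob e \<noteq> {}" using card_cob[OF e] by auto
  show ?thesis
  proof (cases "cb A \<inter> cob e = {}")
    case True
    then have "\<forall>K\<in>lat.cmps (A \<union> B). cb (A \<inter> K) \<noteq> cob e" using dec ne by blast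
    then show ?thesis using True by simp
  next
    case False
    then obtain p K where K: "K \<in> lat.cmps (A \<union> B)" "p \<in> cb (A \<inter> K)" "p \<in> cob e" using dec by blast
    obtain f where f: "f \<in> lat.near e" "f \<in> K" using near_cmp[OF K(2,3)] by blast
    have uniq: "L = K" if L: "L \<in> lat.cmps (A \<union> B)" "p' \<in> cb (A \<inter> L)" "p' \<in> cob e" for L p'
    proof (rule ccontr)
      assume "L \<noteq> K"
      moreover obtain g where "g \<in> lat.near e" "g \<in> L" using near_cmp[OF L(2,3)] by blast
      ultimately have "Two e A B" unfolding Two_def using K L f
        by (intro bexI[of _ "(f, g)"] bexI[of _ K] bexI[of _ L]) auto
      then show False using nb by (simp add: Bd_def)
    qed
    have int: "cb A \<inter> cob e = cb (A \<inter> K) \<inter> cob e" using dec uniq K(1) by blast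
    have "\<not> 7 \<le> card (cb (A \<inter> K))" using nb f K(1) by (auto simp: Bd_def Hit_def)
    then obtain h where h: "h \<in> UE" "cb (A \<inter> K) = cob h" using small_cb[of "A \<inter> K"] fin K(2) by force
    show ?thesis
    proof (cases "h = e")
      case True
      then show ?thesis using h K int card_cob[OF e] by auto
    next
      case False
      have "cb (A \<inter> L) \<noteq> cob e" if L: "L \<in> lat.cmps (A \<union> B)" for L
      proof
        assume eq: "cb (A \<inter> L) = cob e"
        then have "L = K" using uniq[OF L K(3)[folded eq] K(3)] by simp
        then have "cob h = cob e" using eq h by simp
        then show False using cob_inj[OF h(1)] False by blast
      qed
      then show ?thesis using card_share[OF False] int h by auto
    qed
  qed
qed

text \<open>The sign of \<open>theta x y u\<close> for u \<le> 6, see \<open>th_sign\<close>.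
  \<open>Q\<close> and \<open>F\<close> are the sign, corner spins included, and the modulus of the
  resampled Wilson loop.\<close>

definition s :: "nat \<Rightarrow> real" where "s u = (if u \<le> 3 then 1 else - 1)"

definition Q :: "uedge set \<Rightarrow> real" where
  "Q A = (- 1) ^ card (A \<inter> Gc) * (\<Prod>e\<in>G1. s (lat.upl e A))"

definition F :: "uedge set \<Rightarrow> real" where
  "F A = (\<Prod>e\<in>G1. \<bar>lat.theta x y (lat.upl e A)\<bar>)"

lemma finG: "finite G1" "finite Gc"
  using \<Lambda>(1) G(1) finite_subset by blast+

lemma G_UE: "e \<in> G1 \<Longrightarrow> e \<in> UE" "e \<in> Gc \<Longrightarrow> e \<in> UE"
  using \<Lambda>(2) G(1) by auto

text \<open>A majority vote of the plaquettes at \<open>e\<close>: \<open>s\<close> recovers the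
  spin that \<open>e\<close> has in the flat background, so the product is -1 when \<open>e\<close>
  is flipped against it.\<close>

lemma s_upl:
  assumes "finite A" "e \<in> UE" "\<not> Bd e A B"
  shows "s (lat.upl e A) * sgn_in (e \<in> A) = sgn_in (\<exists>K\<in>lat.cmps (A \<union> B). cb (A \<inter> K) = cob e)"
  using local_struct[OF assms] unfolding upl_eq[OF assms(1,2)] s_def by auto

lemma prod_sgn_in: "finite X \<Longrightarrow> (\<Prod>e\<in>X. sgn_in (R e)) = (- 1) ^ card {e\<in>X. R e}"
  by (simp add: prod.If_cases Int_def)

text \<open>A flat cluster meets the loop evenly. A non-flat one that matters has coboundary
  \<open>cob f\<close> for an edge f that is no corner edge. Toggling f makes it flat, so it meets
  the loop oddly exactly if f lies on the loop, and then f is the one edge counted by the second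
  term.\<close>

lemma cluster_even:
  assumes AB: "A \<subseteq> \<Lambda>" "B \<subseteq> \<Lambda>" and K: "K \<in> lat.cmps (A \<union> B)"
    and nb: "\<And>e. e \<in> G1 \<Longrightarrow> \<not> Bd e A B" and nn: "\<And>e. e \<in> Gc \<Longrightarrow> \<not> NearE e A B"
  shows "even (card (A \<inter> K \<inter> (G1 \<union> Gc)) + card {e\<in>G1. cb (A \<inter> K) = cob e})"
proof -
  let ?a = "A \<inter> K" and ?G = "G1 \<union> Gc"
  let ?J = "{e\<in>G1. cb ?a = cob e}"
  have fina: "finite ?a" using AB \<Lambda>(1) finite_subset by blast
  have ne: "cob e \<noteq> {}" if "e \<in> G1" for e using card_cob[OF G_UE(1)[OF that]] by auto
  show ?thesis
  proof (cases "cb ?a = {}")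
    case True
    then have "?J = {}" using ne by auto
    then have "card ?J = 0" by (simp only: card.empty)
    then show ?thesis using parity[OF fina True] by (simp only: add_0_right)
  next
    case nonflat: False
    show ?thesis
    proof (cases "?a \<inter> ?G = {} \<and> ?J = {}")
      case True
      then show ?thesis by (metis add_0 card.empty even_zero)
    next
      case False
      then obtain e where e: "e \<in> ?G" "e \<in> ?a \<or> cb ?a = cob e" by blast
      have "\<exists>f\<in>lat.near e. f \<in> K"
        using e(2)
      proof
        assume "cb ?a = cob e"
        then show ?thesis using nonflat near_cmp[of _ A K e] by blast
      next
        assume "e \<in> ?a"
        then show ?thesis using lat.near_refl[of e] by blast
      qed
      then obtain g where g: "g \<in> lat.near e" "g \<in> K" by blast
      then have "NearE e A B" using K nonflat by (auto simp: NearE_def)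
      then have "e \<in> G1" using nn e(1) by blast
      then have "\<not> 7 \<le> card (cb ?a)" using nb[of e] g K by (auto simp: Bd_def Hit_def)
      then obtain f where f: "f \<in> UE" "cb ?a = cob f" using small_cb[OF fina nonflat] by force
      have "f \<notin> Gc"
      proof
        assume "f \<in> Gc"
        obtain p where p: "p \<in> cb ?a" using nonflat by blast
        then obtain g where "g \<in> lat.near f" "g \<in> K" using near_cmp[OF p, of f] f(2) by blast
        then have "NearE f A B" using K nonflat by (auto simp: NearE_def)
        then show False using nn \<open>f \<in> Gc\<close> by blast
      qed
      have J: "?J = (if f \<in> ?G then {f} else {})"
        using cob_inj[OF f(1)] f(2) \<open>f \<notin> Gc\<close> by auto
      let ?b = "if f \<in> ?a then ?a - {f} else insert f ?a"
      have "cb ?b = {}" unfolding cb_toggle[OF fina] using f(2) by blast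
      then have ev: "even (card (?b \<inter> ?G))" using parity[of ?b] fina by auto
      have "?b = (?a - {f}) \<union> ({f} - ?a)" by auto
      then have "odd (card (?G \<inter> ?a)) = odd (card (?G \<inter> {f}))"
        using odd_card_symdiff[of ?G ?a "{f}"] ev \<Lambda>(1) G(1) finite_subset[of ?G \<Lambda>] by (simp add: Int_commute)
      then have "odd (card (?a \<inter> ?G)) \<longleftrightarrow> f \<in> ?G" by (cases "f \<in> ?G") (simp_all add: Int_commute)
      then show ?thesis unfolding J by (cases "f \<in> G1"; cases "f \<in> Gc"; simp)
    qed
  qed
qed

text \<open>By \<open>s_upl\<close> the signs and the spins on \<open>G1\<close> multiply to
  (-1)^|J|, J being the set of flipped edges. Summing \<open>cluster_even\<close> over the clusters
  shows that |J| has the parity of \<open>A\<close> on the whole loop, so all spins cancel.\<close>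

lemma Q_eq_1:
  assumes AB: "A \<subseteq> \<Lambda>" "B \<subseteq> \<Lambda>"
    and nb: "\<And>e. e \<in> G1 \<Longrightarrow> \<not> Bd e A B" and nn: "\<And>e. e \<in> Gc \<Longrightarrow> \<not> NearE e A B"
  shows "Q A = 1"
proof -
  let ?C = "lat.cmps (A \<union> B)" and ?G = "G1 \<union> Gc"
  have finA: "finite A" "finite (A \<union> B)" using AB \<Lambda>(1) finite_subset by auto
  have finC: "finite ?C" by (rule lat.finite_cmps[OF finA(2)])
  let ?J = "\<lambda>K. {e\<in>G1. cb (A \<inter> K) = cob e}"
  define J where "J = {e\<in>G1. \<exists>K\<in>?C. cb (A \<inter> K) = cob e}"
  have "(\<Prod>e\<in>G1. s (lat.upl e A)) * (\<Prod>e\<in>G1. sgn_in (e \<in> A)) = (\<Prod>e\<in>G1. sgn_in (\<exists>K\<in>?C. cb (A \<inter> K) = cob e))"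
    unfolding prod.distrib[symmetric]
    by (rule prod.cong) (use s_upl[OF finA(1) G_UE(1) nb] in auto)
  then have prods: "(\<Prod>e\<in>G1. s (lat.upl e A)) * (- 1) ^ card (A \<inter> G1) = (- 1) ^ card J"
    unfolding prod_sgn_in[OF finG(1)] J_def by (simp add: Int_def conj_commute)
  have "card (A \<inter> ?G) = card (A \<inter> G1) + card (A \<inter> Gc)"
    unfolding Int_Un_distrib using finA G(2) by (intro card_Un_disjoint) auto
  moreover have "even (card (A \<inter> ?G) + card J)"
  proof -
    have "A \<inter> ?G = (\<Union>K\<in>?C. A \<inter> K \<inter> ?G)" using lat.Union_cmps[of "A \<union> B"] by blast
    then have 1: "card (A \<inter> ?G) = (\<Sum>K\<in>?C. card (A \<inter> K \<inter> ?G))"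
      using finA finC lat.cmps_disjoint[of _ "A \<union> B"] by (simp only:) (rule card_UN_disjoint, auto)
    have disjJ: "?J K \<inter> ?J L = {}" if KL: "K \<in> ?C" "L \<in> ?C" "K \<noteq> L" for K L
    proof (rule ccontr)
      assume "?J K \<inter> ?J L \<noteq> {}"
      then obtain e where e: "e \<in> G1" "cb (A \<inter> K) = cob e" "cb (A \<inter> L) = cob e" by auto
      have "cob e \<noteq> {}" using card_cob[OF G_UE(1)[OF e(1)]] by auto
      then obtain p where p: "p \<in> cb (A \<inter> K)" "p \<in> cb (A \<inter> L)" using e by auto
      have "bdp p \<inter> (A \<inter> K) \<noteq> {}" "bdp p \<inter> (A \<inter> L) \<noteq> {}" "p \<in> PL" using p by (auto simp: lat.dd_def)
      then obtain f g where "f \<in> bdp p" "f \<in> K" "g \<in> bdp p" "g \<in> L" by blast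
      then show False using lat.cmps_adj_eq[OF KL(1,2), of f g] KL(3) \<open>p \<in> PL\<close> by (auto simp: lat.adj_def)
    qed
    have "J = (\<Union>K\<in>?C. ?J K)" by (auto simp: J_def)
    then have 2: "card J = (\<Sum>K\<in>?C. card (?J K))"
      using finC finG disjJ by (simp only:) (rule card_UN_disjoint, auto)
    have "even (\<Sum>K\<in>?C. card (A \<inter> K \<inter> ?G) + card (?J K))"
      by (rule dvd_sum) (use cluster_even[OF AB _ nb nn] in auto)
    then show ?thesis unfolding 1 2 by (simp add: sum.distrib)
  qed
  ultimately have par: "even (card (A \<inter> G1) + card (A \<inter> Gc) + card J)" by simp
  have "Q A * (- 1) ^ card (A \<inter> G1) = (- 1) ^ card (A \<inter> Gc) * (- 1) ^ card J"
    unfolding Q_def prods[symmetric] by (simp add: mult_ac)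
  then show ?thesis using par by (auto simp: minus_one_power_iff split: if_splits)
qed

end

context main_est
begin

subsection \<open>Effective edge weights\<close>

text \<open>\<open>rt 4\<close> is x / y^2, so this puts the ratio at or above 1 from u = 4
  on.\<close>

lemma y2_le: "y\<^sup>2 \<le> x"
proof -
  have "(y\<^sup>2)\<^sup>2 \<le> y ^ 3" using power_decreasing[of 3 4 y] y by simp
  then have "(y\<^sup>2)\<^sup>2 \<le> x\<^sup>2" using yx by (rule order_trans)
  then show ?thesis by (rule power2_le_imp_le) (rule less_imp_le[OF x(1)])
qed

lemma y7: "y ^ 7 = y * y ^ 6"
  by (simp add: numeral_eq_Suc)

lemma y5_le: "y ^ 5 \<le> x ^ 3"
proof -
  have "(y ^ 5)\<^sup>2 \<le> (y ^ 3) ^ 3" using power_decreasing[of 9 10 y] y by simp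
  also have "\<dots> \<le> (x\<^sup>2) ^ 3" by (rule power_mono[OF yx]) (use y in simp)
  also have "\<dots> = (x ^ 3)\<^sup>2" by simp
  finally show ?thesis by (rule power2_le_imp_le) (use x(1) in simp)
qed

abbreviation "rt \<equiv> lat.ratio x y"
abbreviation "th \<equiv> lat.theta x y"

lemma rt_pos: "0 < rt u"
  using x y by (simp add: lat.ratio_def)

lemma rt_small:
  assumes "u \<le> 3" shows "x * y ^ 6 \<le> rt u" "rt u \<le> 1"
proof -
  have "y ^ 6 \<le> y ^ (2 * u)" using assms y by (intro power_decreasing) auto
  moreover have y1: "y ^ (2 * u) \<le> 1" by (rule power_le_one) (use y in auto)
  moreover have "0 < y ^ (2 * u)" using y by simp
  moreover have "x * y ^ 6 \<le> 1 * y ^ 6" using x_le1 y by (intro mult_right_mono) auto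
  moreover have "x * y ^ 6 * y ^ (2 * u) \<le> x * y ^ 6 * 1" by (rule mult_left_mono[OF y1]) (use x y in auto)
  ultimately show "x * y ^ 6 \<le> rt u" "rt u \<le> 1"
    by (simp_all add: lat.ratio_def pos_le_divide_eq pos_divide_le_eq)
qed

lemma rt_large:
  assumes "4 \<le> u" "u \<le> 6" shows "1 \<le> rt u" "x * y ^ 6 \<le> 1 / rt u"
proof -
  have p: "y ^ (2 * u) \<le> y ^ 8" "y ^ 12 \<le> y ^ (2 * u)" "0 < y ^ (2 * u)"
    using assms y by (auto intro: power_decreasing)
  have "y ^ 8 = y\<^sup>2 * y ^ 6" by simp
  also have "\<dots> \<le> x * y ^ 6" using y2_le y by (intro mult_right_mono) auto
  finally show "1 \<le> rt u" using p y by (simp add: lat.ratio_def pos_le_divide_eq)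
  have "(x * y ^ 6) * (x * y ^ 6) \<le> 1 * y ^ 6 * (1 * y ^ 6)"
    using x_le1 x y by (intro mult_mono) auto
  also have "\<dots> = y ^ 12" by simp
  finally show "x * y ^ 6 \<le> 1 / rt u" using p x y by (simp add: lat.ratio_def pos_le_divide_eq)
qed

lemma th_small: "u \<le> 3 \<Longrightarrow> \<bar>th u\<bar> = th u \<and> th u \<le> 1 - rt u \<and> 1 - 2 * rt u \<le> th u"
  using rt_small[of u] rt_pos[of u] by (auto simp: lat.theta_def field_simps)

lemma th_large:
  assumes "4 \<le> u" "u \<le> 6"
  shows "\<bar>th u\<bar> = - th u \<and> - th u = (1 - 1 / rt u) / (1 + 1 / rt u) \<and> - th u \<le> 1 - 1 / rt u \<and> 1 - 2 * (1 / rt u) \<le> - th u"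
proof -
  define r where "r = 1 / rt u"
  have r: "0 < r" "r \<le> 1" "rt u = 1 / r" using rt_large[OF assms] rt_pos[of u] by (auto simp: r_def)
  have "1 - 1 / r = (r - 1) / r" "1 + 1 / r = (r + 1) / r" using r(1) by (simp_all add: field_simps)
  then have "th u = (r - 1) / (r + 1)" unfolding lat.theta_def r(3) using r(1) by simp
  then have "- th u = (1 - r) / (1 + r)" by (simp add: minus_divide_left add.commute)
  moreover have "0 \<le> (1 - r) / (1 + r)" "(1 - r) / (1 + r) \<le> 1 - r" "1 - 2 * r \<le> (1 - r) / (1 + r)"
    using r by (auto simp: field_simps)
  ultimately show ?thesis unfolding r_def[symmetric] by auto
qed

lemma th_sign: "u \<le> 6 \<Longrightarrow> th u = s u * \<bar>th u\<bar>"
proof (cases "u \<le> 3")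
  case True
  then show ?thesis using th_small[of u] by (simp add: s_def)
next
  case False
  moreover assume "u \<le> 6"
  ultimately have "\<bar>th u\<bar> = - th u" using th_large[of u] by linarith
  then show ?thesis using False by (simp only: s_def if_False)
qed

lemma th_abs_le: "u \<le> 6 \<Longrightarrow> \<bar>th u\<bar> \<le> 1 - x * y ^ 6"
  using th_small[of u] th_large[of u] rt_small[of u] rt_large[of u] by (cases "u \<le> 3") auto

lemma xy_pos: "0 < x * y ^ 6"
  using x y by simp

lemma upl_le: "e \<in> UE \<Longrightarrow> lat.upl e A \<le> 6"
proof -
  assume "e \<in> UE"
  have "lat.upl e A \<le> card (cob e)" unfolding lat.upl_def by (rule card_mono[OF finite_cob]) (auto simp: cob_def)
  then show ?thesis using card_cob[OF \<open>e \<in> UE\<close>] by simp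
qed

lemma F_bounds: "0 \<le> F A" "F A \<le> (1 - x * y ^ 6) ^ card G1"
proof -
  show "0 \<le> F A" by (simp add: F_def prod_nonneg)
  have "F A \<le> (\<Prod>e\<in>G1. 1 - x * y ^ 6)"
    unfolding F_def by (rule prod_mono) (use th_abs_le upl_le G_UE in auto)
  then show "F A \<le> (1 - x * y ^ 6) ^ card G1" by simp
qed

lemma F_le1: "F A \<le> 1"
proof -
  have "\<bar>th (lat.upl e A)\<bar> \<le> 1" if "e \<in> G1" for e
    using th_abs_le[OF upl_le[OF G_UE(1)[OF that]], of A] xy_pos by linarith
  then show ?thesis unfolding F_def by (intro prod_le_1) auto
qed

lemma s_abs: "\<bar>s u\<bar> = 1"
  by (simp add: s_def)

lemma Q_abs: "\<bar>Q A\<bar> = 1"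
  by (simp add: Q_def abs_mult abs_prod s_abs power_abs)

abbreviation "GG \<equiv> G1 \<union> Gc"

lemma wilson_eq: "lat.Ex x y PL \<Lambda> (\<lambda>A. (- 1) ^ card (A \<inter> GG)) = S.PE (\<lambda>A B. Q A * F A)"
proof -
  let ?c = "\<lambda>A. (- 1 :: real) ^ card (A \<inter> Gc)"
  have "(\<Sum>A\<in>Pow \<Lambda>. S.w1 A * (- 1) ^ card (A \<inter> GG)) = (\<Sum>A\<in>Pow \<Lambda>. S.w1 A * (?c A * (\<Prod>e\<in>G1. sgn_in (e \<in> A))))"
  proof (rule sum.cong)
    fix A assume "A \<in> Pow \<Lambda>"
    then have "finite A" using \<Lambda>(1) finite_subset by auto
    then have "card (A \<inter> GG) = card (A \<inter> G1) + card (A \<inter> Gc)"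
      unfolding Int_Un_distrib using G(2) by (intro card_Un_disjoint) auto
    moreover have "{e \<in> G1. e \<in> A} = A \<inter> G1" by auto
    ultimately show "S.w1 A * (- 1) ^ card (A \<inter> GG) = S.w1 A * (?c A * (\<Prod>e\<in>G1. sgn_in (e \<in> A)))"
      by (simp add: prod_sgn_in[OF finG(1)] power_add mult_ac)
  qed simp
  also have "\<dots> = (\<Sum>A\<in>Pow \<Lambda>. S.w1 A * (?c A * (\<Prod>e\<in>G1. th (lat.upl e A))))"
  proof (rule lat.sum_flip_all)
    show "card {p \<in> PL. e \<in> bdp p} = 6" if "e \<in> G1" for e
      using card_cob[OF G_UE(1)[OF that]] by (simp add: cob_def)
    show "?c (insert e A) = ?c A" if "e \<in> G1" for e A
    proof -
      have "e \<notin> Gc" using that G(2) by blast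
      then show ?thesis by simp
    qed
  qed (use \<Lambda> x y finG G isol in auto)
  also have "\<dots> = (\<Sum>A\<in>Pow \<Lambda>. S.w1 A * (Q A * F A))"
  proof (rule sum.cong)
    fix A
    have "(\<Prod>e\<in>G1. th (lat.upl e A)) = (\<Prod>e\<in>G1. s (lat.upl e A) * \<bar>th (lat.upl e A)\<bar>)"
      by (rule prod.cong) (use th_sign upl_le G_UE in auto)
    then show "S.w1 A * (?c A * (\<Prod>e\<in>G1. th (lat.upl e A))) = S.w1 A * (Q A * F A)"
      by (simp add: Q_def F_def prod.distrib mult_ac)
  qed simp
  finally show ?thesis unfolding S.PE_fst_Ex lat.Ex_def by simp
qed

text \<open>The relative weight of flipping an edge of the loop over a flat background in which its spin is \<open>b\<close>.\<close>
definition gw :: "bool \<Rightarrow> real" where "gw b = (if b then y ^ 6 / x else x * y ^ 6)"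

text \<open>The integrand of \<open>Upsilon\<close> as a product over edges, see
  \<open>psi_prod\<close> and \<open>Upsilon_integrand\<close>.\<close>

definition Psi :: "uedge set \<Rightarrow> real" where
  "Psi B = (\<Prod>e\<in>GG. exp (- 2 * gw (e \<in> B)))"

definition good :: "uedge set \<Rightarrow> uedge set \<Rightarrow> bool" where
  "good a b \<longleftrightarrow> cb a = {} \<and> cb b = {}"

lemma good_sym: "good a b = good b a"
  by (auto simp: good_def)

lemma swapU_flat: "cb (A \<inter> S.swapU good A B) = {}" "cb (B \<inter> S.swapU good A B) = {}"
proof -
  let ?U = "S.swapU good A B"
  have *: "cb (C \<inter> ?U) = {}" if C: "C = A \<or> C = B" for C
  proof (rule ccontr)
    assume "cb (C \<inter> ?U) \<noteq> {}"
    then obtain p where p: "p \<in> PL" "odd (card (bdp p \<inter> (C \<inter> ?U)))" by (auto simp: lat.dd_def)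
    have "C \<inter> ?U \<subseteq> A \<union> B" using C by auto
    then obtain K where K: "K \<in> lat.cmps (A \<union> B)" "odd (card (bdp p \<inter> (C \<inter> ?U \<inter> K)))"
      using lat.odd_dd_cmps[OF _ p] by blast
    then have "C \<inter> ?U \<inter> K \<noteq> {}" by auto
    then obtain e where "e \<in> ?U" "e \<in> K" by blast
    then have g: "good (A \<inter> K) (B \<inter> K)" using S.swapU_iff[OF K(1)] by blast
    then have "K \<subseteq> ?U" using S.swapU_iff[OF K(1)] by blast
    then have "C \<inter> ?U \<inter> K = C \<inter> K" by blast
    then have "p \<in> cb (C \<inter> K)" using K(2) p(1) by (simp add: lat.dd_def)
    then show False using g C by (auto simp: good_def)
  qed
  show "cb (A \<inter> ?U) = {}" "cb (B \<inter> ?U) = {}" using * by blast+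
qed

text \<open>On flat sets both weights reduce to a power of \<open>x\<close>, so the clusters
  selected by \<open>good\<close> may be exchanged.\<close>

lemma PE_swap_good: "S.PE h = S.PE (\<lambda>A B. h (S.swap good A B) (S.swap good B A))"
proof (rule S.PE_swap[OF good_sym])
  fix A B assume "A \<subseteq> \<Lambda>" "B \<subseteq> \<Lambda>"
  then show "A \<inter> S.swapU good A B \<subseteq> \<Lambda> \<and> B \<inter> S.swapU good A B \<subseteq> \<Lambda> \<and>
      S.w1 (A \<inter> S.swapU good A B) * S.w2 (B \<inter> S.swapU good A B) =
      S.w1 (B \<inter> S.swapU good A B) * S.w2 (A \<inter> S.swapU good A B)"
    using swapU_flat(1)[of A B] swapU_flat(2)[of B A] by (simp add: lat.wt_def le_infI1)
qed

lemma w2_flat: "B \<subseteq> \<Lambda> \<Longrightarrow> S.w2 B \<noteq> 0 \<Longrightarrow> cb B = {}"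
  using lat.wt_zero[OF lat.finite_dd[of B PL]] \<Lambda>(1) finite_subset[of B \<Lambda>] by (auto split: if_splits)

text \<open>As \<open>B\<close> is flat, the cluster of \<open>e\<close> is exchanged unless its
  part in \<open>A\<close> is not flat. So \<open>swap good B A\<close>, which has the law of
  \<open>B\<close>, agrees with \<open>A\<close> at typical edges.\<close>

lemma near_agree:
  assumes AB: "A \<subseteq> \<Lambda>" "B \<subseteq> \<Lambda>" and flat: "cb B = {}" and nn: "\<not> NearE e A B"
  shows "e \<in> S.swap good B A \<longleftrightarrow> e \<in> A"
proof -
  have c: "S.swapU good B A = S.swapU good A B" by (rule S.swapU_commute[OF good_sym])
  show ?thesis
  proof (cases "e \<in> A \<union> B")
    case True
    then obtain K where K: "K \<in> lat.cmps (A \<union> B)" "e \<in> K" using lat.Union_cmps[of "A \<union> B"] by blast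
    have "cb (A \<inter> K) = {}" using nn K lat.near_refl[of e] by (auto simp: NearE_def)
    moreover have "cb (B \<inter> K) = {}" using lat.dd_cmps[of B "A \<union> B"] flat K(1) by blast
    ultimately have "e \<in> S.swapU good A B" using S.swapU_iff[OF K] by (simp add: good_def)
    then show ?thesis unfolding S.swap_def c by blast
  qed (auto simp: S.swap_def c)
qed

lemma near_card0:
  assumes "\<not> NearE e A B" shows "cb A \<inter> cob e = {}"
proof (rule ccontr)
  assume "cb A \<inter> cob e \<noteq> {}"
  moreover have "cb A = (\<Union>K\<in>lat.cmps (A \<union> B). cb (A \<inter> K))" by (rule lat.dd_cmps) simp
  ultimately obtain p K where K: "K \<in> lat.cmps (A \<union> B)" "p \<in> cb (A \<inter> K)" "p \<in> cob e" by blast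
  then obtain f where "f \<in> lat.near e" "f \<in> K" using near_cmp[OF K(2,3)] by blast
  then show False using assms K by (auto simp: NearE_def)
qed

lemma y6x: "0 < y ^ 6 / x" "y ^ 6 / x \<le> y ^ 4" "y ^ 4 / x \<le> y"
proof -
  show "0 < y ^ 6 / x" using x y by simp
  have "y ^ 6 = y\<^sup>2 * y ^ 4" by simp
  also have "\<dots> \<le> x * y ^ 4" using y2_le y by (intro mult_right_mono) auto
  finally show "y ^ 6 / x \<le> y ^ 4" using x by (simp add: divide_simps mult.commute)
  have "y ^ 4 = y\<^sup>2 * y\<^sup>2" by simp
  also have "\<dots> \<le> x * y"
    using y2_le y power_decreasing[of 1 2 y] x by (intro mult_mono) auto
  finally show "y ^ 4 / x \<le> y" using x by (simp add: divide_simps mult.commute)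
qed

lemma gw_bounds: "0 < gw b" "x * y ^ 6 \<le> gw b" "gw b \<le> y" "gw b \<le> 1"
proof -
  have "x * y ^ 6 \<le> 1 * y ^ 6" using x_le1 y by (intro mult_right_mono) auto
  moreover have "y ^ 6 \<le> y ^ 1" "y ^ 4 \<le> y ^ 1" using y by (intro power_decreasing; simp)+
  moreover have "x * y ^ 6 \<le> y ^ 6 / x"
  proof -
    have "x * x \<le> 1" using x_le1 x mult_le_one[of x x] by simp
    then have "x * x * y ^ 6 \<le> 1 * y ^ 6" using y by (intro mult_right_mono) auto
    then show ?thesis using x by (simp add: pos_le_divide_eq mult_ac)
  qed
  ultimately show "0 < gw b" "x * y ^ 6 \<le> gw b" "gw b \<le> y" "gw b \<le> 1"
    using y6x xy_pos y by (auto simp: gw_def)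
qed

text \<open>Without \<open>NearE\<close>, \<open>A\<close> is flat around \<open>e\<close>:
  \<open>upl\<close> is 0 or 6, the ratio or its inverse equals \<open>gw\<close> at the coupled
  configuration, and the error is quadratic. Under \<open>NearE\<close> without \<open>Bd\<close>
  both terms lie in [1 - 2 y, 1]; under \<open>Bd\<close> only [0, 1] is used.\<close>

lemma edge_diff:
  assumes AB: "A \<subseteq> \<Lambda>" "B \<subseteq> \<Lambda>" and flat: "cb B = {}" and e: "e \<in> G1"
  shows "\<bar>\<bar>th (lat.upl e A)\<bar> - exp (- 2 * gw (e \<in> S.swap good B A))\<bar>
    \<le> 2 * (x * y ^ 6)\<^sup>2 + 2 * (y ^ 6 / x)\<^sup>2 + 2 * y * of_bool (NearE e A B) + of_bool (Bd e A B)"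
proof -
  let ?a = "\<bar>th (lat.upl e A)\<bar>" and ?b = "exp (- 2 * gw (e \<in> S.swap good B A))"
  have finA: "finite A" using AB \<Lambda>(1) finite_subset by blast
  have eU: "e \<in> UE" by (rule G_UE(1)[OF e])
  have a: "0 \<le> ?a" "?a \<le> 1" using th_abs_le[OF upl_le[OF eU], of A] xy_pos by linarith+
  have b: "0 \<le> ?b" "?b \<le> 1" using gw_bounds(1)[of "e \<in> S.swap good B A"] by auto
  have b2: "1 - 2 * y \<le> ?b"
    using exp_ge_add_one_self[of "- 2 * gw (e \<in> S.swap good B A)"] gw_bounds(3)[of "e \<in> S.swap good B A"] by linarith
  show ?thesis
  proof (cases "Bd e A B")
    case True
    have "\<bar>?a - ?b\<bar> \<le> 1" using a b by linarith
    also have "1 \<le> 2 * (x * y ^ 6)\<^sup>2 + 2 * (y ^ 6 / x)\<^sup>2 + 2 * y * of_bool (NearE e A B) + of_bool (Bd e A B)"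
      using True y by (simp add: add_nonneg_nonneg)
    finally show ?thesis .
  next
    case nb: False
    show ?thesis
    proof (cases "NearE e A B")
      case True
      have "card (cb A \<inter> cob e) = 6 \<or> card (cb A \<inter> cob e) = 0 \<or> card (cb A \<inter> cob e) = 1"
        using local_struct[OF finA eU nb] by linarith
      then have "lat.upl e A = 0 \<or> lat.upl e A = 1 \<or> lat.upl e A = 5 \<or> lat.upl e A = 6"
        unfolding upl_eq[OF finA eU] by auto
      moreover have "1 - 2 * y \<le> \<bar>th 0\<bar>" "1 - 2 * y \<le> \<bar>th 1\<bar>" "1 - 2 * y \<le> \<bar>th 5\<bar>" "1 - 2 * y \<le> \<bar>th 6\<bar>"
      proof -
        have p: "x * y ^ 6 \<le> 1 * y ^ 1" "x * y ^ 4 \<le> 1 * y ^ 1"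
          using x_le1 x y by (intro mult_mono power_decreasing; simp)+
        have "y ^ 6 / y\<^sup>2 = y ^ 4" "y ^ 10 / y ^ 6 = y ^ 4" "y ^ 12 / y ^ 6 = y ^ 6"
          using y by (simp_all add: divide_eq_eq)
        moreover have "rt 0 = x * y ^ 6" "rt 1 = x * (y ^ 6 / y\<^sup>2)" "1 / rt 5 = y ^ 10 / y ^ 6 / x" "1 / rt 6 = y ^ 12 / y ^ 6 / x"
          by (simp_all add: lat.ratio_def mult.commute)
        ultimately have r: "rt 0 = x * y ^ 6" "rt 1 = x * y ^ 4" "1 / rt 5 = y ^ 4 / x" "1 / rt 6 = y ^ 6 / x"
          by metis+
        have "y ^ 6 / x \<le> y" using y6x(2) power_decreasing[of 1 4 y] y by simp
        then show "1 - 2 * y \<le> \<bar>th 0\<bar>" "1 - 2 * y \<le> \<bar>th 1\<bar>" "1 - 2 * y \<le> \<bar>th 5\<bar>" "1 - 2 * y \<le> \<bar>th 6\<bar>"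
          using th_small[of 0] th_small[of 1] th_large[of 5] th_large[of 6] p y6x(3) unfolding r by auto
      qed
      ultimately have a2: "1 - 2 * y \<le> ?a" by auto
      have "\<bar>?a - ?b\<bar> \<le> 2 * y" using a b a2 b2 by linarith
      also have "2 * y \<le> 2 * (x * y ^ 6)\<^sup>2 + 2 * (y ^ 6 / x)\<^sup>2 + 2 * y" by simp
      finally show ?thesis using nb True by simp
    next
      case False
      have "cb A \<inter> cob e = {}" by (rule near_card0[OF False])
      then have u: "lat.upl e A = (if e \<in> A then 6 else 0)" by (simp add: upl_eq[OF finA eU])
      have agree: "e \<in> S.swap good B A \<longleftrightarrow> e \<in> A" by (rule near_agree[OF AB flat False])
      have "?a = (1 - gw (e \<in> A)) / (1 + gw (e \<in> A))"
      proof (cases "e \<in> A")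
        case True
        have "1 / rt 6 = y ^ 6 / x" using x y by (simp add: lat.ratio_def field_simps)
        then show ?thesis using th_large[of 6] True u by (simp add: gw_def)
      next
        case False
        have "rt 0 = x * y ^ 6" by (simp add: lat.ratio_def)
        then have "th 0 = (1 - gw (e \<in> A)) / (1 + gw (e \<in> A))" using False by (simp add: gw_def lat.theta_def)
        moreover have "?a = th 0" using th_small[of 0] False u by simp
        ultimately show ?thesis by simp
      qed
      then have "\<bar>?a - ?b\<bar> \<le> 2 * (gw (e \<in> A))\<^sup>2"
        using half_ratio_exp_diff[of "gw (e \<in> A)"] gw_bounds[of "e \<in> A"] by (simp add: agree)
      also have "\<dots> \<le> 2 * (x * y ^ 6)\<^sup>2 + 2 * (y ^ 6 / x)\<^sup>2" by (simp add: gw_def)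
      finally show ?thesis using nb False by simp
    qed
  qed
qed

text \<open>The 4 collects the two quadratic errors, 2 \<open>c1\<close> comes from
  \<open>NearE\<close> and \<open>c1 + c1\<^sup>2\<close> from \<open>Bd\<close>.\<close>

definition C2 where "C2 = 4 + 3 * c1 + c1\<^sup>2"
definition C3 where "C3 = 2 + 5832 * K0"

lemma c1_pos: "0 < c1" using K0_pos by (simp add: c1_def)

lemma PE_edge_diff:
  assumes e: "e \<in> G1"
  shows "S.PE (\<lambda>A B. \<bar>\<bar>th (lat.upl e A)\<bar> - exp (- 2 * gw (e \<in> S.swap good B A))\<bar>) \<le> C2 * (x * y ^ 7)"
proof -
  let ?c = "2 * (x * y ^ 6)\<^sup>2 + 2 * (y ^ 6 / x)\<^sup>2"
  have "S.PE (\<lambda>A B. \<bar>\<bar>th (lat.upl e A)\<bar> - exp (- 2 * gw (e \<in> S.swap good B A))\<bar>)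
    \<le> S.PE (\<lambda>A B. ?c + (2 * y * of_bool (NearE e A B) + of_bool (Bd e A B)))"
  proof (rule S.PE_mono)
    fix A B assume "A \<subseteq> \<Lambda>" "B \<subseteq> \<Lambda>" "S.w2 B \<noteq> 0"
    then show "\<bar>\<bar>th (lat.upl e A)\<bar> - exp (- 2 * gw (e \<in> S.swap good B A))\<bar>
      \<le> ?c + (2 * y * of_bool (NearE e A B) + of_bool (Bd e A B))"
      using edge_diff[OF _ _ w2_flat e, of A B] by (simp add: add.assoc)
  qed
  also have "\<dots> = ?c + (2 * y * S.Pr (NearE e) + S.Pr (Bd e))"
    unfolding S.PE_add S.PE_const S.PE_cmult S.Pr_def ..
  also have "\<dots> \<le> (2 * (x * y ^ 7) + 2 * (x * y ^ 7)) + (2 * y * (c1 * x * y ^ 6) + (c1 + c1\<^sup>2) * x * y ^ 7)"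
  proof (intro add_mono mult_left_mono Pr_NearE Pr_Bd)
    have "(x * y ^ 6)\<^sup>2 = x * (x * y ^ 12)" by (simp add: power2_eq_square)
    also have "\<dots> \<le> x * (1 * y ^ 7)" using x x_le1 y by (intro mult_left_mono mult_mono power_decreasing) auto
    finally show "(x * y ^ 6)\<^sup>2 \<le> x * y ^ 7" by simp
    \<comment> \<open>The larger quadratic error needs y^5 \<le> x^3, which follows from y^3 \<le>
      x^2 through y^10 \<le> y^9 \<le> x^6.\<close>
    have "y ^ 12 = y ^ 5 * y ^ 7" by simp
    also have "\<dots> \<le> x ^ 3 * y ^ 7" using y5_le y by (intro mult_right_mono) auto
    also have "x ^ 3 * y ^ 7 = (x * y ^ 7) * x\<^sup>2" by (simp add: power2_eq_square power3_eq_cube)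
    finally show "(y ^ 6 / x)\<^sup>2 \<le> x * y ^ 7"
      using x by (simp add: power_divide pos_divide_le_eq)
  qed (use y in auto)
  also have "\<dots> = C2 * (x * y ^ 7)"
    by (simp add: C2_def y7 algebra_simps)
  finally show ?thesis .
qed

lemma single_not_flat: "e \<in> UE \<Longrightarrow> cb {e} \<noteq> {}"
  using cb_toggle[of "{}" e] card_cob[of e] by force

text \<open>A single edge is not flat, so the cluster of an edge of \<open>B\<close> has at least
  two edges. The resulting x^2 pays for the division by x in \<open>gw True\<close>.\<close>

lemma Pr_edge_flat:
  assumes "e \<in> Gc"
  shows "S.Pr (\<lambda>A B. e \<in> B) \<le> 2916 * K0 * x\<^sup>2"
proof -
  have "S.Pr (\<lambda>A B. e \<in> B) \<le> S.Pr (\<lambda>A B. \<exists>K\<in>lat.cmps (A \<union> B). e \<in> K \<and> e \<in> B \<inter> K)"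
  proof (rule S.Pr_mono)
    fix A B assume "e \<in> B"
    then obtain K where "K \<in> lat.cmps (A \<union> B)" "e \<in> K" using lat.Union_cmps[of "A \<union> B"] by blast
    then show "\<exists>K\<in>lat.cmps (A \<union> B). e \<in> K \<and> e \<in> B \<inter> K" using \<open>e \<in> B\<close> by blast
  qed
  also have "\<dots> \<le> (\<Sum>(a,b)\<in>S.clus (\<lambda>a b. e \<in> b) e. S.w1 a * S.w2 b)"
    by (rule S.comp_prob)
  also have "\<dots> \<le> 1 * (S.q * (324 * S.q) ^ 1 / (1 - 324 * S.q))"
  proof (rule S.cluster_sum)
    fix a b assume ab: "a \<subseteq> \<Lambda>" "b \<subseteq> \<Lambda>" "e \<in> b" "S.w1 a * S.w2 b \<noteq> 0"
    have fin: "finite a" "finite b" using ab \<Lambda>(1) finite_subset by blast+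
    have "cb b = {}" using w2_flat[OF ab(2)] ab(4) by simp
    then have "b \<noteq> {e}" using single_not_flat[OF G_UE(2)[OF assms]] by auto
    then obtain f where "f \<in> b" "f \<noteq> e" using ab(3) by blast
    then have "card {e, f} \<le> card (a \<union> b)" using ab(3) fin by (intro card_mono) auto
    then show "Suc 1 \<le> card (a \<union> b) \<and> S.w1 a * S.w2 b \<le> 1 * x ^ (card a + card b)"
      using weight_bound[OF ab(1,2), of 0] \<open>f \<noteq> e\<close> by simp
  qed simp
  also have "\<dots> \<le> 2916 * K0 * x\<^sup>2" using cluster2 by simp
  finally show ?thesis .
qed

text \<open>A corner edge has no \<open>theta\<close>, so its factor is compared with 1. As
  \<open>A\<close> does not enter, the exchange can be undone first.\<close>

lemma PE_corner_diff:
  assumes e: "e \<in> Gc"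
  shows "S.PE (\<lambda>A B. \<bar>1 - exp (- 2 * gw (e \<in> S.swap good B A))\<bar>) \<le> C3 * (x * y ^ 6)"
proof -
  have "S.PE (\<lambda>A B. \<bar>1 - exp (- 2 * gw (e \<in> S.swap good B A))\<bar>) = S.PE (\<lambda>A B. \<bar>1 - exp (- 2 * gw (e \<in> B))\<bar>)"
    by (rule PE_swap_good[of "\<lambda>A B. \<bar>1 - exp (- 2 * gw (e \<in> B))\<bar>", symmetric])
  also have "\<dots> \<le> S.PE (\<lambda>A B. 2 * (x * y ^ 6) + 2 * (y ^ 6 / x) * of_bool (e \<in> B))"
  proof (rule S.PE_mono)
    fix A B :: "uedge set"
    have "\<bar>1 - exp (- 2 * gw (e \<in> B))\<bar> \<le> 2 * gw (e \<in> B)"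
      using exp_ge_add_one_self[of "- 2 * gw (e \<in> B)"] gw_bounds(1)[of "e \<in> B"] by (simp add: abs_le_iff)
    also have "\<dots> \<le> 2 * (x * y ^ 6) + 2 * (y ^ 6 / x) * of_bool (e \<in> B)"
      using xy_pos by (simp add: gw_def)
    finally show "\<bar>1 - exp (- 2 * gw (e \<in> B))\<bar> \<le> 2 * (x * y ^ 6) + 2 * (y ^ 6 / x) * of_bool (e \<in> B)" .
  qed
  also have "\<dots> = 2 * (x * y ^ 6) + 2 * (y ^ 6 / x) * S.Pr (\<lambda>A B. e \<in> B)"
    unfolding S.PE_add S.PE_const S.PE_cmult S.Pr_def ..
  also have "\<dots> \<le> 2 * (x * y ^ 6) + 2 * (y ^ 6 / x) * (2916 * K0 * x\<^sup>2)"
    by (intro add_left_mono mult_left_mono Pr_edge_flat[OF e]) (use y6x in simp)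
  also have "\<dots> = C3 * (x * y ^ 6)" using x by (simp add: C3_def field_simps power2_eq_square)
  finally show ?thesis .
qed

definition C4 where "C4 = 2 * c1 + 2 * c1\<^sup>2 + C2 + C3"

text \<open>\<open>Q\<close> is replaced by 1, at cost 2 on the exceptional event. Then two products
  of factors in [0, 1] are compared by adding up the differences of their factors.\<close>

lemma main_bound:
  "\<bar>lat.Ex x y PL \<Lambda> (\<lambda>A. (- 1) ^ card (A \<inter> GG)) - lat.Ex x 0 PL \<Lambda> Psi\<bar>
    \<le> C4 * (x * y ^ 6) * (real (card GG) * y + real (card Gc))"
proof -
  let ?X = "\<bar>lat.Ex x y PL \<Lambda> (\<lambda>A. (- 1) ^ card (A \<inter> GG)) - lat.Ex x 0 PL \<Lambda> Psi\<bar>"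
  let ?V = "\<lambda>A B. (\<exists>e\<in>G1. Bd e A B) \<or> (\<exists>e\<in>Gc. NearE e A B)"
  let ?b = "\<lambda>e A B. exp (- 2 * gw (e \<in> S.swap good B A))"
  let ?a = "\<lambda>e A. if e \<in> G1 then \<bar>th (lat.upl e A)\<bar> else 1"
  have cG: "real (card G1) \<le> real (card GG)" using finG by (simp add: card_mono)
  have "lat.Ex x 0 PL \<Lambda> Psi = S.PE (\<lambda>A B. Psi (S.swap good B A))"
    using PE_swap_good[of "\<lambda>A B. Psi B"] by (simp add: S.PE_snd_Ex)
  then have "lat.Ex x y PL \<Lambda> (\<lambda>A. (- 1) ^ card (A \<inter> GG)) - lat.Ex x 0 PL \<Lambda> Psi
      = S.PE (\<lambda>A B. Q A * F A - Psi (S.swap good B A))"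
    unfolding S.PE_diff wilson_eq by simp
  then have "?X
      \<le> S.PE (\<lambda>A B. \<bar>Q A * F A - Psi (S.swap good B A)\<bar>)"
    using S.PE_abs by simp
  also have "\<dots> \<le> S.PE (\<lambda>A B. 2 * of_bool (?V A B) + (\<Sum>e\<in>GG. \<bar>?a e A - ?b e A B\<bar>))"
  proof (rule S.PE_mono)
    fix A B assume AB: "A \<subseteq> \<Lambda>" "B \<subseteq> \<Lambda>"
    have "\<bar>Q A * F A - F A\<bar> \<le> 2 * of_bool (?V A B)"
    proof (cases "?V A B")
      case True
      have "\<bar>Q A * F A\<bar> = F A" using F_bounds(1)[of A] by (simp add: abs_mult Q_abs)
      then show ?thesis using True F_le1[of A] F_bounds(1)[of A] by simp
    next
      case False
      then have "Q A = 1" by (intro Q_eq_1[OF AB]) auto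
      then show ?thesis by simp
    qed
    moreover have "\<bar>F A - Psi (S.swap good B A)\<bar> \<le> (\<Sum>e\<in>GG. \<bar>?a e A - ?b e A B\<bar>)"
    proof -
      have "F A = (\<Prod>e\<in>GG. ?a e A)"
        unfolding F_def by (rule prod.mono_neutral_cong_left) (use finG in auto)
      moreover have "norm ((\<Prod>e\<in>GG. ?a e A) - (\<Prod>e\<in>GG. ?b e A B)) \<le> (\<Sum>e\<in>GG. norm (?a e A - ?b e A B))"
      proof (rule norm_prod_diff)
        fix e assume "e \<in> GG"
        show "norm (?a e A) \<le> 1"
          using th_abs_le[OF upl_le[OF G_UE(1)], of e A] xy_pos by auto
        show "norm (?b e A B) \<le> 1" using gw_bounds(1)[of "e \<in> S.swap good B A"] by simp
      qed
      ultimately show ?thesis by (simp add: Psi_def)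
    qed
    ultimately show "\<bar>Q A * F A - Psi (S.swap good B A)\<bar>
      \<le> 2 * of_bool (?V A B) + (\<Sum>e\<in>GG. \<bar>?a e A - ?b e A B\<bar>)"
      by linarith
  qed
  also have "\<dots> = 2 * S.Pr ?V
      + (\<Sum>e\<in>GG. S.PE (\<lambda>A B. \<bar>?a e A - ?b e A B\<bar>))"
    unfolding S.PE_add S.PE_cmult S.Pr_def using S.PE_sum[of GG "\<lambda>e A B. \<bar>?a e A - ?b e A B\<bar>"] finG by simp
  also have "S.Pr ?V
      \<le> (\<Sum>e\<in>GG. S.Pr (if e \<in> G1 then Bd e else NearE e))"
    by (rule S.Pr_le_sum) (use finG G(2) in auto)
  also have "(\<Sum>e\<in>GG. S.Pr (if e \<in> G1 then Bd e else NearE e)) = (\<Sum>e\<in>G1. S.Pr (Bd e)) + (\<Sum>e\<in>Gc. S.Pr (NearE e))"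
    using finG G(2) by (subst sum.union_disjoint) (auto intro!: arg_cong2[where f = "(+)"] sum.cong)
  also have "\<dots> \<le> (\<Sum>e\<in>G1. (c1 + c1\<^sup>2) * x * y ^ 7) + (\<Sum>e\<in>Gc. c1 * x * y ^ 6)"
    by (intro add_mono sum_mono Pr_Bd Pr_NearE)
  also have "(\<Sum>e\<in>GG. S.PE (\<lambda>A B. \<bar>?a e A - ?b e A B\<bar>)) \<le> (\<Sum>e\<in>G1. C2 * (x * y ^ 7)) + (\<Sum>e\<in>Gc. C3 * (x * y ^ 6))"
  proof -
    have "(\<Sum>e\<in>GG. S.PE (\<lambda>A B. \<bar>?a e A - ?b e A B\<bar>)) = (\<Sum>e\<in>G1. S.PE (\<lambda>A B. \<bar>?a e A - ?b e A B\<bar>)) + (\<Sum>e\<in>Gc. S.PE (\<lambda>A B. \<bar>?a e A - ?b e A B\<bar>))"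
      using finG G(2) by (rule sum.union_disjoint)
    also have "\<dots> \<le> (\<Sum>e\<in>G1. C2 * (x * y ^ 7)) + (\<Sum>e\<in>Gc. C3 * (x * y ^ 6))"
    proof (intro add_mono sum_mono)
      fix e assume "e \<in> G1" then show "S.PE (\<lambda>A B. \<bar>?a e A - ?b e A B\<bar>) \<le> C2 * (x * y ^ 7)"
        using PE_edge_diff[of e] by simp
    next
      fix e assume e: "e \<in> Gc"
      then have "e \<notin> G1" using G(2) by auto
      then show "S.PE (\<lambda>A B. \<bar>?a e A - ?b e A B\<bar>) \<le> C3 * (x * y ^ 6)"
        using PE_corner_diff[OF e] by simp
    qed
    finally show ?thesis .
  qed
  finally have "?X
    \<le> 2 * ((\<Sum>e\<in>G1. (c1 + c1\<^sup>2) * x * y ^ 7) + (\<Sum>e\<in>Gc. c1 * x * y ^ 6))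
      + ((\<Sum>e\<in>G1. C2 * (x * y ^ 7)) + (\<Sum>e\<in>Gc. C3 * (x * y ^ 6)))" by simp
  also have "\<dots> = (2 * c1 + 2 * c1\<^sup>2 + C2) * (x * y ^ 6) * (real (card G1) * y) + (2 * c1 + C3) * (x * y ^ 6) * real (card Gc)"
    by (simp add: y7 algebra_simps)
  also have "\<dots> \<le> C4 * (x * y ^ 6) * (real (card GG) * y) + C4 * (x * y ^ 6) * real (card Gc)"
  proof (intro add_mono mult_mono)
    show "2 * c1 + 2 * c1\<^sup>2 + C2 \<le> C4" "2 * c1 + C3 \<le> C4" "0 \<le> C4" "0 \<le> C4 * (x * y ^ 6)"
      using c1_pos K0_pos xy_pos by (simp_all add: C4_def C2_def C3_def)
  qed (use xy_pos cG y x c1_pos K0_pos in \<open>auto simp: C4_def C2_def C3_def\<close>)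
  finally show ?thesis by (simp add: algebra_simps)
qed

lemma wilson_decay: "\<bar>lat.Ex x y PL \<Lambda> (\<lambda>A. (- 1) ^ card (A \<inter> GG))\<bar> \<le> exp (- (x * y ^ 6) * real (card G1))"
proof -
  have "\<bar>lat.Ex x y PL \<Lambda> (\<lambda>A. (- 1) ^ card (A \<inter> GG))\<bar> \<le> S.PE (\<lambda>A B. \<bar>Q A * F A\<bar>)"
    unfolding wilson_eq by (rule S.PE_abs)
  also have "\<dots> \<le> S.PE (\<lambda>A B. exp (- (x * y ^ 6) * real (card G1)))"
  proof (rule S.PE_mono)
    fix A B :: "uedge set"
    have "\<bar>Q A * F A\<bar> = F A" using F_bounds(1)[of A] by (simp add: abs_mult Q_abs)
    also have "\<dots> \<le> (1 - x * y ^ 6) ^ card G1" by (rule F_bounds)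
    also have "\<dots> \<le> exp (- (x * y ^ 6)) ^ card G1"
    proof (rule power_mono)
      show "1 - x * y ^ 6 \<le> exp (- (x * y ^ 6))" using exp_ge_add_one_self[of "- (x * y ^ 6)"] by simp
      show "0 \<le> 1 - x * y ^ 6" using th_abs_le[of 0] by linarith
    qed
    also have "\<dots> = exp (- (x * y ^ 6) * real (card G1))" by (rule exp_power_nat)
    finally show "\<bar>Q A * F A\<bar> \<le> exp (- (x * y ^ 6) * real (card G1))" .
  qed
  finally show ?thesis unfolding S.PE_const .
qed

lemma Psi_bounds: "0 \<le> Psi B" "Psi B \<le> exp (- (x * y ^ 6) * real (card GG))"
proof -
  show "0 \<le> Psi B" by (simp add: Psi_def prod_nonneg)
  have "Psi B \<le> (\<Prod>e\<in>GG. exp (- (x * y ^ 6)))"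
    unfolding Psi_def
  proof (rule prod_mono)
    fix e
    show "0 \<le> exp (- 2 * gw (e \<in> B)) \<and> exp (- 2 * gw (e \<in> B)) \<le> exp (- (x * y ^ 6))"
      using gw_bounds(1,2)[of "e \<in> B"] by auto
  qed
  also have "\<dots> = exp (- (x * y ^ 6) * real (card GG))" by (simp only: prod_constant exp_power_nat)
  finally show "Psi B \<le> exp (- (x * y ^ 6) * real (card GG))" .
qed

lemma Psi_Ex_bounds: "0 \<le> lat.Ex x 0 PL \<Lambda> Psi" "lat.Ex x 0 PL \<Lambda> Psi \<le> exp (- (x * y ^ 6) * real (card GG))"
proof -
  have eq: "lat.Ex x 0 PL \<Lambda> Psi = S.PE (\<lambda>A B. Psi B)" by (simp add: S.PE_snd_Ex)
  show "0 \<le> lat.Ex x 0 PL \<Lambda> Psi" unfolding eq by (rule S.PE_nonneg) (rule Psi_bounds)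
  have "S.PE (\<lambda>A B. Psi B) \<le> S.PE (\<lambda>A B. exp (- (x * y ^ 6) * real (card GG)))"
    by (rule S.PE_mono) (rule Psi_bounds)
  then show "lat.Ex x 0 PL \<Lambda> Psi \<le> exp (- (x * y ^ 6) * real (card GG))" unfolding eq S.PE_const .
qed

end

section \<open>The Wilson loop expectation in infinite volume\<close>

lemma exp_power_real: "exp (c :: real) ^ n = exp (real n * c)"
  by (simp add: exp_of_nat_mult)

text \<open>The shared plaquette is oriented so as to contain \<open>e\<close>; it then contains
  \<open>f\<close> or its reversal.\<close>

lemma corner_isolated:
  assumes \<gamma>: "simple_loop \<gamma>" and e: "e \<in> \<gamma>" "f \<in> \<gamma>" "e \<noteq> f" and adj: "lat.adj (und e) (und f)"
  shows "e \<in> corner_edges \<gamma>"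
proof -
  have nn: "nn_edge e" "nn_edge f" using simple_loopD[OF \<gamma>] e by auto
  have ne: "und e \<noteq> und f" using simple_loop_inj[OF \<gamma>] e by (meson inj_onD)
  obtain p where p: "p \<in> PL" "und e \<in> bdp p" "und f \<in> bdp p" using adj by (auto simp: lat.adj_def)
  have rn: "nn_edge (rev_edge g)" if "nn_edge g" for g
    using that by (rule nn_cases) (auto simp: rev_edge_def nn_edge_pos)
  obtain P where P: "P \<in> plaquettes" "e \<in> P" "und ` P = bdp p" "\<And>g. g \<in> P \<Longrightarrow> nn_edge g"
  proof -
    obtain g where g: "g \<in> posp p" "und g = und e" using p(2) und_posp[of p] by (metis imageE)
    then have "e = g \<or> e = rev_edge g" using und_eqD[OF nn_posp[OF p(1) g(1)] nn(1)] by simp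
    then show thesis
    proof
      assume "e = g"
      then show thesis using that[of "posp p"] g(1) p(1) und_posp nn_posp unfolding plaquettes_eq by blast
    next
      assume eg: "e = rev_edge g"
      have "rev_edge ` posp p \<in> plaquettes" unfolding plaquettes_eq using p(1) by blast
      moreover have "e \<in> rev_edge ` posp p" using eg g(1) by blast
      moreover have "nn_edge h" if "h \<in> rev_edge ` posp p" for h using that nn_posp[OF p(1)] rn by blast
      ultimately show thesis using that und_rev_posp[OF p(1)] by blast
    qed
  qed
  obtain h where h: "h \<in> P" "und h = und f" using p(3) P(3) by (metis imageE)
  then have "h = f \<or> h = rev_edge f" using und_eqD[OF nn(2) P(4)[OF h(1)]] by simp
  then have "h \<in> \<gamma> \<union> rev_edge ` \<gamma>" using e(2) by blast
  moreover have "h \<noteq> e" using h(2) ne by auto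
  ultimately show ?thesis unfolding corner_edges_def using e(1) P(1,2) h(1) by blast
qed

lemma finite_box_cover:
  assumes "finite F" "F \<subseteq> UE"
  shows "\<exists>N0. \<forall>N\<ge>N0. F \<subseteq> EN N"
proof -
  obtain r where "F \<subseteq> int_ed r" using finite_subset_int_ed[OF assms] by blast
  then show ?thesis using int_ed_EN[of r] by (intro exI[of _ "r + 1"]) blast
qed

lemma lim_eq:
  assumes "a \<longlonglongrightarrow> (L :: real)" "\<exists>N0. \<forall>N\<ge>N0. b N = a N"
  shows "lim b = L"
proof -
  have "b \<longlonglongrightarrow> L"
  proof (rule Lim_transform_eventually[OF assms(1)])
    show "eventually (\<lambda>N. a N = b N) sequentially"
      using assms(2) unfolding eventually_sequentially by metis
  qed
  then show ?thesis by (rule limI)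
qed

lemma psi_prod:
  fixes x y :: real
  assumes "finite G"
  shows "(\<Prod>e\<in>G. exp (- 2 * (if e \<in> A then y ^ 6 / x else x * y ^ 6)))
    = exp (- 2 * (real (card (A \<inter> G)) * (y ^ 6 / x) + (real (card G) - real (card (A \<inter> G))) * (x * y ^ 6)))"
proof -
  have "(\<Prod>e\<in>G. exp (- 2 * (if e \<in> A then y ^ 6 / x else x * y ^ 6)))
      = exp (\<Sum>e\<in>G. - 2 * (if e \<in> A then y ^ 6 / x else x * y ^ 6))"
    by (rule exp_sum[OF assms, symmetric])
  also have "(\<Sum>e\<in>G. - 2 * (if e \<in> A then y ^ 6 / x else x * y ^ 6))
      = - 2 * (\<Sum>e\<in>G. if e \<in> A then y ^ 6 / x else x * y ^ 6)"
    by (rule sum_distrib_left[symmetric])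
  also have "(\<Sum>e\<in>G. if e \<in> A then y ^ 6 / x else x * y ^ 6)
      = real (card (G \<inter> {e. e \<in> A})) * (y ^ 6 / x) + real (card (G \<inter> - {e. e \<in> A})) * (x * y ^ 6)"
    unfolding sum.If_cases[OF assms] by simp
  also have "G \<inter> {e. e \<in> A} = A \<inter> G" by auto
  also have "real (card (G \<inter> - {e. e \<in> A})) = real (card G) - real (card (A \<inter> G))"
  proof -
    have "card G = card (A \<inter> G) + card (G \<inter> - {e. e \<in> A})"
      using assms by (subst card_Un_disjoint[symmetric]) (auto intro: arg_cong[where f = card])
    then show ?thesis by simp
  qed
  finally show ?thesis .
qed

text \<open>x y^6 is exp (- 24 \<beta> - 4 \<kappa>), and y^6 / x is exp (8 \<kappa>) times as
  large; k is the number of loop edges with spin 1.\<close>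

lemma Upsilon_integrand:
  fixes \<beta> \<kappa> :: real
  assumes "0 < n"
  shows "exp (- 2 * n * exp (- 24 * \<beta> - 4 * \<kappa>) * (1 + k / n * (exp (8 * \<kappa>) - 1)))
    = exp (- 2 * (k * (exp (- 4 * \<beta>) ^ 6 / exp (- 4 * \<kappa>)) + (n - k) * (exp (- 4 * \<kappa>) * exp (- 4 * \<beta>) ^ 6)))"
proof -
  define E where "E = exp (- 24 * \<beta> - 4 * \<kappa>)"
  have 1: "exp (- 4 * \<kappa>) * exp (- 4 * \<beta>) ^ 6 = E"
    unfolding exp_power_real E_def exp_add[symmetric] by simp
  have 2: "exp (- 4 * \<beta>) ^ 6 / exp (- 4 * \<kappa>) = E * exp (8 * \<kappa>)"
    unfolding exp_power_real E_def exp_add[symmetric] exp_diff[symmetric] by simp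
  have "n * E * (1 + k / n * (exp (8 * \<kappa>) - 1)) = k * (E * exp (8 * \<kappa>)) + (n - k) * E"
    using assms by (simp add: field_simps)
  then show ?thesis unfolding 1 2 E_def[symmetric] by (simp add: mult.assoc)
qed

lemma limit_estimates:
  fixes \<beta> \<kappa> K0 :: real
  defines "x \<equiv> exp (- 4 * \<kappa>)" and "y \<equiv> exp (- 4 * \<beta>)"
  assumes q: "324 * (2 * x + x\<^sup>2) < 1" "1 / (1 - 324 * (2 * x + x\<^sup>2)) \<le> K0"
    and \<beta>: "0 \<le> \<beta>" "2 * \<kappa> \<le> 3 * \<beta>" and \<gamma>: "simple_loop \<gamma>"
  defines "n \<equiv> real (card \<gamma>)" and "m \<equiv> real (card (corner_edges \<gamma>))"
  shows "\<bar>wilson_lim \<beta> \<kappa> \<gamma> - Upsilon \<gamma> \<beta> \<kappa>\<bar> \<le> main_est.C4 K0 * (x * y ^ 6) * (n * y + m)"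
    and "\<bar>wilson_lim \<beta> \<kappa> \<gamma>\<bar> \<le> exp (- (x * y ^ 6) * (n - m))"
    and "0 \<le> Upsilon \<gamma> \<beta> \<kappa>" "Upsilon \<gamma> \<beta> \<kappa> \<le> exp (- (x * y ^ 6) * n)"
proof -
  define Gc where "Gc = und ` corner_edges \<gamma>"
  define G1 where "G1 = und ` \<gamma> - Gc"
  let ?G = "und ` \<gamma>"
  have fin: "finite \<gamma>" and nn: "\<forall>e\<in>\<gamma>. nn_edge e" using simple_loopD[OF \<gamma>] by auto
  have inj: "inj_on und \<gamma>" by (rule simple_loop_inj[OF \<gamma>])
  have csub: "corner_edges \<gamma> \<subseteq> \<gamma>" by (auto simp: corner_edges_def)
  have ne: "\<gamma> \<noteq> {}" by (rule simple_loop_nonempty[OF \<gamma>])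
  have GG: "G1 \<union> Gc = ?G" using csub by (auto simp: G1_def Gc_def)
  have finG: "finite ?G" using fin by simp
  have GUE: "?G \<subseteq> UE" using nn und_UE by blast
  have cG: "card ?G = card \<gamma>" by (rule card_image[OF inj])
  have cGc: "card Gc = card (corner_edges \<gamma>)"
    unfolding Gc_def by (rule card_image[OF inj_on_subset[OF inj csub]])
  have cG1: "real (card G1) = n - m"
  proof -
    have "card (G1 \<union> Gc) = card G1 + card Gc"
      by (rule card_Un_disjoint) (use finG GG in \<open>auto simp: G1_def intro: finite_subset\<close>)
    then show ?thesis unfolding GG cG cGc n_def m_def by simp
  qed
  have x: "0 < x" and y: "0 < y" "y \<le> 1" and yx: "y ^ 3 \<le> x\<^sup>2"
    using \<beta> by (simp_all add: x_def y_def exp_power_real)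
  have isol: "\<not> lat.adj e f" if ef: "e \<in> G1" "f \<in> G1" "e \<noteq> f" for e f
  proof
    assume adj: "lat.adj e f"
    obtain e' f' where e': "e' \<in> \<gamma>" "f' \<in> \<gamma>" "e = und e'" "f = und f'"
      using ef(1,2) unfolding G1_def by blast
    have "e' \<in> corner_edges \<gamma>" by (rule corner_isolated[OF \<gamma> e'(1,2)]) (use ef adj e' in auto)
    then show False using ef(1) e'(3) by (auto simp: G1_def Gc_def)
  qed
  obtain N0 where N0: "\<And>N. N \<ge> N0 \<Longrightarrow> ?G \<subseteq> EN N" using finite_box_cover[OF finG GUE] by blast
  have me: "main_est x y K0 (EN M) G1 Gc" if "M \<ge> N0" for M
  proof
    show "even (card (A \<inter> (G1 \<union> Gc)))" if "finite A" "cb A = {}" for A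
      unfolding GG by (rule flat_loop_parity[OF \<gamma> that])
    show "G1 \<union> Gc \<subseteq> EN M" unfolding GG by (rule N0[OF that])
    show "G1 \<inter> Gc = {}" by (auto simp: G1_def)
  qed (use x y yx q isol finite_EN EN_UE in auto)
  let ?W = "\<lambda>A. (- 1 :: real) ^ card (A \<inter> ?G)"
  define \<Psi> where "\<Psi> A = (\<Prod>e\<in>?G. exp (- 2 * (if e \<in> A then y ^ 6 / x else x * y ^ 6)))" for A
  have Psi: "main_est.Psi x y G1 Gc = \<Psi>" if "M \<ge> N0" for M
    unfolding main_est.Psi_def[OF me[OF that]] main_est.gw_def[OF me[OF that]] \<Psi>_def GG ..
  have Psi_le: "\<bar>\<Psi> A\<bar> \<le> 1" for A
  proof -
    have "0 \<le> y ^ 6 / x" "0 \<le> x * y ^ 6" using x y by auto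
    then have "\<Psi> A \<le> 1" "0 \<le> \<Psi> A" unfolding \<Psi>_def by (auto intro!: prod_le_1 prod_nonneg)
    then show ?thesis by simp
  qed
  \<comment> \<open>The sequence with the plaquettes of the box defines the quantity in question,
    the one with all plaquettes carries the estimates.\<close>
  obtain LW where LW: "(\<lambda>N. lat.Ex x y (PN N) (EN N) ?W) \<longlonglongrightarrow> LW" "(\<lambda>M. lat.Ex x y PL (EN M) ?W) \<longlonglongrightarrow> LW"
    using limit_free[OF x q(1) less_imp_le[OF y(1)] y(2) finG GUE, of ?W]
    by (auto simp: power_abs Int_assoc)
  have "\<Psi> A = \<Psi> (A \<inter> ?G)" for A unfolding \<Psi>_def by (rule prod.cong) auto
  then obtain LP where LP: "(\<lambda>N. lat.Ex x 0 (PN N) (EN N) \<Psi>) \<longlonglongrightarrow> LP" "(\<lambda>M. lat.Ex x 0 PL (EN M) \<Psi>) \<longlonglongrightarrow> LP"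
    using limit_free[OF x q(1) order_refl zero_le_one finG GUE, of \<Psi>] Psi_le by blast
  have W: "wilson_lim \<beta> \<kappa> \<gamma> = LW"
    unfolding wilson_lim_def
  proof (rule lim_eq[OF LW(1)])
    show "\<exists>N0. \<forall>N\<ge>N0. higgs_exp N \<beta> \<kappa> (\<lambda>\<sigma> \<phi>. wilson \<gamma> \<sigma>) = lat.Ex x y (PN N) (EN N) ?W"
      using higgs_exp_eq[OF \<gamma> N0] unfolding x_def y_def by blast
  qed
  have U: "Upsilon \<gamma> \<beta> \<kappa> = LP"
    unfolding Upsilon_def gauge_lim_def
  proof (rule lim_eq[OF LP(1)], intro exI[of _ N0] allI impI)
    fix N assume N: "N0 \<le> N"
    have n0: "0 < real (card \<gamma>)" using ne fin by (simp add: card_gt_0_iff)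
    have "exp (- 2 * real (card \<gamma>) * exp (- 24 * \<beta> - 4 * \<kappa>) *
        (1 + real (card {e \<in> \<gamma>. sg N A e = 1}) / real (card \<gamma>) * (exp (8 * \<kappa>) - 1))) = \<Psi> A" for A
    proof -
      have "A \<inter> ?G = und ` {e \<in> \<gamma>. und e \<in> A}" by auto
      then have "card (A \<inter> ?G) = card {e \<in> \<gamma>. und e \<in> A}"
        using card_image[OF inj_on_subset[OF inj], of "{e \<in> \<gamma>. und e \<in> A}"] by simp
      then show ?thesis
        unfolding wilson_sg(2)[OF \<gamma> N0[OF N]] Upsilon_integrand[OF n0] \<Psi>_def psi_prod[OF finG] x_def y_def cG
        by simp
    qed
    then show "gauge_exp N \<kappa> (\<lambda>\<sigma>. exp (- 2 * real (card \<gamma>) * exp (- 24 * \<beta> - 4 * \<kappa>) *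
        (1 + real (card {e \<in> \<gamma>. \<sigma> e = 1}) / real (card \<gamma>) * (exp (8 * \<kappa>) - 1)))) = lat.Ex x 0 (PN N) (EN N) \<Psi>"
      unfolding gauge_exp_eq x_def by simp
  qed
  have le: "L \<le> c" if "a \<longlonglongrightarrow> L" "\<And>M. M \<ge> N0 \<Longrightarrow> a M \<le> c" for a and L c :: real
    using that by (intro LIMSEQ_le_const2) auto
  show "\<bar>wilson_lim \<beta> \<kappa> \<gamma> - Upsilon \<gamma> \<beta> \<kappa>\<bar> \<le> main_est.C4 K0 * (x * y ^ 6) * (n * y + m)"
    unfolding W U
  proof (rule le[OF tendsto_rabs[OF tendsto_diff[OF LW(2) LP(2)]]])
    fix M assume M: "N0 \<le> M"
    show "\<bar>lat.Ex x y PL (EN M) ?W - lat.Ex x 0 PL (EN M) \<Psi>\<bar> \<le> main_est.C4 K0 * (x * y ^ 6) * (n * y + m)"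
      using main_est.main_bound[OF me[OF M]] unfolding Psi[OF M] GG cG cGc n_def m_def .
  qed
  show "\<bar>wilson_lim \<beta> \<kappa> \<gamma>\<bar> \<le> exp (- (x * y ^ 6) * (n - m))"
    unfolding W
  proof (rule le[OF tendsto_rabs[OF LW(2)]])
    fix M assume M: "N0 \<le> M"
    show "\<bar>lat.Ex x y PL (EN M) ?W\<bar> \<le> exp (- (x * y ^ 6) * (n - m))"
      using main_est.wilson_decay[OF me[OF M]] unfolding GG cG1 .
  qed
  show "0 \<le> Upsilon \<gamma> \<beta> \<kappa>"
    using LIMSEQ_le_const[OF LP(2), of 0] main_est.Psi_Ex_bounds(1)[OF me] Psi unfolding U by auto
  show "Upsilon \<gamma> \<beta> \<kappa> \<le> exp (- (x * y ^ 6) * n)"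
    unfolding U
  proof (rule le[OF LP(2)])
    fix M assume M: "N0 \<le> M"
    show "lat.Ex x 0 PL (EN M) \<Psi> \<le> exp (- (x * y ^ 6) * n)"
      using main_est.Psi_Ex_bounds(2)[OF me[OF M]] unfolding Psi[OF M] GG cG n_def .
  qed
qed

text \<open>The second bound is used for \<open>lam\<close> up to \<open>D powr (- 1/2)\<close>, the third one beyond.\<close>
lemma interpolate:
  fixes C L lam D y r :: real
  assumes L: "L \<le> 2" "L \<le> C * lam * (y + r)" "L \<le> 2 * exp (- lam * (1 - r))"
    and nonneg: "0 \<le> C" "0 \<le> lam" "0 < D"
    and y: "0 \<le> y" "y \<le> D powr (4/5)" and r: "0 \<le> r" "r \<le> D\<^sup>2"
  shows "L \<le> (2 * C + 4) * D powr (2/7)"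
\<comment> \<open>For D \<ge> 1/2 the trivial bound 2 suffices. Below, r \<le> D^2 < 1/2 keeps 1 - r
  away from 0.\<close>
proof (cases "1 / 2 \<le> D")
  case True
  have "1 / 2 = (1 / 2 :: real) powr 1" by simp
  also have "\<dots> \<le> (1 / 2) powr (2/7)" by (rule powr_mono') auto
  also have "\<dots> \<le> D powr (2/7)" by (rule powr_mono2) (use True in auto)
  finally have "2 \<le> 4 * D powr (2/7)" by simp
  moreover have "0 \<le> 2 * C * D powr (2/7)" using nonneg by simp
  ultimately show ?thesis using L(1) by (simp add: distrib_right)
next
  case False
  then have D: "0 < D" "D \<le> 1" "D < 1 / 2" using nonneg by auto
  have mono: "D powr a \<le> D powr b" if "b \<le> a" for a b by (rule powr_mono') (use that D in auto)
  have D2: "D\<^sup>2 = D powr 2" using D by simp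
  have r1: "r \<le> D powr (4/5)" using r(2) mono[of "4/5" 2] unfolding D2 by simp
  have "D * D \<le> 1 / 2 * 1" by (rule mult_mono) (use D in auto)
  then have r2: "r \<le> 1 / 2" using r(2) by (simp add: power2_eq_square)
  show ?thesis
  proof (cases "lam \<le> D powr (- 1/2)")
    case True
    have "L \<le> C * lam * (y + r)" by (rule L(2))
    also have "\<dots> \<le> C * D powr (- 1/2) * (D powr (4/5) + D powr (4/5))"
      by (intro mult_mono add_mono mult_left_mono) (use True nonneg y r r1 in auto)
    also have "\<dots> = 2 * C * (D powr (- 1/2) * D powr (4/5))" by simp
    also have "D powr (- 1/2) * D powr (4/5) = D powr (3/10)" by (simp add: powr_add[symmetric])
    also have "2 * C * D powr (3/10) \<le> 2 * C * D powr (2/7)"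
      by (intro mult_left_mono mono) (use nonneg in auto)
    also have "\<dots> \<le> (2 * C + 4) * D powr (2/7)" by (rule mult_right_mono) auto
    finally show ?thesis .
  next
    case False
    then have lam: "D powr (- 1/2) < lam" by simp
    have pos: "0 < D powr (- 1/2)" using D by simp
    have lam0: "0 < lam" using lam pos by linarith
    have "lam * (1 / 2) \<le> lam * (1 - r)" by (rule mult_left_mono) (use r2 lam0 in auto)
    then have "exp (- lam * (1 - r)) \<le> exp (- (lam / 2))" by simp
    also have "\<dots> \<le> 1 / (lam / 2)"
    proof -
      have "lam / 2 \<le> exp (lam / 2)" using exp_ge_add_one_self[of "lam / 2"] by linarith
      then have "1 / exp (lam / 2) \<le> 1 / (lam / 2)" using lam0 by (intro divide_left_mono) auto
      then show ?thesis by (simp add: exp_minus inverse_eq_divide)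
    qed
    also have "\<dots> \<le> 2 / D powr (- 1/2)" using lam pos lam0 by (simp add: frac_le)
    also have "\<dots> = 2 * D powr (1/2)" by (simp add: powr_minus field_simps)
    also have "\<dots> \<le> 2 * D powr (2/7)" by (intro mult_left_mono mono) auto
    finally have "L \<le> 4 * D powr (2/7)" using L(3) by linarith
    also have "\<dots> \<le> (2 * C + 4) * D powr (2/7)" by (rule mult_right_mono) (use nonneg in auto)
    finally show ?thesis .
  qed
qed

section \<open>Uniformity in the couplings and the final exponent\<close>

theorem mainTheorem1:
  fixes \<beta>0 \<kappa>0 :: real
  assumes "\<beta>0 \<ge> 0" and "\<kappa>0 \<ge> 0"
    and a1: "exp (- 4 * \<beta>0) + 4 * exp (- 4 * \<kappa>0) < 1"
    and a2: "2 powr (1/3) * 5 * exp (- 4 * \<beta>0) * exp (- 4 * \<kappa>0 / 6) < 1"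
    and a3: "18^2 * exp (- 4 * \<kappa>0) * (2 + exp (- 4 * \<kappa>0)) < 1"
  shows "\<exists>C::real. \<forall>\<beta> \<kappa> \<gamma>. \<beta> \<ge> \<beta>0 \<longrightarrow> \<kappa> \<ge> \<kappa>0 \<longrightarrow> 3 * \<beta> \<ge> 2 * \<kappa> \<longrightarrow> simple_loop \<gamma> \<longrightarrow>
     \<bar>wilson_lim \<beta> \<kappa> \<gamma> - Upsilon \<gamma> \<beta> \<kappa>\<bar>
       \<le> C * (exp (- 4 * (\<beta> + \<kappa> / 6))
              + sqrt (real (card (corner_edges \<gamma>)) / real (card \<gamma>))) powr (2/7)"
proof -
  define x0 where "x0 = exp (- 4 * \<kappa>0)"
  \<comment> \<open>The value at \<kappa>0 serves all \<kappa> \<ge> \<kappa>0, since x decreases in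
    \<kappa>.\<close>
  define K0 where "K0 = 1 / (1 - 324 * (2 * x0 + x0\<^sup>2))"
  define C where "C = \<bar>main_est.C4 K0\<bar>"
  have q0: "324 * (2 * x0 + x0\<^sup>2) < 1"
    using a3 by (simp add: x0_def power2_eq_square algebra_simps)
  show ?thesis
  proof (intro exI[of _ "2 * C + 4"] allI impI)
    fix \<beta> \<kappa> :: real and \<gamma>
    assume \<beta>: "\<beta> \<ge> \<beta>0" and \<kappa>: "\<kappa> \<ge> \<kappa>0" and \<beta>\<kappa>: "3 * \<beta> \<ge> 2 * \<kappa>" and \<gamma>: "simple_loop \<gamma>"
    define x where "x = exp (- 4 * \<kappa>)"
    define y where "y = exp (- 4 * \<beta>)"
    define n where "n = real (card \<gamma>)"
    define m where "m = real (card (corner_edges \<gamma>))"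
    define \<epsilon> where "\<epsilon> = exp (- 4 * (\<beta> + \<kappa> / 6))"
    define r where "r = m / n"
    define D where "D = \<epsilon> + sqrt r"
    define lam where "lam = n * (x * y ^ 6)"
    have fin: "finite \<gamma>" using simple_loopD[OF \<gamma>] by blast
    have n: "0 < n" using fin simple_loop_nonempty[OF \<gamma>] by (simp add: n_def card_gt_0_iff)
    have m: "0 \<le> m" "m \<le> n"
      unfolding n_def m_def using fin by (auto intro!: card_mono simp: corner_edges_def)
    have x: "0 < x" "x \<le> x0" and y: "0 < y" "y \<le> 1"
      using assms(1) \<beta> \<kappa> by (simp_all add: x_def x0_def y_def)
    have "2 * x + x\<^sup>2 \<le> 2 * x0 + x0\<^sup>2" using x by (intro add_mono mult_left_mono power_mono) auto
    then have q: "324 * (2 * x + x\<^sup>2) < 1" "1 / (1 - 324 * (2 * x + x\<^sup>2)) \<le> K0"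
      unfolding K0_def using q0 by (auto intro!: divide_left_mono mult_pos_pos)
    have \<beta>0: "0 \<le> \<beta>" using assms(1) \<beta> by simp
    note est = limit_estimates[where \<beta> = \<beta> and \<kappa> = \<kappa>, folded x_def y_def n_def m_def, OF q \<beta>0 \<beta>\<kappa> \<gamma>, folded n_def m_def]
    let ?L = "\<bar>wilson_lim \<beta> \<kappa> \<gamma> - Upsilon \<gamma> \<beta> \<kappa>\<bar>"
    have xy: "0 < x * y ^ 6" using x y by simp
    have r: "0 \<le> r" using m n by (simp add: r_def)
    have \<epsilon>: "0 < \<epsilon>" by (simp add: \<epsilon>_def)
    have "x * y ^ 6 * (n - m) \<le> x * y ^ 6 * n" by (rule mult_left_mono) (use xy m in auto)
    then have e1: "exp (- (x * y ^ 6) * (n - m)) \<le> 1" "exp (- (x * y ^ 6) * n) \<le> exp (- (x * y ^ 6) * (n - m))"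
      using xy m by (simp_all add: mult_nonneg_nonneg)
    have eq: "- (x * y ^ 6) * (n - m) = - lam * (1 - r)"
      using n by (simp add: lam_def r_def field_simps)
    have L3: "?L \<le> 2 * exp (- lam * (1 - r))"
      using est(2-4) e1 unfolding eq by linarith
    have L1: "?L \<le> 2" using L3 e1(1) unfolding eq by linarith
    have L2: "?L \<le> C * lam * (y + r)"
    proof -
      have "?L \<le> main_est.C4 K0 * ((x * y ^ 6) * (n * y + m))" using est(1) by (simp only: mult.assoc)
      also have "\<dots> \<le> C * ((x * y ^ 6) * (n * y + m))"
        unfolding C_def by (rule mult_right_mono) (use xy n y m in auto)
      also have "n * y + m = n * (y + r)" using n by (simp add: r_def field_simps)
      finally show ?thesis by (simp add: lam_def mult_ac)
    qed
    have "\<epsilon> \<le> D" using r by (simp add: D_def)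
    \<comment> \<open>\<epsilon> is y x^(1/6), so this says y^(1/5) \<le> x^(2/15), the fifteenth
      root of y^3 \<le> x^2.\<close>
    have "y \<le> \<epsilon> powr (4/5)"
      using \<beta>\<kappa> by (simp add: y_def \<epsilon>_def powr_def)
    also have "\<dots> \<le> D powr (4/5)" by (rule powr_mono2) (use \<epsilon> \<open>\<epsilon> \<le> D\<close> in auto)
    finally have yD: "y \<le> D powr (4/5)" .
    have "(sqrt r)\<^sup>2 \<le> D\<^sup>2" by (rule power_mono) (use r \<epsilon> in \<open>auto simp: D_def\<close>)
    then have rD: "r \<le> D\<^sup>2" using r by simp
    have "?L \<le> (2 * C + 4) * D powr (2/7)"
      by (rule interpolate[OF L1 L2 L3 _ _ _ _ yD r rD]) (use xy n y \<epsilon> \<open>\<epsilon> \<le> D\<close> in \<open>auto simp: C_def lam_def\<close>)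
    then show "?L \<le> (2 * C + 4) * (exp (- 4 * (\<beta> + \<kappa> / 6)) + sqrt (real (card (corner_edges \<gamma>)) / real (card \<gamma>))) powr (2/7)"
      unfolding D_def \<epsilon>_def r_def m_def n_def .
  qed
qed

end
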